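(* Let $k$ be an infinite field, $H$ a Hopf algebra over $k$, and $\alpha:H\times H\to k$ a normalized convolution-invertible two-cocycle. Let $\mu_\sigma=\varphi^{-1}\circ\mu_\alpha:\mathcal U_H^{\alpha}\to S(t_H)_\Theta\otimes{}^{\sigma}H$, which is an injective $H$-comodule algebra morphism. Then: (a) $\mu_\sigma(X_h)=1\otimes h$ for all $h\in H$. (b) The morphism $\mu_\sigma$ maps $\mathcal U_H^{\alpha}$ into $\mathcal A_H^{\alpha}$.
   Context: All algebras are associative unital $k$-algebras; unadorned tensor products are over $k$; $\Delta$, $\varepsilon$ are the comultiplication and counit of $H$, with Sweedler notation. An $H$-comodule algebra is an algebra with a right $H$-coaction that is an algebra morphism; morphisms are algebra morphisms that are comodule maps. Cocycles and twisted algebras: let $R$ be a commutative algebra. A two-cocycle with values in $R$ is a bilinear map $\alpha:H\times H\to R$ with $\sum\alpha(x_{(1)},y_{(1)})\alpha(x_{(2)}y_{(2)},z)=\sum\alpha(y_{(1)},z_{(1)})\alpha(x,y_{(2)}z_{(2)})$ for all $x,y,z\in H$; it is normalized if $\alpha(x,1)=\alpha(1,x)=\varepsilon(x)1$, and convolution-invertible if it is invertible for convolution in $\operatorname{Hom}(H\otimes H,R)$. The twisted algebra $R\otimes{}^{\alpha}H$ is $R\otimes H$ with product $(b\otimes x)\cdot_\alpha(c\otimes y)=\sum bc\,\alpha(x_{(1)},y_{(1)})\otimes x_{(2)}y_{(2)}$ and coaction $\mathrm{id}_R\otimes\Delta$. For $R=k$ write ${}^{\alpha}H=k\otimes{}^{\alpha}H$.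 Universal cocycle: let $t_H$ be a copy of the vector space $H$ (with identity map $h\mapsto t_h$), $S(t_H)$ its symmetric algebra, $K_H$ the field of fractions of $S(t_H)$. Let $t^{-1}:H\to K_H$, $h\mapsto t_h^{-1}$, be the unique linear map with $\sum t_{h_{(1)}}t^{-1}_{h_{(2)}}=\sum t^{-1}_{h_{(1)}}t_{h_{(2)}}=\varepsilon(h)1$ for all $h\in H$ (it exists; note that $t^{-1}_h$ is in general not $1/t_h$). $S(t_H)_{\Theta}$ is the subalgebra of $K_H$ generated by all $t_h$ and $t_h^{-1}$, $h\in H$. Define $\sigma:H\times H\to S(t_H)_{\Theta}$ by $\sigma(x,y)=\sum t_{x_{(1)}}t_{y_{(1)}}\alpha(x_{(2)},y_{(2)})t^{-1}_{x_{(3)}y_{(3)}}$; it is a convolution-invertible two-cocycle with convolution inverse $\sigma^{-1}(x,y)=\sum t_{x_{(1)}y_{(1)}}\alpha^{-1}(x_{(2)},y_{(2)})t^{-1}_{x_{(3)}}t^{-1}_{y_{(3)}}$. $\mathcal B_H^{\alpha}\subset S(t_H)_{\Theta}$ is the subalgebra generated by all values of $\sigma$ and $\sigma^{-1}$, and $\mathcal A_H^{\alpha}=\mathcal B_H^{\alpha}\otimes{}^{\sigma}H\subset S(t_H)_\Theta\otimes{}^{\sigma}H$; both twisted algebras have unit $t_1^{-1}\otimes1$. The map $\varphi:S(t_H)_\Theta\otimes{}^{\sigma}H\to S(t_H)_\Theta\otimes{}^{\alpha}H$, $\varphi(b\otimes h)=\sum b\,t_{h_{(1)}}\otimes h_{(2)}$,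 is an $S(t_H)_\Theta$-linear isomorphism of $H$-comodule algebras with inverse $\varphi^{-1}(b\otimes h)=\sum b\,t^{-1}_{h_{(1)}}\otimes h_{(2)}$. Identities: $X_H$ is a copy of $H$ (with identity map $h\mapsto X_h$); $T(X_H)$ is the tensor algebra, an $H$-comodule algebra with coaction determined by $\delta(X_h)=\sum X_{h_{(1)}}\otimes h_{(2)}$. $I_H({}^{\alpha}H)$ is the ideal of those $P\in T(X_H)$ with $\mu(P)=0$ for all $H$-comodule algebra morphisms $\mu:T(X_H)\to{}^{\alpha}H$, and $\mathcal U_H^{\alpha}=T(X_H)/I_H({}^{\alpha}H)$; the class of $X_h$ is again denoted $X_h$. The algebra morphism $T(X_H)\to S(t_H)\otimes{}^{\alpha}H$, $X_h\mapsto\sum t_{h_{(1)}}\otimes h_{(2)}$, induces an injective $H$-comodule algebra morphism $\mu_\alpha:\mathcal U_H^{\alpha}\to S(t_H)\otimes{}^{\alpha}H\subset S(t_H)_\Theta\otimes{}^{\alpha}H$. *)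

theory Defs
  imports Complex_Main "HOL-Algebra.QuotRing" "HOL-Algebra.Module" "HOL-Library.Poly_Mapping"
begin

section \<open>Algebras over a field\<close>

text \<open>
  The ground field is a type \<open>'k :: field\<close>.  A \<open>'k\<close>-algebra is a record of type
  \<open>('k, 'a) module\<close> from HOL-Algebra: a ring together with a scalar multiplication.
  The algebras whose carrier is a whole type (the ground field, the Hopf algebra, the field of
  fractions of the symmetric algebra) are given by the type class operations and a scaling.
\<close>

definition alg_of :: "('k \<Rightarrow> 'a \<Rightarrow> 'a) \<Rightarrow> ('k, 'a::ring_1) module" where
  "alg_of s = \<lparr>carrier = UNIV, mult = (*), one = 1, zero = 0, add = (+), smult = s\<rparr>"

definition alg_hom :: "('k, 'a) module \<Rightarrow> ('k, 'b) module \<Rightarrow> ('a \<Rightarrow> 'b) set" where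
  "alg_hom A B = {f \<in> ring_hom A B.
     \<forall>c. \<forall>x\<in>carrier A. f (c \<odot>\<^bsub>A\<^esub> x) = c \<odot>\<^bsub>B\<^esub> f x}"

definition quot_alg :: "('k, 'a) module \<Rightarrow> 'a set \<Rightarrow> ('k, 'a set) module" where
  "quot_alg A I = ring.extend (A Quot I)
     (module.fields (\<lambda>c C. \<Union>x\<in>C. I +>\<^bsub>A\<^esub> (c \<odot>\<^bsub>A\<^esub> x)))"

definition subalgebra :: "('k \<Rightarrow> 'a \<Rightarrow> 'a) \<Rightarrow> 'a::ring_1 set \<Rightarrow> bool" where
  "subalgebra s B \<longleftrightarrow> 1 \<in> B \<and> (\<forall>x\<in>B. \<forall>y\<in>B. x + y \<in> B \<and> x * y \<in> B) \<and> (\<forall>c. \<forall>x\<in>B. s c x \<in> B)"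

definition generated_subalgebra :: "('k \<Rightarrow> 'a \<Rightarrow> 'a) \<Rightarrow> 'a::ring_1 set \<Rightarrow> 'a set" where
  "generated_subalgebra s X = \<Inter>{B. subalgebra s B \<and> X \<subseteq> B}"


section \<open>Tensor products\<close>

definition fscale :: "'k \<Rightarrow> ('x \<Rightarrow>\<^sub>0 'k) \<Rightarrow> ('x \<Rightarrow>\<^sub>0 'k::field)" where
  "fscale c p = Poly_Mapping.map ((*) c) p"

text \<open>
  \<open>V \<otimes> W\<close> is the vector space with basis \<open>V \<times> W\<close> modulo the span of the bilinearity relations;
  its elements are the cosets \<open>tcoset V W p\<close> of formal linear combinations \<open>p\<close> of pairs.
\<close>

definition tensor_relations ::
  "('k::field, 'v) module \<Rightarrow> ('k, 'w) module \<Rightarrow> ('v \<times> 'w \<Rightarrow>\<^sub>0 'k) set" where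
  "tensor_relations V W =
     {Poly_Mapping.single (v \<oplus>\<^bsub>V\<^esub> v', w) 1 - Poly_Mapping.single (v, w) 1
        - Poly_Mapping.single (v', w) 1 | v v' w. v \<in> carrier V \<and> v' \<in> carrier V \<and> w \<in> carrier W}
   \<union> {Poly_Mapping.single (v, w \<oplus>\<^bsub>W\<^esub> w') 1 - Poly_Mapping.single (v, w) 1
        - Poly_Mapping.single (v, w') 1 | v w w'. v \<in> carrier V \<and> w \<in> carrier W \<and> w' \<in> carrier W}
   \<union> {Poly_Mapping.single (c \<odot>\<^bsub>V\<^esub> v, w) 1 - Poly_Mapping.single (v, w) c
        | c v w. v \<in> carrier V \<and> w \<in> carrier W}
   \<union> {Poly_Mapping.single (v, c \<odot>\<^bsub>W\<^esub> w) 1 - Poly_Mapping.single (v, w) c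
        | c v w. v \<in> carrier V \<and> w \<in> carrier W}"

definition tensor_null ::
  "('k::field, 'v) module \<Rightarrow> ('k, 'w) module \<Rightarrow> ('v \<times> 'w \<Rightarrow>\<^sub>0 'k) set" where
  "tensor_null V W = Modules.module.span fscale (tensor_relations V W)"

definition tcoset ::
  "('k::field, 'v) module \<Rightarrow> ('k, 'w) module \<Rightarrow> ('v \<times> 'w \<Rightarrow>\<^sub>0 'k) \<Rightarrow> ('v \<times> 'w \<Rightarrow>\<^sub>0 'k) set" where
  "tcoset V W p = {q. q - p \<in> tensor_null V W}"

definition tens ::
  "('k::field, 'v) module \<Rightarrow> ('k, 'w) module \<Rightarrow> 'v \<Rightarrow> 'w \<Rightarrow> ('v \<times> 'w \<Rightarrow>\<^sub>0 'k) set" where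
  "tens V W v w = tcoset V W (Poly_Mapping.single (v, w) 1)"

text \<open>
  \<open>tlift Z f\<close> is the linear map \<open>V \<otimes> W \<rightarrow> Z\<close> with \<open>v \<otimes> w \<mapsto> f v w\<close> for a bilinear \<open>f\<close>, computed on
  an arbitrary representative of the coset (all of them give the same value).
\<close>

definition formal_sum :: "('k, 'z) module \<Rightarrow> ('v \<Rightarrow> 'w \<Rightarrow> 'z) \<Rightarrow> ('v \<times> 'w \<Rightarrow>\<^sub>0 'k::field) \<Rightarrow> 'z" where
  "formal_sum Z f p =
     (\<Oplus>\<^bsub>Z\<^esub>a\<in>Poly_Mapping.keys p. Poly_Mapping.lookup p a \<odot>\<^bsub>Z\<^esub> f (fst a) (snd a))"

definition tlift :: "('k, 'z) module \<Rightarrow> ('v \<Rightarrow> 'w \<Rightarrow> 'z) \<Rightarrow> ('v \<times> 'w \<Rightarrow>\<^sub>0 'k::field) set \<Rightarrow> 'z" where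
  "tlift Z f C = formal_sum Z f (SOME p. p \<in> C)"

definition tensor_space ::
  "('k::field, 'v) module \<Rightarrow> ('k, 'w) module \<Rightarrow> ('k, ('v \<times> 'w \<Rightarrow>\<^sub>0 'k) set) module" where
  "tensor_space V W =
     \<lparr>carrier = tcoset V W ` {p. Poly_Mapping.keys p \<subseteq> carrier V \<times> carrier W},
      mult = undefined, one = undefined,
      zero = tcoset V W 0,
      add = (\<lambda>C D. \<Union>p\<in>C. \<Union>q\<in>D. tcoset V W (p + q)),
      smult = (\<lambda>c C. \<Union>p\<in>C. tcoset V W (fscale c p))\<rparr>"

definition tensor_alg ::
  "('k::field, 'v) module \<Rightarrow> ('k, 'w) module \<Rightarrow> ('k, ('v \<times> 'w \<Rightarrow>\<^sub>0 'k) set) module" where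
  "tensor_alg A B = (tensor_space A B)
     \<lparr>mult := (\<lambda>P Q. tlift (tensor_space A B) (\<lambda>a b. tlift (tensor_space A B)
                (\<lambda>a' b'. tens A B (a \<otimes>\<^bsub>A\<^esub> a') (b \<otimes>\<^bsub>B\<^esub> b')) Q) P),
      one := tens A B \<one>\<^bsub>A\<^esub> \<one>\<^bsub>B\<^esub>\<rparr>"


section \<open>Hopf algebras and comodule algebras\<close>

record (overloaded) ('k::zero, 'h) hopf_data =
  hscale :: "'k \<Rightarrow> 'h \<Rightarrow> 'h"
  comul :: "'h \<Rightarrow> ('h \<times> 'h \<Rightarrow>\<^sub>0 'k) set"
  counit :: "'h \<Rightarrow> 'k"
  antipode :: "'h \<Rightarrow> 'h"

definition ground_alg :: "('k, 'k::field) module" where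
  "ground_alg = alg_of (*)"

definition hopf_alg :: "('k::field, 'h::ring_1) hopf_data \<Rightarrow> ('k, 'h) module" where
  "hopf_alg H = alg_of (hscale H)"

text \<open>
  Sweedler sums \<open>\<Sum> f h\<^sub>1 h\<^sub>2\<close> in \<open>Z\<close>, the sums \<open>\<Sum> f h\<^sub>1 h\<^sub>2 h\<^sub>3\<close> over the iterated comultiplication,
  and the corresponding sums for two elements.
\<close>

definition sweedler ::
  "('k::field, 'h) hopf_data \<Rightarrow> ('k, 'z) module \<Rightarrow> ('h \<Rightarrow> 'h \<Rightarrow> 'z) \<Rightarrow> 'h \<Rightarrow> 'z" where
  "sweedler H Z f h = tlift Z f (comul H h)"

definition sweedler3 ::
  "('k::field, 'h) hopf_data \<Rightarrow> ('k, 'z) module \<Rightarrow> ('h \<Rightarrow> 'h \<Rightarrow> 'h \<Rightarrow> 'z) \<Rightarrow> 'h \<Rightarrow> 'z" where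
  "sweedler3 H Z f h = sweedler H Z (\<lambda>h12 h3. sweedler H Z (\<lambda>h1 h2. f h1 h2 h3) h12) h"

definition sweedler_pair ::
  "('k::field, 'h) hopf_data \<Rightarrow> ('k, 'z) module \<Rightarrow> ('h \<Rightarrow> 'h \<Rightarrow> 'h \<Rightarrow> 'h \<Rightarrow> 'z) \<Rightarrow> 'h \<Rightarrow> 'h \<Rightarrow> 'z" where
  "sweedler_pair H Z f x y =
     sweedler H Z (\<lambda>x1 x2. sweedler H Z (\<lambda>y1 y2. f x1 x2 y1 y2) y) x"

definition sweedler3_pair ::
  "('k::field, 'h) hopf_data \<Rightarrow> ('k, 'z) module \<Rightarrow>
   ('h \<Rightarrow> 'h \<Rightarrow> 'h \<Rightarrow> 'h \<Rightarrow> 'h \<Rightarrow> 'h \<Rightarrow> 'z) \<Rightarrow> 'h \<Rightarrow> 'h \<Rightarrow> 'z" where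
  "sweedler3_pair H Z f x y =
     sweedler3 H Z (\<lambda>x1 x2 x3. sweedler3 H Z (\<lambda>y1 y2 y3. f x1 x2 x3 y1 y2 y3) y) x"

definition hopf_algebra :: "('k::field, 'h::ring_1) hopf_data \<Rightarrow> bool" where
  "hopf_algebra H \<longleftrightarrow>
     vector_space (hscale H) \<and>
     (\<forall>c x y. hscale H c (x * y) = hscale H c x * y \<and> hscale H c (x * y) = x * hscale H c y) \<and>
     comul H \<in> alg_hom (hopf_alg H) (tensor_alg (hopf_alg H) (hopf_alg H)) \<and>
     counit H \<in> alg_hom (hopf_alg H) ground_alg \<and>
     (let HH = tensor_space (hopf_alg H) (hopf_alg H); HHH = tensor_space HH (hopf_alg H);
          t3 = (\<lambda>a b c. tens HH (hopf_alg H) (tens (hopf_alg H) (hopf_alg H) a b) c)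
      in \<forall>h. sweedler H HHH (\<lambda>a c. sweedler H HHH (\<lambda>a1 a2. t3 a1 a2 c) a) h
           = sweedler H HHH (\<lambda>a c. sweedler H HHH (\<lambda>c1 c2. t3 a c1 c2) c) h) \<and>
     (\<forall>h. sweedler H (hopf_alg H) (\<lambda>h1 h2. hscale H (counit H h1) h2) h = h \<and>
          sweedler H (hopf_alg H) (\<lambda>h1 h2. hscale H (counit H h2) h1) h = h) \<and>
     Vector_Spaces.linear (hscale H) (hscale H) (antipode H) \<and>
     (\<forall>h. sweedler H (hopf_alg H) (\<lambda>h1 h2. antipode H h1 * h2) h = hscale H (counit H h) 1 \<and>
          sweedler H (hopf_alg H) (\<lambda>h1 h2. h1 * antipode H h2) h = hscale H (counit H h) 1)"

definition comodule_alg_hom ::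
  "('k::field, 'h::ring_1) hopf_data \<Rightarrow>
   ('k, 'a) module \<Rightarrow> ('a \<Rightarrow> ('a \<times> 'h \<Rightarrow>\<^sub>0 'k) set) \<Rightarrow>
   ('k, 'b) module \<Rightarrow> ('b \<Rightarrow> ('b \<times> 'h \<Rightarrow>\<^sub>0 'k) set) \<Rightarrow> ('a \<Rightarrow> 'b) set" where
  "comodule_alg_hom H A dA B dB = {f \<in> alg_hom A B. \<forall>a\<in>carrier A.
     dB (f a) = tlift (tensor_space B (hopf_alg H)) (\<lambda>a' h. tens B (hopf_alg H) (f a') h) (dA a)}"


section \<open>Two-cocycles and twisted algebras\<close>

definition bilinear_map ::
  "('k::field \<Rightarrow> 'h::ab_group_add \<Rightarrow> 'h) \<Rightarrow> ('k \<Rightarrow> 'r::ab_group_add \<Rightarrow> 'r) \<Rightarrow>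
   ('h \<Rightarrow> 'h \<Rightarrow> 'r) \<Rightarrow> bool" where
  "bilinear_map s r \<alpha> \<longleftrightarrow>
     (\<forall>y. Vector_Spaces.linear s r (\<lambda>x. \<alpha> x y)) \<and> (\<forall>x. Vector_Spaces.linear s r (\<lambda>y. \<alpha> x y))"

definition two_cocycle ::
  "('k::field, 'h::ring_1) hopf_data \<Rightarrow> ('k \<Rightarrow> 'r \<Rightarrow> 'r) \<Rightarrow> ('h \<Rightarrow> 'h \<Rightarrow> 'r::comm_ring_1) \<Rightarrow> bool" where
  "two_cocycle H r \<alpha> \<longleftrightarrow> bilinear_map (hscale H) r \<alpha> \<and>
     (\<forall>x y z. sweedler_pair H (alg_of r) (\<lambda>x1 x2 y1 y2. \<alpha> x1 y1 * \<alpha> (x2 * y2) z) x y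
            = sweedler_pair H (alg_of r) (\<lambda>y1 y2 z1 z2. \<alpha> y1 z1 * \<alpha> x (y2 * z2)) y z)"

definition normalized_cocycle ::
  "('k::field, 'h::ring_1) hopf_data \<Rightarrow> ('k \<Rightarrow> 'r \<Rightarrow> 'r) \<Rightarrow> ('h \<Rightarrow> 'h \<Rightarrow> 'r::comm_ring_1) \<Rightarrow> bool" where
  "normalized_cocycle H r \<alpha> \<longleftrightarrow>
     (\<forall>x. \<alpha> x 1 = r (counit H x) 1 \<and> \<alpha> 1 x = r (counit H x) 1)"

definition convolution_inverse ::
  "('k::field, 'h::ring_1) hopf_data \<Rightarrow> ('k \<Rightarrow> 'r \<Rightarrow> 'r) \<Rightarrow>
   ('h \<Rightarrow> 'h \<Rightarrow> 'r::comm_ring_1) \<Rightarrow> ('h \<Rightarrow> 'h \<Rightarrow> 'r) \<Rightarrow> bool" where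
  "convolution_inverse H r \<alpha> \<beta> \<longleftrightarrow> bilinear_map (hscale H) r \<beta> \<and>
     (\<forall>x y. sweedler_pair H (alg_of r) (\<lambda>x1 x2 y1 y2. \<alpha> x1 y1 * \<beta> x2 y2) x y
              = r (counit H x * counit H y) 1 \<and>
            sweedler_pair H (alg_of r) (\<lambda>x1 x2 y1 y2. \<beta> x1 y1 * \<alpha> x2 y2) x y
              = r (counit H x * counit H y) 1)"

text \<open>
  \<open>twisted_alg H R \<alpha> u\<close> is \<open>R \<otimes> H\<close> with the product twisted by \<open>\<alpha>\<close> and the unit \<open>u \<otimes> 1\<close>.  The element
  \<open>u\<close> is a parameter because it is \<open>1\<close> for a normalized cocycle and the inverse of \<open>\<alpha> 1 1\<close> in general.
\<close>

definition twisted_alg ::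
  "('k::field, 'h::ring_1) hopf_data \<Rightarrow> ('k, 'r) module \<Rightarrow> ('h \<Rightarrow> 'h \<Rightarrow> 'r) \<Rightarrow> 'r \<Rightarrow>
   ('k, ('r \<times> 'h \<Rightarrow>\<^sub>0 'k) set) module" where
  "twisted_alg H R \<alpha> u = (let RH = tensor_space R (hopf_alg H) in RH
     \<lparr>mult := (\<lambda>P Q. tlift RH (\<lambda>b x. tlift RH (\<lambda>c y.
                sweedler_pair H RH (\<lambda>x1 x2 y1 y2.
                  tens R (hopf_alg H) (b \<otimes>\<^bsub>R\<^esub> c \<otimes>\<^bsub>R\<^esub> \<alpha> x1 y1) (x2 * y2)) x y) Q) P),
      one := tens R (hopf_alg H) u 1\<rparr>)"

text \<open>The coaction \<open>id \<otimes> \<Delta>\<close>, with values in \<open>(R \<otimes> H) \<otimes> H\<close>.\<close>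

definition tensor_coaction ::
  "('k::field, 'h::ring_1) hopf_data \<Rightarrow> ('k, 'r) module \<Rightarrow>
   ('r \<times> 'h \<Rightarrow>\<^sub>0 'k) set \<Rightarrow> (('r \<times> 'h \<Rightarrow>\<^sub>0 'k) set \<times> 'h \<Rightarrow>\<^sub>0 'k) set" where
  "tensor_coaction H R =
     (let RH = tensor_space R (hopf_alg H); RHH = tensor_space RH (hopf_alg H)
      in tlift RHH (\<lambda>b h. sweedler H RHH
           (\<lambda>h1 h2. tens RH (hopf_alg H) (tens R (hopf_alg H) b h1) h2) h))"

definition twisted_hopf_alg ::
  "('k::field, 'h::ring_1) hopf_data \<Rightarrow> ('h \<Rightarrow> 'h \<Rightarrow> 'k) \<Rightarrow> ('k, ('k \<times> 'h \<Rightarrow>\<^sub>0 'k) set) module" where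
  "twisted_hopf_alg H \<alpha> = twisted_alg H ground_alg \<alpha> 1"


section \<open>Tensor algebra and symmetric algebra\<close>

text \<open>
  With words as a monoid under concatenation, \<open>'x list \<Rightarrow>\<^sub>0 'k\<close> with its convolution product is the
  free algebra on the set \<open>'x\<close>.
\<close>

instantiation list :: (type) monoid_add
begin
definition zero_list :: "'a list" where "zero_list = []"
definition plus_list :: "'a list \<Rightarrow> 'a list \<Rightarrow> 'a list" where "plus_list = (@)"
instance by standard (simp_all add: zero_list_def plus_list_def)
end

definition free_alg :: "('k::field, 'x list \<Rightarrow>\<^sub>0 'k) module" where
  "free_alg = alg_of fscale"

definition free_gen :: "'x \<Rightarrow> ('x list \<Rightarrow>\<^sub>0 'k::field)" where
  "free_gen x = Poly_Mapping.single [x] 1"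

text \<open>
  The tensor algebra of a vector space \<open>V\<close> is the free algebra on the symbols \<open>X\<^sub>v\<close>, \<open>v \<in> V\<close>, modulo the
  ideal that makes \<open>v \<mapsto> X\<^sub>v\<close> linear; the symmetric algebra is its quotient by the commutators.
\<close>

definition linearity_ideal :: "('k::field \<Rightarrow> 'v::ab_group_add \<Rightarrow> 'v) \<Rightarrow> ('v list \<Rightarrow>\<^sub>0 'k) set" where
  "linearity_ideal s = Idl\<^bsub>free_alg\<^esub>
     ({free_gen (v + w) - free_gen v - free_gen w | v w. True}
      \<union> {free_gen (s c v) - fscale c (free_gen v) | c v. True})"

definition tensor_algebra ::
  "('k::field \<Rightarrow> 'v::ab_group_add \<Rightarrow> 'v) \<Rightarrow> ('k, ('v list \<Rightarrow>\<^sub>0 'k) set) module" where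
  "tensor_algebra s = quot_alg free_alg (linearity_ideal s)"

definition tgen :: "('k::field \<Rightarrow> 'v::ab_group_add \<Rightarrow> 'v) \<Rightarrow> 'v \<Rightarrow> ('v list \<Rightarrow>\<^sub>0 'k) set" where
  "tgen s v = linearity_ideal s +>\<^bsub>free_alg\<^esub> free_gen v"

text \<open>\<open>tensor_algebra_ext A f\<close> is the algebra morphism to \<open>A\<close> extending the linear map \<open>X\<^sub>v \<mapsto> f v\<close>.\<close>

definition tensor_algebra_ext ::
  "('k::field, 'a) module \<Rightarrow> ('v \<Rightarrow> 'a) \<Rightarrow> ('v list \<Rightarrow>\<^sub>0 'k) set \<Rightarrow> 'a" where
  "tensor_algebra_ext A f P = (let p = (SOME p. p \<in> P) in
     \<Oplus>\<^bsub>A\<^esub>w\<in>Poly_Mapping.keys p.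
       Poly_Mapping.lookup p w \<odot>\<^bsub>A\<^esub> foldr (\<lambda>v a. f v \<otimes>\<^bsub>A\<^esub> a) w \<one>\<^bsub>A\<^esub>)"

definition commutator_ideal ::
  "('k::field \<Rightarrow> 'v::ab_group_add \<Rightarrow> 'v) \<Rightarrow> ('v list \<Rightarrow>\<^sub>0 'k) set set" where
  "commutator_ideal s = (let T = tensor_algebra s in
     Idl\<^bsub>T\<^esub> {tgen s v \<otimes>\<^bsub>T\<^esub> tgen s w \<ominus>\<^bsub>T\<^esub> tgen s w \<otimes>\<^bsub>T\<^esub> tgen s v | v w. True})"

definition symmetric_algebra ::
  "('k::field \<Rightarrow> 'v::ab_group_add \<Rightarrow> 'v) \<Rightarrow> ('k, ('v list \<Rightarrow>\<^sub>0 'k) set set) module" where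
  "symmetric_algebra s = quot_alg (tensor_algebra s) (commutator_ideal s)"

definition sgen :: "('k::field \<Rightarrow> 'v::ab_group_add \<Rightarrow> 'v) \<Rightarrow> 'v \<Rightarrow> ('v list \<Rightarrow>\<^sub>0 'k) set set" where
  "sgen s v = commutator_ideal s +>\<^bsub>tensor_algebra s\<^esub> tgen s v"

text \<open>The field \<open>'f\<close> is, via \<open>\<iota>\<close>, a field of fractions of \<open>S\<close>.\<close>

definition fraction_field :: "('k, 's) module \<Rightarrow> ('s \<Rightarrow> 'f::field) \<Rightarrow> bool" where
  "fraction_field S \<iota> \<longleftrightarrow>
     \<iota> \<in> ring_hom S \<lparr>carrier = UNIV, mult = (*), one = 1, zero = 0, add = (+)\<rparr> \<and>
     inj_on \<iota> (carrier S) \<and>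
     (\<forall>z. \<exists>a\<in>carrier S. \<exists>b\<in>carrier S. \<iota> b \<noteq> 0 \<and> z = \<iota> a / \<iota> b)"


section \<open>The universal cocycle\<close>

text \<open>
  From here on \<open>\<iota>\<close> embeds the symmetric algebra \<open>S(t\<^sub>H)\<close> of the vector space \<open>H\<close> into a field of fractions
  \<open>K\<^sub>H\<close>, which is the type \<open>'f\<close>.
\<close>

definition frac_scale ::
  "('k::field, 'h::ring_1) hopf_data \<Rightarrow> (('h list \<Rightarrow>\<^sub>0 'k) set set \<Rightarrow> 'f::field) \<Rightarrow> 'k \<Rightarrow> 'f \<Rightarrow> 'f" where
  "frac_scale H \<iota> c z = (let S = symmetric_algebra (hscale H) in \<iota> (c \<odot>\<^bsub>S\<^esub> \<one>\<^bsub>S\<^esub>) * z)"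

definition frac_alg ::
  "('k::field, 'h::ring_1) hopf_data \<Rightarrow> (('h list \<Rightarrow>\<^sub>0 'k) set set \<Rightarrow> 'f::field) \<Rightarrow> ('k, 'f) module" where
  "frac_alg H \<iota> = alg_of (frac_scale H \<iota>)"

definition t_var ::
  "('k::field, 'h::ring_1) hopf_data \<Rightarrow> (('h list \<Rightarrow>\<^sub>0 'k) set set \<Rightarrow> 'f::field) \<Rightarrow> 'h \<Rightarrow> 'f" where
  "t_var H \<iota> h = \<iota> (sgen (hscale H) h)"

definition t_inv ::
  "('k::field, 'h::ring_1) hopf_data \<Rightarrow> (('h list \<Rightarrow>\<^sub>0 'k) set set \<Rightarrow> 'f::field) \<Rightarrow> 'h \<Rightarrow> 'f" where
  "t_inv H \<iota> = (THE g. Vector_Spaces.linear (hscale H) (frac_scale H \<iota>) g \<and>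
     (\<forall>h. sweedler H (frac_alg H \<iota>) (\<lambda>h1 h2. t_var H \<iota> h1 * g h2) h
            = frac_scale H \<iota> (counit H h) 1 \<and>
          sweedler H (frac_alg H \<iota>) (\<lambda>h1 h2. g h1 * t_var H \<iota> h2) h
            = frac_scale H \<iota> (counit H h) 1))"

definition S_Theta ::
  "('k::field, 'h::ring_1) hopf_data \<Rightarrow> (('h list \<Rightarrow>\<^sub>0 'k) set set \<Rightarrow> 'f::field) \<Rightarrow> ('k, 'f) module" where
  "S_Theta H \<iota> = (frac_alg H \<iota>)
     \<lparr>carrier := generated_subalgebra (frac_scale H \<iota>) (range (t_var H \<iota>) \<union> range (t_inv H \<iota>))\<rparr>"

definition sigma ::
  "('k::field, 'h::ring_1) hopf_data \<Rightarrow> (('h list \<Rightarrow>\<^sub>0 'k) set set \<Rightarrow> 'f::field) \<Rightarrow>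
   ('h \<Rightarrow> 'h \<Rightarrow> 'k) \<Rightarrow> 'h \<Rightarrow> 'h \<Rightarrow> 'f" where
  "sigma H \<iota> \<alpha> x y = sweedler3_pair H (frac_alg H \<iota>)
     (\<lambda>x1 x2 x3 y1 y2 y3.
        t_var H \<iota> x1 * t_var H \<iota> y1 * frac_scale H \<iota> (\<alpha> x2 y2) 1 * t_inv H \<iota> (x3 * y3)) x y"

text \<open>The argument \<open>\<beta>\<close> is the convolution inverse of \<open>\<alpha>\<close>.\<close>

definition sigma_inv ::
  "('k::field, 'h::ring_1) hopf_data \<Rightarrow> (('h list \<Rightarrow>\<^sub>0 'k) set set \<Rightarrow> 'f::field) \<Rightarrow>
   ('h \<Rightarrow> 'h \<Rightarrow> 'k) \<Rightarrow> 'h \<Rightarrow> 'h \<Rightarrow> 'f" where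
  "sigma_inv H \<iota> \<beta> x y = sweedler3_pair H (frac_alg H \<iota>)
     (\<lambda>x1 x2 x3 y1 y2 y3.
        t_var H \<iota> (x1 * y1) * frac_scale H \<iota> (\<beta> x2 y2) 1 * t_inv H \<iota> x3 * t_inv H \<iota> y3) x y"

definition B_alg ::
  "('k::field, 'h::ring_1) hopf_data \<Rightarrow> (('h list \<Rightarrow>\<^sub>0 'k) set set \<Rightarrow> 'f::field) \<Rightarrow>
   ('h \<Rightarrow> 'h \<Rightarrow> 'k) \<Rightarrow> ('h \<Rightarrow> 'h \<Rightarrow> 'k) \<Rightarrow> 'f set" where
  "B_alg H \<iota> \<alpha> \<beta> = generated_subalgebra (frac_scale H \<iota>)
     ({sigma H \<iota> \<alpha> x y | x y. True} \<union> {sigma_inv H \<iota> \<beta> x y | x y. True})"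

text \<open>\<open>S(t\<^sub>H)\<^sub>\<Theta> \<otimes>\<^sup>\<sigma> H\<close> and \<open>S(t\<^sub>H)\<^sub>\<Theta> \<otimes>\<^sup>\<alpha> H\<close>.\<close>

definition sigma_twisted ::
  "('k::field, 'h::ring_1) hopf_data \<Rightarrow> (('h list \<Rightarrow>\<^sub>0 'k) set set \<Rightarrow> 'f::field) \<Rightarrow>
   ('h \<Rightarrow> 'h \<Rightarrow> 'k) \<Rightarrow> ('k, ('f \<times> 'h \<Rightarrow>\<^sub>0 'k) set) module" where
  "sigma_twisted H \<iota> \<alpha> = twisted_alg H (S_Theta H \<iota>) (sigma H \<iota> \<alpha>) (t_inv H \<iota> 1)"

definition alpha_twisted ::
  "('k::field, 'h::ring_1) hopf_data \<Rightarrow> (('h list \<Rightarrow>\<^sub>0 'k) set set \<Rightarrow> 'f::field) \<Rightarrow>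
   ('h \<Rightarrow> 'h \<Rightarrow> 'k) \<Rightarrow> ('k, ('f \<times> 'h \<Rightarrow>\<^sub>0 'k) set) module" where
  "alpha_twisted H \<iota> \<alpha> = twisted_alg H (S_Theta H \<iota>) (\<lambda>x y. frac_scale H \<iota> (\<alpha> x y) 1) 1"

text \<open>
  \<open>\<A>\<^sub>H\<^sup>\<alpha> = \<B>\<^sub>H\<^sup>\<alpha> \<otimes>\<^sup>\<sigma> H\<close>, regarded as a subalgebra of \<open>S(t\<^sub>H)\<^sub>\<Theta> \<otimes>\<^sup>\<sigma> H\<close>: the classes of the formal
  combinations of pairs \<open>(b, h)\<close> with \<open>b \<in> \<B>\<^sub>H\<^sup>\<alpha>\<close>.
\<close>

definition A_alg ::
  "('k::field, 'h::ring_1) hopf_data \<Rightarrow> (('h list \<Rightarrow>\<^sub>0 'k) set set \<Rightarrow> 'f::field) \<Rightarrow>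
   ('h \<Rightarrow> 'h \<Rightarrow> 'k) \<Rightarrow> ('h \<Rightarrow> 'h \<Rightarrow> 'k) \<Rightarrow> ('k, ('f \<times> 'h \<Rightarrow>\<^sub>0 'k) set) module" where
  "A_alg H \<iota> \<alpha> \<beta> = (sigma_twisted H \<iota> \<alpha>)
     \<lparr>carrier := tcoset (S_Theta H \<iota>) (hopf_alg H) `
        {p. Poly_Mapping.keys p \<subseteq> B_alg H \<iota> \<alpha> \<beta> \<times> UNIV}\<rparr>"

definition phi ::
  "('k::field, 'h::ring_1) hopf_data \<Rightarrow> (('h list \<Rightarrow>\<^sub>0 'k) set set \<Rightarrow> 'f::field) \<Rightarrow>
   ('f \<times> 'h \<Rightarrow>\<^sub>0 'k) set \<Rightarrow> ('f \<times> 'h \<Rightarrow>\<^sub>0 'k) set" where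
  "phi H \<iota> = (let SH = tensor_space (S_Theta H \<iota>) (hopf_alg H) in
     tlift SH (\<lambda>b h. sweedler H SH
       (\<lambda>h1 h2. tens (S_Theta H \<iota>) (hopf_alg H) (b * t_var H \<iota> h1) h2) h))"


section \<open>Identities and the universal comodule algebra\<close>

abbreviation T_alg :: "('k::field, 'h::ring_1) hopf_data \<Rightarrow> ('k, ('h list \<Rightarrow>\<^sub>0 'k) set) module" where
  "T_alg H \<equiv> tensor_algebra (hscale H)"

definition T_coaction ::
  "('k::field, 'h::ring_1) hopf_data \<Rightarrow>
   ('h list \<Rightarrow>\<^sub>0 'k) set \<Rightarrow> (('h list \<Rightarrow>\<^sub>0 'k) set \<times> 'h \<Rightarrow>\<^sub>0 'k) set" where
  "T_coaction H = (let TH = tensor_alg (T_alg H) (hopf_alg H) in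
     tensor_algebra_ext TH
       (\<lambda>h. sweedler H TH (\<lambda>h1 h2. tens (T_alg H) (hopf_alg H) (tgen (hscale H) h1) h2) h))"

definition identities ::
  "('k::field, 'h::ring_1) hopf_data \<Rightarrow> ('h \<Rightarrow> 'h \<Rightarrow> 'k) \<Rightarrow> ('h list \<Rightarrow>\<^sub>0 'k) set set" where
  "identities H \<alpha> = {P \<in> carrier (T_alg H).
     \<forall>\<mu> \<in> comodule_alg_hom H (T_alg H) (T_coaction H)
            (twisted_hopf_alg H \<alpha>) (tensor_coaction H ground_alg).
       \<mu> P = \<zero>\<^bsub>twisted_hopf_alg H \<alpha>\<^esub>}"

definition U_alg ::
  "('k::field, 'h::ring_1) hopf_data \<Rightarrow> ('h \<Rightarrow> 'h \<Rightarrow> 'k) \<Rightarrow>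
   ('k, ('h list \<Rightarrow>\<^sub>0 'k) set set) module" where
  "U_alg H \<alpha> = quot_alg (T_alg H) (identities H \<alpha>)"

definition U_class ::
  "('k::field, 'h::ring_1) hopf_data \<Rightarrow> ('h \<Rightarrow> 'h \<Rightarrow> 'k) \<Rightarrow>
   ('h list \<Rightarrow>\<^sub>0 'k) set \<Rightarrow> ('h list \<Rightarrow>\<^sub>0 'k) set set" where
  "U_class H \<alpha> P = identities H \<alpha> +>\<^bsub>T_alg H\<^esub> P"

definition U_gen ::
  "('k::field, 'h::ring_1) hopf_data \<Rightarrow> ('h \<Rightarrow> 'h \<Rightarrow> 'k) \<Rightarrow> 'h \<Rightarrow> ('h list \<Rightarrow>\<^sub>0 'k) set set" where
  "U_gen H \<alpha> h = U_class H \<alpha> (tgen (hscale H) h)"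

text \<open>
  The maps on \<open>\<U>\<^sub>H\<^sup>\<alpha>\<close> induced by maps on \<open>T(X\<^sub>H)\<close> are computed on an arbitrary representative of the
  class; for the two maps below the choice does not matter.
\<close>

definition U_coaction ::
  "('k::field, 'h::ring_1) hopf_data \<Rightarrow> ('h \<Rightarrow> 'h \<Rightarrow> 'k) \<Rightarrow>
   ('h list \<Rightarrow>\<^sub>0 'k) set set \<Rightarrow> (('h list \<Rightarrow>\<^sub>0 'k) set set \<times> 'h \<Rightarrow>\<^sub>0 'k) set" where
  "U_coaction H \<alpha> C =
     tlift (tensor_space (U_alg H \<alpha>) (hopf_alg H))
       (\<lambda>P h. tens (U_alg H \<alpha>) (hopf_alg H) (U_class H \<alpha> P) h)
       (T_coaction H (SOME P. P \<in> C))"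

definition mu_alpha ::
  "('k::field, 'h::ring_1) hopf_data \<Rightarrow> (('h list \<Rightarrow>\<^sub>0 'k) set set \<Rightarrow> 'f::field) \<Rightarrow>
   ('h \<Rightarrow> 'h \<Rightarrow> 'k) \<Rightarrow> ('h list \<Rightarrow>\<^sub>0 'k) set set \<Rightarrow> ('f \<times> 'h \<Rightarrow>\<^sub>0 'k) set" where
  "mu_alpha H \<iota> \<alpha> C = (let SH = alpha_twisted H \<iota> \<alpha> in
     tensor_algebra_ext SH
       (\<lambda>h. sweedler H SH (\<lambda>h1 h2. tens (S_Theta H \<iota>) (hopf_alg H) (t_var H \<iota> h1) h2) h)
       (SOME P. P \<in> C))"

definition mu_sigma ::
  "('k::field, 'h::ring_1) hopf_data \<Rightarrow> (('h list \<Rightarrow>\<^sub>0 'k) set set \<Rightarrow> 'f::field) \<Rightarrow>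
   ('h \<Rightarrow> 'h \<Rightarrow> 'k) \<Rightarrow> ('h list \<Rightarrow>\<^sub>0 'k) set set \<Rightarrow> ('f \<times> 'h \<Rightarrow>\<^sub>0 'k) set" where
  "mu_sigma H \<iota> \<alpha> = inv_into (carrier (sigma_twisted H \<iota> \<alpha>)) (phi H \<iota>) \<circ> mu_alpha H \<iota> \<alpha>"

end

theory Submission
  imports Defs "HOL-Computational_Algebra.Polynomial" "Jordan_Normal_Form.Determinant"
begin

text \<open>
  The map \<open>\<phi>\<close> replaces a functional \<open>f\<close> on \<open>H\<close> by the convolution product of \<open>t\<close> and \<open>f\<close>.  Since \<open>\<sigma>\<close> is
  the convolution product of \<open>t \<otimes> t\<close>, \<open>\<alpha>\<close> and \<open>t\<^sup>-\<^sup>1\<close> composed with the multiplication, \<open>\<phi>\<close> is an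
  isomorphism of comodule algebras, and it sends \<open>1 \<otimes> h\<close> to \<open>\<Sum> t h\<^sub>1 \<otimes> h\<^sub>2\<close>, the image of \<open>X\<^sub>h\<close>; this is (a).
  Products of the elements \<open>1 \<otimes> h\<close> for the twisted multiplication have coefficients that are products of
  values of \<open>\<sigma>\<close>, and the coefficient of the unit is \<open>t\<^sup>-\<^sup>1 1\<close>, a value of \<open>\<sigma>\<^sup>-\<^sup>1\<close>; this is (b).
  The inverse \<open>t\<^sup>-\<^sup>1\<close> exists because every element of \<open>H\<close> lies in a finite-dimensional right coideal, on
  which \<open>t\<close> is given by a matrix whose determinant specialises to \<open>1\<close> at the counit.  Injectivity holds
  because every comodule algebra morphism from the tensor algebra to the twisted Hopf algebra arises
  from the generic one by specialising the variables \<open>t\<^sub>h\<close>, and a polynomial over an infinite field that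
  vanishes under all specialisations is zero.
\<close>

text \<open>Equality in a tensor product, a quotient by a span, is hard to check on representatives.
  It is tested by functionals instead, which suffices because \<open>H\<close> has a basis.
  Products, coactions and \<open>\<phi>\<close> then act on functionals, and what remains to be
  checked are identities between convolution products. The development runs with coefficients in the
  ground field and in the field of fractions. The two runs meet in one noncommutative polynomial
  with coefficients in the ground field: evaluated at a scalar linear form it gives a coordinate of
  a morphism to the twisted Hopf algebra, evaluated at \<open>t\<close> a coordinate of the generic
  morphism. Since the symbols attached to linearly dependent vectors are dependent, such polynomials
  are rewritten in basis variables before coefficients are compared. The determinant argument
  produces an inverse of \<open>t\<close> on one coideal at a time; the pieces are glued because an
  invertible matrix leaves only one candidate. The product twisted by \<open>\<sigma>\<close> is
  treated through \<open>\<phi>\<close>: multiplicativity and the unit are carried over from the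
  product twisted by \<open>\<alpha>\<close>.\<close>

section \<open>Determinants and inverse matrices\<close>

text \<open>The determinant of a matrix given by an index function. The explicit sum over
  permutations is the shape in which the value of a noncommutative polynomial appears in
  \<open>comatrix_inverse\<close>.\<close>

definition leibniz :: "nat \<Rightarrow> (nat \<Rightarrow> nat \<Rightarrow> 'a::comm_ring_1) \<Rightarrow> 'a" where
  "leibniz n m = (\<Sum>p | p permutes {0..<n}. of_int (sign p) * (\<Prod>i=0..<n. m i (p i)))"

lemma leibniz_identity: "leibniz n (\<lambda>i j. if i = j then 1 else 0) = 1"
proof -
  have "det (1\<^sub>m n :: 'a mat) = leibniz n (\<lambda>i j. if i = j then 1 else 0)"
    unfolding leibniz_def det_def'[OF one_carrier_mat]
  proof (rule sum.cong[OF refl])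
    fix p assume "p \<in> {p. p permutes {0..<n}}"
    then have "p i < n" if "i < n" for i using permutes_in_image[of p "{0..<n}" i] that by simp
    then show "signof p * (\<Prod>i = 0..<n. 1\<^sub>m n $$ (i, p i)) = of_int (sign p) * (\<Prod>i=0..<n. if i = p i then 1 else 0)"
      by (intro arg_cong2[where f = "(*)"] prod.cong) auto
  qed
  then show ?thesis by simp
qed

text \<open>Both products are recorded: the left inverse yields a convolution inverse on a coideal,
  the right inverse its uniqueness.\<close>

lemma inverse_matrix_exists:
  fixes m :: "nat \<Rightarrow> nat \<Rightarrow> 'a::field"
  assumes "leibniz n m \<noteq> 0"
  shows "\<exists>N. \<forall>i<n. \<forall>j<n. (\<Sum>k=0..<n. m i k * N k j) = (if i = j then 1 else 0) \<and>
    (\<Sum>k=0..<n. N i k * m k j) = (if i = j then 1 else 0)"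
proof -
  define A where "A = mat n n (\<lambda>(i, j). m i j)"
  have A: "A \<in> carrier_mat n n" by (simp add: A_def)
  have "det A = leibniz n m"
    unfolding leibniz_def det_def'[OF A]
  proof (rule sum.cong[OF refl])
    fix p assume "p \<in> {p. p permutes {0..<n}}"
    then have "p i < n" if "i < n" for i using permutes_in_image[of p "{0..<n}" i] that by simp
    then show "signof p * (\<Prod>i = 0..<n. A $$ (i, p i)) = of_int (sign p) * (\<Prod>i=0..<n. m i (p i))"
      by (intro arg_cong2[where f = "(*)"] prod.cong) (auto simp: A_def)
  qed
  then have "A \<in> Units (ring_mat TYPE('a) n ())"
    using assms by (intro det_non_zero_imp_unit[OF A]) simp
  then obtain C where C: "C \<in> carrier_mat n n" "C * A = 1\<^sub>m n" "A * C = 1\<^sub>m n"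
    by (auto simp: Units_def ring_mat_def)
  have "(\<Sum>k=0..<n. m i k * C $$ (k, j)) = (if i = j then 1 else 0) \<and>
      (\<Sum>k=0..<n. C $$ (i, k) * m k j) = (if i = j then 1 else 0)" if "i < n" "j < n" for i j
    using arg_cong[OF C(2), of "\<lambda>M. M $$ (i, j)"] arg_cong[OF C(3), of "\<lambda>M. M $$ (i, j)"] that C(1) A
    by (auto simp: scalar_prod_def A_def)
  then show ?thesis by (intro exI[of _ "\<lambda>i j. C $$ (i, j)"]) blast
qed

section \<open>Vector spaces with a carrier\<close>

text \<open>Only the additive group and the scalar action of \<open>V\<close> enter, so the notion
  applies to \<open>tensor_space\<close>, whose multiplication and unit are unspecified.\<close>

abbreviation kspace :: "('k::field, 'v) module \<Rightarrow> bool" where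
  "kspace V \<equiv> Module.module ground_alg V"

lemma alg_of_simps [simp]:
  "carrier (alg_of s) = UNIV" "monoid.mult (alg_of s) = (*)" "one (alg_of s) = 1"
  "zero (alg_of s) = 0" "add (alg_of s) = (+)" "(\<odot>\<^bsub>alg_of s\<^esub>) = s"
  by (simp_all add: alg_of_def)

lemma ring_alg_of [simp]: "ring (alg_of (s :: 'k \<Rightarrow> 'b \<Rightarrow> 'b::ring_1))"
proof (rule ringI, rule abelian_groupI)
  fix x :: 'b
  show "\<exists>y\<in>carrier (alg_of s). y \<oplus>\<^bsub>alg_of s\<^esub> x = \<zero>\<^bsub>alg_of s\<^esub>"
    by (rule bexI[of _ "- x"]) simp_all
  show "Group.monoid (alg_of s)" by (rule monoidI) (simp_all add: mult.assoc)
qed (simp_all add: distrib_left distrib_right add.assoc add.commute)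

lemma cring_ground_alg [simp]: "cring (ground_alg :: ('k, 'k::field) module)"
  unfolding ground_alg_def by (rule cringI[OF ring.is_abelian_group[OF ring_alg_of]])
    (simp_all add: comm_monoidI algebra_simps)

lemma ground_alg_simps [simp]:
  "carrier ground_alg = UNIV" "monoid.mult ground_alg = (*)" "one ground_alg = 1"
  "zero ground_alg = 0" "add ground_alg = (+)" "(\<odot>\<^bsub>ground_alg\<^esub>) = (*)"
  by (simp_all add: ground_alg_def)

lemma finsum_alg_of: "finsum (alg_of s) f A = sum f A"
proof -
  interpret ring "alg_of s" by simp
  show ?thesis
  proof (induction A rule: infinite_finite_induct)
    case (infinite A)
    then show ?case by (simp add: finsum_infinite)
  qed (auto simp: finsum_insert)
qed

lemma kspaceI:
  assumes "abelian_group V"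
    and "\<And>a x. x \<in> carrier V \<Longrightarrow> a \<odot>\<^bsub>V\<^esub> x \<in> carrier V"
    and "\<And>a b x. x \<in> carrier V \<Longrightarrow> (a + b) \<odot>\<^bsub>V\<^esub> x = a \<odot>\<^bsub>V\<^esub> x \<oplus>\<^bsub>V\<^esub> b \<odot>\<^bsub>V\<^esub> x"
    and "\<And>a x y. x \<in> carrier V \<Longrightarrow> y \<in> carrier V \<Longrightarrow> a \<odot>\<^bsub>V\<^esub> (x \<oplus>\<^bsub>V\<^esub> y) = a \<odot>\<^bsub>V\<^esub> x \<oplus>\<^bsub>V\<^esub> a \<odot>\<^bsub>V\<^esub> y"
    and "\<And>a b x. x \<in> carrier V \<Longrightarrow> (a * b) \<odot>\<^bsub>V\<^esub> x = a \<odot>\<^bsub>V\<^esub> (b \<odot>\<^bsub>V\<^esub> x)"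
    and "\<And>x. x \<in> carrier V \<Longrightarrow> 1 \<odot>\<^bsub>V\<^esub> x = x"
  shows "kspace V"
  by (rule moduleI) (use assms in auto)

lemma kspaceD:
  assumes "kspace V"
  shows "abelian_group V"
    "x \<in> carrier V \<Longrightarrow> a \<odot>\<^bsub>V\<^esub> x \<in> carrier V"
    "x \<in> carrier V \<Longrightarrow> (a + b) \<odot>\<^bsub>V\<^esub> x = a \<odot>\<^bsub>V\<^esub> x \<oplus>\<^bsub>V\<^esub> b \<odot>\<^bsub>V\<^esub> x"
    "x \<in> carrier V \<Longrightarrow> y \<in> carrier V \<Longrightarrow> a \<odot>\<^bsub>V\<^esub> (x \<oplus>\<^bsub>V\<^esub> y) = a \<odot>\<^bsub>V\<^esub> x \<oplus>\<^bsub>V\<^esub> a \<odot>\<^bsub>V\<^esub> y"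
    "x \<in> carrier V \<Longrightarrow> (a * b) \<odot>\<^bsub>V\<^esub> x = a \<odot>\<^bsub>V\<^esub> (b \<odot>\<^bsub>V\<^esub> x)"
    "x \<in> carrier V \<Longrightarrow> 1 \<odot>\<^bsub>V\<^esub> x = x"
    "x \<in> carrier V \<Longrightarrow> y \<in> carrier V \<Longrightarrow> x \<oplus>\<^bsub>V\<^esub> y \<in> carrier V"
    "\<zero>\<^bsub>V\<^esub> \<in> carrier V"
    "x \<in> carrier V \<Longrightarrow> 0 \<odot>\<^bsub>V\<^esub> x = \<zero>\<^bsub>V\<^esub>"
proof -
  interpret Module.module ground_alg V by (rule assms)
  show "abelian_group V" by (rule M.abelian_group_axioms)
  show "x \<in> carrier V \<Longrightarrow> a \<odot>\<^bsub>V\<^esub> x \<in> carrier V" by simp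
  show "x \<in> carrier V \<Longrightarrow> (a + b) \<odot>\<^bsub>V\<^esub> x = a \<odot>\<^bsub>V\<^esub> x \<oplus>\<^bsub>V\<^esub> b \<odot>\<^bsub>V\<^esub> x"
    using smult_l_distr[of a b x] by simp
  show "x \<in> carrier V \<Longrightarrow> y \<in> carrier V \<Longrightarrow> a \<odot>\<^bsub>V\<^esub> (x \<oplus>\<^bsub>V\<^esub> y) = a \<odot>\<^bsub>V\<^esub> x \<oplus>\<^bsub>V\<^esub> a \<odot>\<^bsub>V\<^esub> y"
    by (rule smult_r_distr) simp_all
  show "x \<in> carrier V \<Longrightarrow> (a * b) \<odot>\<^bsub>V\<^esub> x = a \<odot>\<^bsub>V\<^esub> (b \<odot>\<^bsub>V\<^esub> x)"
    using smult_assoc1[of a b x] by simp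
  show "x \<in> carrier V \<Longrightarrow> 1 \<odot>\<^bsub>V\<^esub> x = x" using smult_one[of x] by simp
  show "x \<in> carrier V \<Longrightarrow> y \<in> carrier V \<Longrightarrow> x \<oplus>\<^bsub>V\<^esub> y \<in> carrier V" by simp
  show "\<zero>\<^bsub>V\<^esub> \<in> carrier V" by simp
  show "x \<in> carrier V \<Longrightarrow> 0 \<odot>\<^bsub>V\<^esub> x = \<zero>\<^bsub>V\<^esub>" using smult_l_null[of x] by simp
qed

section \<open>Formal linear combinations\<close>

lemma lookup_fscale [simp]: "Poly_Mapping.lookup (fscale c p) x = c * Poly_Mapping.lookup p x"
  by (simp add: fscale_def Poly_Mapping.map.rep_eq when_def)

lemma fscale_single [simp]: "fscale c (Poly_Mapping.single a d) = Poly_Mapping.single a (c * d)"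
  by (rule poly_mapping_eqI) (simp add: lookup_single when_def)

interpretation fs: vector_space "fscale :: 'k::field \<Rightarrow> ('x \<Rightarrow>\<^sub>0 'k) \<Rightarrow> _"
  by unfold_locales
    (auto intro!: poly_mapping_eqI simp: lookup_add algebra_simps)

lemma keys_fscale: "Poly_Mapping.keys (fscale c p) \<subseteq> Poly_Mapping.keys p"
  by (auto simp: in_keys_iff)

lemma poly_mapping_induct_on [consumes 1, case_names zero add]:
  assumes "Poly_Mapping.keys p \<subseteq> A"
    and "P 0"
    and "\<And>q a c. \<lbrakk>a \<in> A; Poly_Mapping.keys q \<subseteq> A; P q\<rbrakk> \<Longrightarrow> P (Poly_Mapping.single a c + q)"
  shows "P (p :: 'a \<Rightarrow>\<^sub>0 'b::ab_group_add)"
proof -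
  have "finite F \<Longrightarrow> F \<subseteq> A \<Longrightarrow> Poly_Mapping.keys p \<subseteq> F \<Longrightarrow> P p" for F p
  proof (induction F arbitrary: p rule: finite_induct)
    case empty
    then show ?case using assms(2) by auto
  next
    case (insert a F)
    let ?q = "p - Poly_Mapping.single a (Poly_Mapping.lookup p a)"
    have k: "Poly_Mapping.keys ?q \<subseteq> F"
      using insert.prems(2)
      by (auto simp: in_keys_iff lookup_minus lookup_single when_def split: if_splits)
    then have "P ?q" using insert.IH insert.prems by simp
    then have "P (Poly_Mapping.single a (Poly_Mapping.lookup p a) + ?q)"
      using k insert.prems by (intro assms(3)) auto
    then show ?case by simp
  qed
  then show ?thesis using assms(1) finite_keys by blast
qed

subsection \<open>Tensor spaces\<close>

lemma subspace_tensor_null: "fs.subspace (tensor_null V W)"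
  unfolding tensor_null_def by (rule fs.subspace_span)

lemmas tensor_null_0 = fs.subspace_0[OF subspace_tensor_null]
lemmas tensor_null_add = fs.subspace_add[OF subspace_tensor_null]
lemmas tensor_null_diff = fs.subspace_diff[OF subspace_tensor_null]
lemmas tensor_null_neg = fs.subspace_neg[OF subspace_tensor_null]
lemmas tensor_null_scale = fs.subspace_scale[OF subspace_tensor_null]
lemmas tensor_null_sum = fs.subspace_sum[OF subspace_tensor_null]

lemma tcoset_self: "p \<in> tcoset V W p"
  by (simp add: tcoset_def tensor_null_0)

lemma tcoset_eq_iff: "tcoset V W p = tcoset V W q \<longleftrightarrow> p - q \<in> tensor_null V W"
proof
  assume "tcoset V W p = tcoset V W q"
  then show "p - q \<in> tensor_null V W" using tcoset_self[of p V W] by (auto simp: tcoset_def)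
next
  assume *: "p - q \<in> tensor_null V W"
  then have "r - p \<in> tensor_null V W \<longleftrightarrow> r - q \<in> tensor_null V W" for r
    using tensor_null_add[of "r - p" V W "p - q"] tensor_null_diff[of "r - q" V W "p - q"] by auto
  then show "tcoset V W p = tcoset V W q" by (auto simp: tcoset_def)
qed

lemma tcoset_mem: "q \<in> tcoset V W p \<longleftrightarrow> tcoset V W q = tcoset V W p"
  by (simp add: tcoset_eq_iff) (simp add: tcoset_def)

text \<open>The sum is defined as a union over all representatives. Its members coincide because the
  null space is closed under addition, so the union is a single coset.\<close>

lemma tensor_add [simp]: "tcoset V W p \<oplus>\<^bsub>tensor_space V W\<^esub> tcoset V W q = tcoset V W (p + q)"
proof -
  have "tcoset V W (p' + q') = tcoset V W (p + q)" if "p' \<in> tcoset V W p" "q' \<in> tcoset V W q" for p' q'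
    using that tensor_null_add[of "p' - p" V W "q' - q"]
    by (simp add: tcoset_eq_iff) (simp add: tcoset_def algebra_simps)
  then have "(\<Union>p'\<in>tcoset V W p. \<Union>q'\<in>tcoset V W q. tcoset V W (p' + q')) = tcoset V W (p + q)"
    using tcoset_self[of p V W] tcoset_self[of q V W] by (intro SUP_eq_const) blast+
  then show ?thesis by (simp add: tensor_space_def)
qed

lemma tensor_smult [simp]: "c \<odot>\<^bsub>tensor_space V W\<^esub> tcoset V W p = tcoset V W (fscale c p)"
proof -
  have "tcoset V W (fscale c p') = tcoset V W (fscale c p)" if "p' \<in> tcoset V W p" for p'
    using that tensor_null_scale[of "p' - p" V W c]
    by (simp add: tcoset_eq_iff) (simp add: tcoset_def fs.scale_right_diff_distrib)
  then have "(\<Union>p'\<in>tcoset V W p. tcoset V W (fscale c p')) = tcoset V W (fscale c p)"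
    using tcoset_self[of p V W] by (intro SUP_eq_const) blast+
  then show ?thesis by (simp add: tensor_space_def)
qed

lemma tensor_zero [simp]: "\<zero>\<^bsub>tensor_space V W\<^esub> = tcoset V W 0"
  by (simp add: tensor_space_def)

lemma tensor_carrier:
  "carrier (tensor_space V W) = tcoset V W ` {p. Poly_Mapping.keys p \<subseteq> carrier V \<times> carrier W}"
  by (simp add: tensor_space_def)

lemma tcoset_carrier:
  "Poly_Mapping.keys p \<subseteq> carrier V \<times> carrier W \<Longrightarrow> tcoset V W p \<in> carrier (tensor_space V W)"
  by (auto simp: tensor_carrier)

lemma keys_add_subset: "Poly_Mapping.keys p \<subseteq> A \<Longrightarrow> Poly_Mapping.keys q \<subseteq> A \<Longrightarrow> Poly_Mapping.keys (p + q) \<subseteq> A"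
  using Poly_Mapping.keys_add[of p q] by blast

lemma keys_fscale_subset: "Poly_Mapping.keys p \<subseteq> A \<Longrightarrow> Poly_Mapping.keys (fscale c p) \<subseteq> A"
  using keys_fscale[of c p] by blast

lemma kspace_tensor [simp]: "kspace (tensor_space V W)"
proof (rule kspaceI, rule abelian_groupI)
  fix x assume "x \<in> carrier (tensor_space V W)"
  then obtain p where p: "x = tcoset V W p" "Poly_Mapping.keys p \<subseteq> carrier V \<times> carrier W"
    by (auto simp: tensor_carrier)
  have "tcoset V W (- p) \<in> carrier (tensor_space V W)"
    using p(2) by (intro tcoset_carrier) (auto simp: in_keys_iff)
  moreover have "tcoset V W (- p) \<oplus>\<^bsub>tensor_space V W\<^esub> x = \<zero>\<^bsub>tensor_space V W\<^esub>"
    by (simp add: p)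
  ultimately show "\<exists>y\<in>carrier (tensor_space V W). y \<oplus>\<^bsub>tensor_space V W\<^esub> x = \<zero>\<^bsub>tensor_space V W\<^esub>"
    by blast
qed (auto simp: tensor_carrier keys_add_subset keys_fscale_subset add.assoc fs.scale_right_distrib
      fs.scale_left_distrib, simp_all add: add.commute)

lemma tens_carrier: "v \<in> carrier V \<Longrightarrow> w \<in> carrier W \<Longrightarrow> tens V W v w \<in> carrier (tensor_space V W)"
  by (auto simp: tens_def intro!: tcoset_carrier)

text \<open>Every relation is supported on pairs from the carriers. Hence any representative of a
  coset in the carrier is supported there too, which controls the arbitrary choice made by
  \<open>tlift\<close>.\<close>

lemma keys_tensor_null:
  assumes "kspace V" "kspace W" "p \<in> tensor_null V W"
  shows "Poly_Mapping.keys p \<subseteq> carrier V \<times> carrier W"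
proof -
  have sub: "fs.subspace {p :: 'b \<times> 'c \<Rightarrow>\<^sub>0 'a. Poly_Mapping.keys p \<subseteq> carrier V \<times> carrier W}"
    by (simp add: fs.subspace_def keys_add_subset keys_fscale_subset)
  have D: "Poly_Mapping.keys (a - b) \<subseteq> carrier V \<times> carrier W"
    if "Poly_Mapping.keys a \<subseteq> carrier V \<times> carrier W" "Poly_Mapping.keys b \<subseteq> carrier V \<times> carrier W"
    for a b :: "'b \<times> 'c \<Rightarrow>\<^sub>0 'a"
    using that fs.subspace_diff[OF sub] by auto
  have "tensor_relations V W \<subseteq> {p. Poly_Mapping.keys p \<subseteq> carrier V \<times> carrier W}"
    unfolding tensor_relations_def
    by (rule subsetI, rule CollectI, elim UnE CollectE exE conjE, hypsubst)
      (simp_all add: D kspaceD[OF assms(1)] kspaceD[OF assms(2)])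
  from fs.span_minimal[OF this sub] show ?thesis
    using assms(3) by (auto simp: tensor_null_def)
qed

lemma keys_tcoset_mem:
  assumes "kspace V" "kspace W" "C \<in> carrier (tensor_space V W)" "p \<in> C"
  shows "Poly_Mapping.keys p \<subseteq> carrier V \<times> carrier W" "C = tcoset V W p"
proof -
  obtain q where q: "C = tcoset V W q" "Poly_Mapping.keys q \<subseteq> carrier V \<times> carrier W"
    using assms(3) by (auto simp: tensor_carrier)
  have "p - q \<in> tensor_null V W" using assms(4) q by (simp add: tcoset_def)
  from keys_tensor_null[OF assms(1,2) this] q(2)
  have "Poly_Mapping.keys ((p - q) + q) \<subseteq> carrier V \<times> carrier W" by (rule keys_add_subset)
  then show "Poly_Mapping.keys p \<subseteq> carrier V \<times> carrier W" by simp
  show "C = tcoset V W p" using assms(4) unfolding q(1) tcoset_mem by (rule sym)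
qed

lemma some_rep:
  assumes "kspace V" "kspace W" "C \<in> carrier (tensor_space V W)"
  shows "Poly_Mapping.keys (SOME p. p \<in> C) \<subseteq> carrier V \<times> carrier W" "C = tcoset V W (SOME p. p \<in> C)"
proof -
  obtain q where "C = tcoset V W q" using assms(3) by (auto simp: tensor_carrier)
  then have "q \<in> C" by (simp add: tcoset_self)
  then have "(SOME p. p \<in> C) \<in> C" by (rule someI)
  from keys_tcoset_mem[OF assms this] show "Poly_Mapping.keys (SOME p. p \<in> C) \<subseteq> carrier V \<times> carrier W" "C = tcoset V W (SOME p. p \<in> C)"
    by auto
qed

lemma vector_space_mult: "vector_space ((*) :: 'k::field \<Rightarrow> 'k \<Rightarrow> 'k)"
  by unfold_locales (simp_all add: algebra_simps)

lemma linearD: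
  assumes "Vector_Spaces.linear s1 s2 f"
  shows "f (x + y) = f x + f y" "f (s1 c x) = s2 c (f x)" "vector_space s1" "vector_space s2"
  using assms by (auto simp: Vector_Spaces.linear_iff)

subsection \<open>Functionals\<close>

text \<open>\<open>\<kappa>\<close> is the structure map of a commutative algebra.  It is needed both for \<open>\<kappa> = id\<close> and for the
  embedding of the ground field into the field of fractions of the symmetric algebra.\<close>

locale scalars =
  fixes \<kappa> :: "'k::field \<Rightarrow> 'r::comm_ring_1"
  assumes scal_1 [simp]: "\<kappa> 1 = 1"
    and scal_add [simp]: "\<kappa> (a + b) = \<kappa> a + \<kappa> b"
    and scal_mult [simp]: "\<kappa> (a * b) = \<kappa> a * \<kappa> b"
begin

lemma scal_0 [simp]: "\<kappa> 0 = 0" using scal_add[of 0 0] by simp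

lemma scal_minus [simp]: "\<kappa> (- a) = - \<kappa> a"
  using scal_add[of a "- a"] by (simp add: eq_neg_iff_add_eq_0 add.commute)

lemma scal_diff [simp]: "\<kappa> (a - b) = \<kappa> a - \<kappa> b"
  using scal_add[of a "- b"] by simp

lemma scal_sum: "\<kappa> (sum f A) = (\<Sum>a\<in>A. \<kappa> (f a))"
  by (induction A rule: infinite_finite_induct) auto

definition lc :: "('a \<Rightarrow> 'r) \<Rightarrow> ('a \<Rightarrow>\<^sub>0 'k) \<Rightarrow> 'r" where
  "lc g p = (\<Sum>a\<in>Poly_Mapping.keys p. \<kappa> (Poly_Mapping.lookup p a) * g a)"

lemma lc_superset:
  assumes "finite A" "Poly_Mapping.keys p \<subseteq> A"
  shows "lc g p = (\<Sum>a\<in>A. \<kappa> (Poly_Mapping.lookup p a) * g a)"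
  unfolding lc_def by (rule sum.mono_neutral_left) (use assms in \<open>auto simp: in_keys_iff\<close>)

lemma lc_0 [simp]: "lc g 0 = 0" by (simp add: lc_def)

lemma lc_single [simp]: "lc g (Poly_Mapping.single a c) = \<kappa> c * g a"
  by (subst lc_superset[of "{a}"]) auto

lemma lc_add [simp]: "lc g (p + q) = lc g p + lc g q"
  unfolding lc_def by (rule Poly_Mapping.setsum_keys_plus_distrib) (auto simp: algebra_simps)

lemma lc_scale [simp]: "lc g (fscale c p) = \<kappa> c * lc g p"
  by (subst lc_superset[of "Poly_Mapping.keys p"])
    (auto simp: keys_fscale lc_def sum_distrib_left mult.assoc)

lemma lc_minus [simp]: "lc g (- p) = - lc g p"
  using lc_add[of g p "- p"] by (simp add: eq_neg_iff_add_eq_0 add.commute)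

lemma lc_diff [simp]: "lc g (p - q) = lc g p - lc g q"
  using lc_add[of g p "- q"] by simp

lemma lc_cong: "(\<And>a. a \<in> Poly_Mapping.keys p \<Longrightarrow> f a = g a) \<Longrightarrow> lc f p = lc g p"
  by (simp add: lc_def)

lemma lc_fun_add: "lc (\<lambda>a. f a + g a) p = lc f p + lc g p"
  by (simp add: lc_def algebra_simps sum.distrib)

lemma lc_fun_mult_left: "lc (\<lambda>a. c * f a) p = c * lc f p"
  unfolding lc_def sum_distrib_left by (rule sum.cong) (simp_all add: ac_simps)

lemma lc_fun_mult_right: "lc (\<lambda>a. f a * c) p = lc f p * c"
  unfolding lc_def sum_distrib_right by (rule sum.cong) (simp_all add: ac_simps)

lemma lc_swap: "lc (\<lambda>a. lc (\<lambda>b. g a b) q) p = lc (\<lambda>b. lc (\<lambda>a. g a b) p) q"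
  unfolding lc_def sum_distrib_left
  by (subst sum.swap) (simp add: mult.left_commute)

definition RR :: "('k, 'r) module" where
  "RR = alg_of (\<lambda>c z. \<kappa> c * z)"

abbreviation tl :: "('v \<Rightarrow> 'w \<Rightarrow> 'r) \<Rightarrow> ('v \<times> 'w \<Rightarrow>\<^sub>0 'k) set \<Rightarrow> 'r" where
  "tl \<equiv> tlift RR"

lemma formal_sum_RR: "formal_sum RR B p = lc (\<lambda>a. B (fst a) (snd a)) p"
  by (simp add: RR_def formal_sum_def finsum_alg_of lc_def)

lemma tl_eq: "tl B C = lc (\<lambda>a. B (fst a) (snd a)) (SOME p. p \<in> C)"
  by (simp add: tlift_def formal_sum_RR)

text \<open>\<open>tl\<close> evaluates on a chosen representative that depends on the coset only.
  Therefore it is linear in the form, and iterated values commute, for arbitrary and not necessarily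
  bilinear functions.\<close>

lemma tl_fun_add: "tl (\<lambda>a b. f a b + g a b) C = tl f C + tl g C"
  by (simp add: tl_eq lc_fun_add)

lemma tl_fun_mult_left: "tl (\<lambda>a b. c * f a b) C = c * tl f C"
  by (simp add: tl_eq lc_fun_mult_left)

lemma tl_fun_mult_right: "tl (\<lambda>a b. f a b * c) C = tl f C * c"
  by (simp add: tl_eq lc_fun_mult_right)

lemma tl_swap: "tl (\<lambda>a b. tl (\<lambda>c d. g a b c d) D) C = tl (\<lambda>c d. tl (\<lambda>a b. g a b c d) C) D"
  unfolding tl_eq by (rule lc_swap)

definition linfun :: "('k, 'v) module \<Rightarrow> ('v \<Rightarrow> 'r) \<Rightarrow> bool" where
  "linfun V l \<longleftrightarrow> (\<forall>v\<in>carrier V. \<forall>w\<in>carrier V. l (v \<oplus>\<^bsub>V\<^esub> w) = l v + l w) \<and>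
     (\<forall>c. \<forall>v\<in>carrier V. l (c \<odot>\<^bsub>V\<^esub> v) = \<kappa> c * l v)"

lemma linfunD:
  assumes "linfun V l"
  shows "v \<in> carrier V \<Longrightarrow> w \<in> carrier V \<Longrightarrow> l (v \<oplus>\<^bsub>V\<^esub> w) = l v + l w"
    "v \<in> carrier V \<Longrightarrow> l (c \<odot>\<^bsub>V\<^esub> v) = \<kappa> c * l v"
  using assms by (auto simp: linfun_def)

lemma linfun_zero:
  assumes "kspace V" "linfun V l"
  shows "l \<zero>\<^bsub>V\<^esub> = 0"
  using linfunD(2)[OF assms(2), of "\<zero>\<^bsub>V\<^esub>" 0] kspaceD(8,9)[OF assms(1)] by simp

lemma linfun_finsum:
  assumes "kspace V" "linfun V l" "f \<in> A \<rightarrow> carrier V"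
  shows "l (finsum V f A) = (\<Sum>a\<in>A. l (f a))"
proof -
  interpret abelian_group V using assms(1) by (rule kspaceD)
  show ?thesis using assms(3)
  proof (induction A rule: infinite_finite_induct)
    case (infinite A)
    then show ?case by (simp add: finsum_infinite linfun_zero[OF assms(1,2)])
  next
    case empty
    then show ?case by (simp add: linfun_zero[OF assms(1,2)])
  next
    case (insert x F)
    then show ?case using finsum_closed[of f F] by (simp add: Pi_def finsum_insert linfunD[OF assms(2)])
  qed
qed

lemma linfun_formal_sum:
  assumes "kspace Z" "\<And>a. a \<in> Poly_Mapping.keys p \<Longrightarrow> F (fst a) (snd a) \<in> carrier Z"
  shows "formal_sum Z F p \<in> carrier Z"
    "linfun Z l \<Longrightarrow> l (formal_sum Z F p) = lc (\<lambda>a. l (F (fst a) (snd a))) p"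
proof -
  interpret abelian_group Z using assms(1) by (rule kspaceD)
  have *: "(\<lambda>a. Poly_Mapping.lookup p a \<odot>\<^bsub>Z\<^esub> F (fst a) (snd a)) \<in> Poly_Mapping.keys p \<rightarrow> carrier Z"
    using assms(2) kspaceD(2)[OF assms(1)] by auto
  show "formal_sum Z F p \<in> carrier Z"
    unfolding formal_sum_def by (rule finsum_closed[OF *])
  show "l (formal_sum Z F p) = lc (\<lambda>a. l (F (fst a) (snd a))) p" if "linfun Z l"
    unfolding formal_sum_def linfun_finsum[OF assms(1) that *] lc_def
    by (rule sum.cong[OF refl]) (rule linfunD(2)[OF that assms(2)])
qed

text \<open>A linear functional passes through the finite sum that computes \<open>tlift\<close>.
  With functionals from a separating family, an equality in \<open>Z\<close> becomes one in the
  coefficient algebra.\<close>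

lemma linfun_tlift:
  assumes "kspace V" "kspace W" "kspace Z" "C \<in> carrier (tensor_space V W)"
    and "\<And>v w. v \<in> carrier V \<Longrightarrow> w \<in> carrier W \<Longrightarrow> F v w \<in> carrier Z"
  shows "tlift Z F C \<in> carrier Z"
    "linfun Z l \<Longrightarrow> l (tlift Z F C) = tl (\<lambda>v w. l (F v w)) C"
proof -
  have *: "F (fst a) (snd a) \<in> carrier Z" if "a \<in> Poly_Mapping.keys (SOME p. p \<in> C)" for a
    using some_rep(1)[OF assms(1,2,4)] that assms(5) by auto
  show "tlift Z F C \<in> carrier Z"
    unfolding tlift_def by (rule linfun_formal_sum(1)[OF assms(3)]) (rule *)
  show "l (tlift Z F C) = tl (\<lambda>v w. l (F v w)) C" if "linfun Z l"
    unfolding tlift_def formal_sum_RR by (rule linfun_formal_sum(2)[OF assms(3) _ that]) (rule *)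
qed

lemma tl_cong:
  assumes "kspace V" "kspace W" "C \<in> carrier (tensor_space V W)"
    and "\<And>v w. v \<in> carrier V \<Longrightarrow> w \<in> carrier W \<Longrightarrow> B v w = B' v w"
  shows "tl B C = tl B' C"
  unfolding tl_eq using some_rep(1)[OF assms(1-3)] assms(4) by (intro lc_cong) auto

definition bil :: "('k, 'v) module \<Rightarrow> ('k, 'w) module \<Rightarrow> ('v \<Rightarrow> 'w \<Rightarrow> 'r) \<Rightarrow> bool" where
  "bil V W B \<longleftrightarrow> (\<forall>w\<in>carrier W. linfun V (\<lambda>v. B v w)) \<and> (\<forall>v\<in>carrier V. linfun W (B v))"

text \<open>A bilinear form kills each of the four kinds of relations, and the zeros of
  \<open>lc\<close> form a subspace. This is the well-definedness of \<open>tlift\<close>.\<close>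

lemma lc_null:
  assumes "bil V W B" "p \<in> tensor_null V W"
  shows "lc (\<lambda>a. B (fst a) (snd a)) p = 0"
proof -
  have "tensor_null V W \<subseteq> {p. lc (\<lambda>a. B (fst a) (snd a)) p = 0}"
    unfolding tensor_null_def
  proof (rule fs.span_minimal)
    show "tensor_relations V W \<subseteq> {p. lc (\<lambda>a. B (fst a) (snd a)) p = 0}"
      using assms(1) by (auto simp: tensor_relations_def bil_def linfun_def)
    show "fs.subspace {p. lc (\<lambda>a. B (fst a) (snd a)) p = 0}"
      by (simp add: fs.subspace_def)
  qed
  then show ?thesis using assms(2) by auto
qed

lemma tl_tcoset:
  assumes "bil V W B"
  shows "tl B (tcoset V W p) = lc (\<lambda>a. B (fst a) (snd a)) p"
proof -
  have "(SOME q. q \<in> tcoset V W p) \<in> tcoset V W p"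
    using tcoset_self by (rule someI)
  then have "(SOME q. q \<in> tcoset V W p) - p \<in> tensor_null V W"
    by (simp add: tcoset_def)
  from lc_null[OF assms this] show ?thesis by (simp add: tl_eq)
qed

lemma tl_tens:
  assumes "bil V W B"
  shows "tl B (tens V W v w) = B v w"
  by (simp add: tens_def tl_tcoset[OF assms])

lemma linfun_tl:
  assumes "bil V W B"
  shows "linfun (tensor_space V W) (tl B)"
  unfolding linfun_def by (auto simp: tensor_carrier tl_tcoset[OF assms])

text \<open>Plays the part of a dual space. The functionals take values in the coefficient algebra,
  so that for this algebra itself the identity alone is a separating family.\<close>

definition separates :: "('k, 'v) module \<Rightarrow> ('v \<Rightarrow> 'r) set \<Rightarrow> bool" where
  "separates V L \<longleftrightarrow> (\<forall>l\<in>L. linfun V l) \<and>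
     (\<forall>v\<in>carrier V. \<forall>w\<in>carrier V. (\<forall>l\<in>L. l v = l w) \<longrightarrow> v = w)"

lemma separatesD:
  assumes "separates V L"
  shows "l \<in> L \<Longrightarrow> linfun V l"
    "v \<in> carrier V \<Longrightarrow> w \<in> carrier V \<Longrightarrow> (\<And>l. l \<in> L \<Longrightarrow> l v = l w) \<Longrightarrow> v = w"
  using assms unfolding separates_def by blast+

end

section \<open>Separating functionals on tensor products\<close>

lemma poly_mapping_sum_single: "(\<Sum>a\<in>Poly_Mapping.keys p. Poly_Mapping.single a (Poly_Mapping.lookup p a)) = p"
  by (rule poly_mapping_eqI) (auto simp: lookup_sum lookup_single when_def in_keys_iff)

lemma tensor_null_l_add:
  "v \<in> carrier V \<Longrightarrow> v' \<in> carrier V \<Longrightarrow> w \<in> carrier W \<Longrightarrow>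
   Poly_Mapping.single (v \<oplus>\<^bsub>V\<^esub> v', w) 1 - (Poly_Mapping.single (v, w) 1 + Poly_Mapping.single (v', w) 1)
     \<in> tensor_null V W"
  unfolding tensor_null_def by (rule fs.span_base) (auto simp: tensor_relations_def diff_diff_eq[symmetric])

lemma tensor_null_r_add:
  "v \<in> carrier V \<Longrightarrow> w \<in> carrier W \<Longrightarrow> w' \<in> carrier W \<Longrightarrow>
   Poly_Mapping.single (v, w \<oplus>\<^bsub>W\<^esub> w') 1 - (Poly_Mapping.single (v, w) 1 + Poly_Mapping.single (v, w') 1)
     \<in> tensor_null V W"
  unfolding tensor_null_def by (rule fs.span_base) (auto simp: tensor_relations_def diff_diff_eq[symmetric])

lemma tensor_null_l_scale:
  "v \<in> carrier V \<Longrightarrow> w \<in> carrier W \<Longrightarrow>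
   Poly_Mapping.single (c \<odot>\<^bsub>V\<^esub> v, w) 1 - Poly_Mapping.single (v, w) c \<in> tensor_null V W"
  unfolding tensor_null_def by (rule fs.span_base) (auto simp: tensor_relations_def)

lemma tensor_null_r_scale:
  "v \<in> carrier V \<Longrightarrow> w \<in> carrier W \<Longrightarrow>
   Poly_Mapping.single (v, c \<odot>\<^bsub>W\<^esub> w) 1 - Poly_Mapping.single (v, w) c \<in> tensor_null V W"
  unfolding tensor_null_def by (rule fs.span_base) (auto simp: tensor_relations_def)

lemma kspace_alg_of: "vector_space s \<Longrightarrow> kspace (alg_of s)"
proof -
  assume "vector_space s"
  then interpret vector_space s .
  show ?thesis
    by (rule kspaceI) (auto simp: ring.is_abelian_group scale_right_distrib scale_left_distrib)
qed

lemma tensor_null_trans: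
  "p - q \<in> tensor_null V W \<Longrightarrow> q - r \<in> tensor_null V W \<Longrightarrow> p - r \<in> tensor_null V W"
  using tensor_null_add[of "p - q" V W "q - r"] by simp

lemma tensor_null_sum_diff:
  "(\<And>a. a \<in> A \<Longrightarrow> f a - g a \<in> tensor_null V W) \<Longrightarrow> sum f A - sum g A \<in> tensor_null V W"
  using tensor_null_sum[of A "\<lambda>a. f a - g a" V W] by (simp add: sum_subtractf)

lemma tensor_null_finsum:
  assumes "kspace V" "f \<in> A \<rightarrow> carrier V" "w \<in> carrier W" "finite A"
  shows "Poly_Mapping.single (finsum V f A, w) 1 - (\<Sum>a\<in>A. Poly_Mapping.single (f a, w) 1) \<in> tensor_null V W"
proof -
  interpret abelian_group V using assms(1) by (rule kspaceD)
  show ?thesis using assms(4,2)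
  proof (induction A rule: finite_induct)
    case empty
    then show ?case
      using tensor_null_l_scale[of "\<zero>\<^bsub>V\<^esub>" V w W 0] kspaceD(9)[OF assms(1), of "\<zero>\<^bsub>V\<^esub>"] assms(3) by simp
  next
    case (insert a A)
    have "Poly_Mapping.single (f a \<oplus>\<^bsub>V\<^esub> finsum V f A, w) 1
        - (Poly_Mapping.single (f a, w) 1 + Poly_Mapping.single (finsum V f A, w) 1) \<in> tensor_null V W"
      using insert.prems assms(3) by (intro tensor_null_l_add) (auto intro: finsum_closed)
    moreover have "(Poly_Mapping.single (f a, w) 1 + Poly_Mapping.single (finsum V f A, w) 1)
        - (Poly_Mapping.single (f a, w) 1 + (\<Sum>a\<in>A. Poly_Mapping.single (f a, w) 1)) \<in> tensor_null V W"
      using insert by (subst add_diff_cancel_left) (simp add: Pi_def)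
    ultimately have "Poly_Mapping.single (f a \<oplus>\<^bsub>V\<^esub> finsum V f A, w) 1
        - (Poly_Mapping.single (f a, w) 1 + (\<Sum>a\<in>A. Poly_Mapping.single (f a, w) 1)) \<in> tensor_null V W"
      by (rule tensor_null_trans)
    then show ?case
      using insert by (simp add: Pi_def finsum_insert)
  qed
qed

text \<open>Expanding the second factor in \<open>E\<close> and moving the scalars to the left leads
  to a normal form with one first factor for each \<open>e\<close>.\<close>

lemma tensor_null_expand:
  assumes "kspace V" "vector_space s" "v \<in> carrier V" "finite E" "w = (\<Sum>e\<in>E. s (r e) e)"
  shows "Poly_Mapping.single (v, w) c - (\<Sum>e\<in>E. Poly_Mapping.single ((c * r e) \<odot>\<^bsub>V\<^esub> v, e) 1)
           \<in> tensor_null V (alg_of s)"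
proof -
  interpret vector_space s by (rule assms(2))
  let ?N = "tensor_null V (alg_of s)"
  have 1: "Poly_Mapping.single (v, \<Sum>e\<in>E. s (r e) e) 1 - (\<Sum>e\<in>E. Poly_Mapping.single (v, e) (r e)) \<in> ?N"
    using assms(4)
  proof (induction E rule: finite_induct)
    case empty
    then show ?case using tensor_null_r_scale[of v V 0 "alg_of s" 0] assms(3) by simp
  next
    case (insert a A)
    have "Poly_Mapping.single (v, s (r a) a + (\<Sum>e\<in>A. s (r e) e)) 1
        - (Poly_Mapping.single (v, s (r a) a) 1 + Poly_Mapping.single (v, \<Sum>e\<in>A. s (r e) e) 1) \<in> ?N"
      using tensor_null_r_add[of v V "s (r a) a" "alg_of s"] assms(3) by simp
    moreover have "(Poly_Mapping.single (v, s (r a) a) 1 + Poly_Mapping.single (v, \<Sum>e\<in>A. s (r e) e) 1)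
        - (Poly_Mapping.single (v, a) (r a) + (\<Sum>e\<in>A. Poly_Mapping.single (v, e) (r e))) \<in> ?N"
      using tensor_null_add[OF tensor_null_r_scale[of v V a "alg_of s" "r a"] insert.IH] assms(3)
      by (simp add: add_diff_add)
    ultimately show ?case using insert.hyps by simp (rule tensor_null_trans)
  qed
  have 2: "Poly_Mapping.single (v, w) c - (\<Sum>e\<in>E. Poly_Mapping.single (v, e) (c * r e)) \<in> ?N"
    using tensor_null_scale[OF 1, of c] by (simp add: assms(5) fs.scale_right_diff_distrib fs.scale_sum_right)
  have 3: "Poly_Mapping.single (v, e) (c * r e) - Poly_Mapping.single ((c * r e) \<odot>\<^bsub>V\<^esub> v, e) 1 \<in> ?N" for e
    using tensor_null_neg[OF tensor_null_l_scale[of v V e "alg_of s" "c * r e"]] assms(3) by simp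
  show ?thesis by (rule tensor_null_trans[OF 2 tensor_null_sum_diff[OF 3]])
qed

text \<open>A tensor can be written with the elements of a basis of the second space as second
  factors. The coordinate functionals of that basis isolate the first factors, and \<open>L\<close>
  detects whether these vanish. No basis of \<open>V\<close> enters, so \<open>V\<close> may be a
  quotient or again a tensor product.\<close>

lemma (in scalars) separates_tensor:
  assumes "kspace V" "separates V L" "vector_space s"
  shows "separates (tensor_space V (alg_of s))
           {tl (\<lambda>v h. l v * \<kappa> (m h)) | l m. l \<in> L \<and> Vector_Spaces.linear s (*) m}"
  unfolding separates_def
proof (intro conjI ballI impI)
  interpret vector_space s by (rule assms(3))
  have bil: "bil V (alg_of s) (\<lambda>v h. l v * \<kappa> (m h))"
    if "l \<in> L" "Vector_Spaces.linear s (*) m" for l m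
    using separatesD(1)[OF assms(2) that(1)] that(2)
    by (auto simp: bil_def linfun_def algebra_simps linearD)
  show "linfun (tensor_space V (alg_of s)) f"
    if "f \<in> {tl (\<lambda>v h. l v * \<kappa> (m h)) | l m. l \<in> L \<and> Vector_Spaces.linear s (*) m}" for f
    using that bil linfun_tl by blast
  fix C D
  assume C: "C \<in> carrier (tensor_space V (alg_of s))" and D: "D \<in> carrier (tensor_space V (alg_of s))"
    and eq: "\<forall>f\<in>{tl (\<lambda>v h. l v * \<kappa> (m h)) | l m. l \<in> L \<and> Vector_Spaces.linear s (*) m}. f C = f D"
  obtain p q where p: "C = tcoset V (alg_of s) p" "Poly_Mapping.keys p \<subseteq> carrier V \<times> UNIV"
    and q: "D = tcoset V (alg_of s) q" "Poly_Mapping.keys q \<subseteq> carrier V \<times> UNIV"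
    using C D by (auto simp: tensor_carrier)
  define d where "d = p - q"
  have dk: "Poly_Mapping.keys d \<subseteq> carrier V \<times> UNIV"
    using keys_add_subset[OF p(2), of "- q"] q(2) by (simp add: d_def)
  have d0: "lc (\<lambda>a. l (fst a) * \<kappa> (m (snd a))) d = 0" if "l \<in> L" "Vector_Spaces.linear s (*) m" for l m
  proof -
    have "tl (\<lambda>v h. l v * \<kappa> (m h)) C = tl (\<lambda>v h. l v * \<kappa> (m h)) D" using eq that by blast
    then show ?thesis by (simp add: d_def p q tl_tcoset[OF bil[OF that]])
  qed
  \<comment> \<open>A basis of the whole space, as an extension of the empty independent
    set.\<close>
  define B where "B = extend_basis {}"
  have indB: "independent B" and spB: "span B = UNIV"
    unfolding B_def using independent_extend_basis[of "{}"] span_extend_basis[of "{}"]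
    by (auto simp: independent_empty)
  define r where "r = representation B"
  have rlin: "Vector_Spaces.linear s (*) (\<lambda>w. r w e)" for e
    unfolding Vector_Spaces.linear_iff r_def using indB spB
    by (auto simp: representation_add representation_scale vector_space_axioms
        vector_space_mult)
  define E where "E = (\<Union>a\<in>Poly_Mapping.keys d. {e. r (snd a) e \<noteq> 0})"
  have finE: "finite E" unfolding E_def r_def by (auto intro: finite_representation)
  have expand: "snd a = (\<Sum>e\<in>E. s (r (snd a) e) e)" if "a \<in> Poly_Mapping.keys d" for a
  proof -
    have "(\<Sum>e\<in>E. s (r (snd a) e) e) = (\<Sum>e | r (snd a) e \<noteq> 0. s (r (snd a) e) e)"
      using that finE by (intro sum.mono_neutral_right) (auto simp: E_def)
    then show ?thesis using sum_nonzero_representation_eq[OF indB, of "snd a"] spB by (simp add: r_def)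
  qed
  let ?N = "tensor_null V (alg_of s)"
  let ?x = "\<lambda>a e. (Poly_Mapping.lookup d a * r (snd a) e) \<odot>\<^bsub>V\<^esub> fst a"
  \<comment> \<open>The first factor belonging to \<open>e\<close> once all terms of
    \<open>d\<close> are expanded in the basis.\<close>
  define u where "u e = finsum V (\<lambda>a. ?x a e) (Poly_Mapping.keys d)" for e
  have xc: "(\<lambda>a. ?x a e) \<in> Poly_Mapping.keys d \<rightarrow> carrier V" for e
    using dk kspaceD(2)[OF assms(1)] by auto
  interpret V: abelian_group V using assms(1) by (rule kspaceD)
  \<comment> \<open>The functional built from \<open>l\<close> and the coordinate at
    \<open>e\<close> takes the value \<open>l (u e)\<close> on \<open>d\<close>, and it vanishes on
    \<open>d\<close> by \<open>d0\<close>.\<close>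
  have u0: "u e = \<zero>\<^bsub>V\<^esub>" for e
  proof (rule separatesD(2)[OF assms(2)])
    show "u e \<in> carrier V" unfolding u_def by (rule V.finsum_closed[OF xc])
    fix l assume l: "l \<in> L"
    note ll = separatesD(1)[OF assms(2) l]
    have "l (u e) = (\<Sum>a\<in>Poly_Mapping.keys d. l (?x a e))"
      unfolding u_def by (rule linfun_finsum[OF assms(1) ll xc])
    also have "\<dots> = lc (\<lambda>a. l (fst a) * \<kappa> (r (snd a) e)) d"
      unfolding lc_def using dk by (intro sum.cong refl) (auto simp: linfunD(2)[OF ll] ac_simps)
    finally show "l (u e) = l \<zero>\<^bsub>V\<^esub>"
      using d0[OF l rlin] linfun_zero[OF assms(1) ll] by simp
  qed simp
  have "d - (\<Sum>a\<in>Poly_Mapping.keys d. \<Sum>e\<in>E. Poly_Mapping.single (?x a e, e) 1) \<in> ?N"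
    using dk tensor_null_expand[OF assms(1,3) _ finE expand]
    by (subst poly_mapping_sum_single[of d, symmetric]) (rule tensor_null_sum_diff, auto)
  moreover have "(\<Sum>a\<in>Poly_Mapping.keys d. \<Sum>e\<in>E. Poly_Mapping.single (?x a e, e) 1) -
      (\<Sum>e\<in>E. Poly_Mapping.single (u e, e) 1) \<in> ?N"
    unfolding u_def using tensor_null_neg[OF tensor_null_finsum[OF assms(1) xc, of _ "alg_of s"]]
    by (subst sum.swap) (rule tensor_null_sum_diff, simp)
  \<comment> \<open>The instance of \<open>tensor_null_finsum\<close> with an empty index set says
    that a pair with first entry zero is null.\<close>
  moreover have "(\<Sum>e\<in>E. Poly_Mapping.single (u e, e) 1) - 0 \<in> ?N"
    using tensor_null_finsum[OF assms(1), of undefined "{}" _ "alg_of s"]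
    by (auto simp: u0 intro!: tensor_null_sum)
  ultimately have "d - 0 \<in> ?N" by (blast intro: tensor_null_trans)
  then show "C = D" by (simp add: p q d_def tcoset_eq_iff)
qed

lemma tensor_alg_simps [simp]:
  "carrier (tensor_alg A B) = carrier (tensor_space A B)"
  "add (tensor_alg A B) = add (tensor_space A B)"
  "zero (tensor_alg A B) = zero (tensor_space A B)"
  "(\<odot>\<^bsub>tensor_alg A B\<^esub>) = (\<odot>\<^bsub>tensor_space A B\<^esub>)"
  "one (tensor_alg A B) = tens A B \<one>\<^bsub>A\<^esub> \<one>\<^bsub>B\<^esub>"
  by (simp_all add: tensor_alg_def tensor_space_def)

lemma alg_homD:
  assumes "f \<in> alg_hom A B"
  shows "x \<in> carrier A \<Longrightarrow> f x \<in> carrier B"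
    "x \<in> carrier A \<Longrightarrow> y \<in> carrier A \<Longrightarrow> f (x \<oplus>\<^bsub>A\<^esub> y) = f x \<oplus>\<^bsub>B\<^esub> f y"
    "x \<in> carrier A \<Longrightarrow> y \<in> carrier A \<Longrightarrow> f (x \<otimes>\<^bsub>A\<^esub> y) = f x \<otimes>\<^bsub>B\<^esub> f y"
    "f \<one>\<^bsub>A\<^esub> = \<one>\<^bsub>B\<^esub>"
    "x \<in> carrier A \<Longrightarrow> f (c \<odot>\<^bsub>A\<^esub> x) = c \<odot>\<^bsub>B\<^esub> f x"
  using assms unfolding alg_hom_def Ring.ring_hom_def by auto

lemma (in scalars) tensor_alg_mult:
  assumes "kspace A" "kspace B"
    and "\<And>x y. x \<in> carrier A \<Longrightarrow> y \<in> carrier A \<Longrightarrow> x \<otimes>\<^bsub>A\<^esub> y \<in> carrier A"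
    and "\<And>x y. x \<in> carrier B \<Longrightarrow> y \<in> carrier B \<Longrightarrow> x \<otimes>\<^bsub>B\<^esub> y \<in> carrier B"
    and "P \<in> carrier (tensor_space A B)" "Q \<in> carrier (tensor_space A B)"
  shows "P \<otimes>\<^bsub>tensor_alg A B\<^esub> Q \<in> carrier (tensor_space A B)"
    "linfun (tensor_space A B) l \<Longrightarrow> l (P \<otimes>\<^bsub>tensor_alg A B\<^esub> Q) =
       tl (\<lambda>a b. tl (\<lambda>a' b'. l (tens A B (a \<otimes>\<^bsub>A\<^esub> a') (b \<otimes>\<^bsub>B\<^esub> b'))) Q) P"
proof -
  let ?T = "tensor_space A B"
  let ?in = "\<lambda>a b. tlift ?T (\<lambda>a' b'. tens A B (a \<otimes>\<^bsub>A\<^esub> a') (b \<otimes>\<^bsub>B\<^esub> b')) Q"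
  have eq: "P \<otimes>\<^bsub>tensor_alg A B\<^esub> Q = tlift ?T ?in P" by (simp add: tensor_alg_def)
  have 1: "?in a b \<in> carrier ?T" if "a \<in> carrier A" "b \<in> carrier B" for a b
    using that assms by (intro linfun_tlift(1)[OF assms(1,2) _ assms(6)]) (auto intro!: tens_carrier)
  show "P \<otimes>\<^bsub>tensor_alg A B\<^esub> Q \<in> carrier ?T"
    unfolding eq by (rule linfun_tlift(1)[OF assms(1,2) _ assms(5)]) (auto intro!: 1)
  assume l: "linfun ?T l"
  have "l (tlift ?T ?in P) = tl (\<lambda>a b. l (?in a b)) P"
    by (rule linfun_tlift(2)[OF assms(1,2) _ assms(5) _ l]) (auto intro!: 1)
  also have "\<dots> = tl (\<lambda>a b. tl (\<lambda>a' b'. l (tens A B (a \<otimes>\<^bsub>A\<^esub> a') (b \<otimes>\<^bsub>B\<^esub> b'))) Q) P"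
    using assms by (intro tl_cong[OF assms(1,2,5)] linfun_tlift(2)[OF assms(1,2) _ assms(6) _ l])
      (auto intro!: tens_carrier)
  finally show "l (P \<otimes>\<^bsub>tensor_alg A B\<^esub> Q) =
       tl (\<lambda>a b. tl (\<lambda>a' b'. l (tens A B (a \<otimes>\<^bsub>A\<^esub> a') (b \<otimes>\<^bsub>B\<^esub> b'))) Q) P"
    unfolding eq .
qed

subsection \<open>Sweedler sums\<close>

locale hopf_scalars = scalars \<kappa> for \<kappa> :: "'k::field \<Rightarrow> 'r::comm_ring_1" +
  fixes H :: "('k, 'h::ring_1) hopf_data"
  assumes hopf: "hopf_algebra H"
begin

abbreviation "HA \<equiv> hopf_alg H"
abbreviation "HH \<equiv> tensor_space HA HA"
abbreviation S :: "('h \<Rightarrow> 'h \<Rightarrow> 'r) \<Rightarrow> 'h \<Rightarrow> 'r" where "S \<equiv> sweedler H RR"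
abbreviation lin :: "('h \<Rightarrow> 'r) \<Rightarrow> bool" where "lin \<equiv> linfun HA"

lemma HA_simps [simp]:
  "carrier HA = UNIV" "(\<otimes>\<^bsub>HA\<^esub>) = (*)" "\<one>\<^bsub>HA\<^esub> = 1"
  "\<zero>\<^bsub>HA\<^esub> = 0" "(\<oplus>\<^bsub>HA\<^esub>) = (+)" "(\<odot>\<^bsub>HA\<^esub>) = hscale H"
  by (simp_all add: hopf_alg_def)

lemma vs_H: "vector_space (hscale H)"
  using hopf by (simp add: hopf_algebra_def)

lemma hscale_mult: "hscale H c x * y = hscale H c (x * y)" "x * hscale H c y = hscale H c (x * y)"
  using hopf unfolding hopf_algebra_def by metis+

lemma kspace_HA [simp]: "kspace HA"
  unfolding hopf_alg_def by (rule kspace_alg_of[OF vs_H])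

lemma comul_hom: "comul H \<in> alg_hom HA (tensor_alg HA HA)"
  and counit_hom: "counit H \<in> alg_hom HA ground_alg"
  using hopf by (simp_all add: hopf_algebra_def)

lemma comul_carrier [simp]: "comul H h \<in> carrier HH"
  using alg_homD(1)[OF comul_hom, of h] by simp

lemma counit_simps [simp]:
  "counit H (x + y) = counit H x + counit H y" "counit H (x * y) = counit H x * counit H y"
  "counit H 1 = 1" "counit H (hscale H c x) = c * counit H x"
  using alg_homD(2-5)[OF counit_hom] by simp_all

lemma lin_iff: "lin f \<longleftrightarrow> (\<forall>x y. f (x + y) = f x + f y) \<and> (\<forall>c x. f (hscale H c x) = \<kappa> c * f x)"
  by (simp add: linfun_def)

lemma linD: "lin f \<Longrightarrow> f (x + y) = f x + f y" "lin f \<Longrightarrow> f (hscale H c x) = \<kappa> c * f x"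
  by (simp_all add: lin_iff)

lemma S_eq: "S F h = tl F (comul H h)"
  by (simp add: sweedler_def)

lemma S_mult_left: "S (\<lambda>a b. c * F a b) h = c * S F h"
  by (simp add: S_eq tl_fun_mult_left)

lemma S_mult_right: "S (\<lambda>a b. F a b * c) h = S F h * c"
  by (simp add: S_eq tl_fun_mult_right)

lemma S_swap: "S (\<lambda>a b. S (\<lambda>c d. G a b c d) y) x = S (\<lambda>c d. S (\<lambda>a b. G a b c d) x) y"
  unfolding S_eq by (rule tl_swap)

lemma S_tl_swap: "S (\<lambda>a b. tl (\<lambda>c d. G a b c d) C) x = tl (\<lambda>c d. S (\<lambda>a b. G a b c d) x) C"
  unfolding S_eq by (rule tl_swap)

lemma bil_HA: "bil HA HA F \<longleftrightarrow> (\<forall>y. lin (\<lambda>x. F x y)) \<and> (\<forall>x. lin (F x))"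
  by (simp add: bil_def)

lemma bilI: "(\<And>y. lin (\<lambda>x. F x y)) \<Longrightarrow> (\<And>x. lin (\<lambda>y. F x y)) \<Longrightarrow> bil HA HA F"
  by (simp add: bil_HA)

lemma lin_mult_l: "lin f \<Longrightarrow> lin (\<lambda>x. c * f x)"
  by (simp add: lin_iff algebra_simps)

lemma lin_mult_r: "lin f \<Longrightarrow> lin (\<lambda>x. f x * c)"
  by (simp add: lin_iff algebra_simps)

lemma lin_add: "lin f \<Longrightarrow> lin g \<Longrightarrow> lin (\<lambda>x. f x + g x)"
  by (simp add: lin_iff algebra_simps)

lemma lin_tl:
  assumes "\<And>a b. lin (\<lambda>x. G x a b)"
  shows "lin (\<lambda>x. tl (\<lambda>a b. G x a b) C)"
  using linD[OF assms] by (simp add: lin_iff tl_eq lc_fun_add lc_fun_mult_left)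

lemma lin_S: "(\<And>a b. lin (\<lambda>x. G x a b)) \<Longrightarrow> lin (\<lambda>x. S (\<lambda>a b. G x a b) y)"
  unfolding S_eq by (rule lin_tl)

lemma lin_comp_l: "lin f \<Longrightarrow> lin (\<lambda>x. f (x * y))"
  by (simp add: lin_iff distrib_right hscale_mult)

lemma lin_comp_r: "lin f \<Longrightarrow> lin (\<lambda>x. f (y * x))"
  by (simp add: lin_iff distrib_left hscale_mult)

lemma lin_counit: "lin (\<lambda>x. \<kappa> (counit H x))"
  by (simp add: lin_iff)

lemma lin_S_arg:
  assumes "\<And>y. lin (\<lambda>x. F x y)" "\<And>x. lin (\<lambda>y. F x y)"
  shows "lin (\<lambda>h. S (\<lambda>a b. F a b) h)"
proof -
  have "linfun HH (tl F)" by (rule linfun_tl[OF bilI]) (rule assms)+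
  then show ?thesis
    using alg_homD(2,5)[OF comul_hom] by (simp add: S_eq lin_iff linfunD)
qed

lemmas lin_intros = lin_mult_l lin_mult_r lin_add lin_S_arg lin_S lin_tl lin_comp_l lin_comp_r lin_counit

lemma linfun_sweedler:
  assumes "kspace Z" "\<And>a b. F a b \<in> carrier Z"
  shows "sweedler H Z F h \<in> carrier Z"
    "linfun Z l \<Longrightarrow> l (sweedler H Z F h) = S (\<lambda>a b. l (F a b)) h"
  unfolding sweedler_def
  by (rule linfun_tlift[OF kspace_HA kspace_HA assms(1) comul_carrier assms(2)]; simp)+

text \<open>The comultiplication is an algebra morphism into the tensor square, so the form is
  evaluated on the product of the two coproducts.\<close>

lemma S_mult:
  assumes "\<And>y. lin (\<lambda>x. F x y)" "\<And>x. lin (\<lambda>y. F x y)"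
  shows "S F (x * y) = S (\<lambda>x1 x2. S (\<lambda>y1 y2. F (x1 * y1) (x2 * y2)) y) x"
proof -
  have b: "bil HA HA F" by (rule bilI) (rule assms)+
  have "comul H (x * y) = comul H x \<otimes>\<^bsub>tensor_alg HA HA\<^esub> comul H y"
    using alg_homD(3)[OF comul_hom, of x y] by simp
  then have "S F (x * y) = tl F (comul H x \<otimes>\<^bsub>tensor_alg HA HA\<^esub> comul H y)" by (simp add: S_eq)
  also have "\<dots> = S (\<lambda>x1 x2. S (\<lambda>y1 y2. F (x1 * y1) (x2 * y2)) y) x"
    by (subst tensor_alg_mult(2)[OF _ _ _ _ _ _ linfun_tl[OF b]]) (simp_all add: S_eq tl_tens[OF b])
  finally show ?thesis .
qed

lemma S_one:
  assumes "\<And>y. lin (\<lambda>x. F x y)" "\<And>x. lin (\<lambda>y. F x y)"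
  shows "S F 1 = F 1 1"
proof -
  have b: "bil HA HA F" by (rule bilI) (rule assms)+
  show ?thesis using alg_homD(4)[OF comul_hom] by (simp add: S_eq tl_tens[OF b])
qed

lemma S_counit_left: "lin f \<Longrightarrow> S (\<lambda>a b. \<kappa> (counit H a) * f b) h = f h"
  and S_counit_right: "lin f \<Longrightarrow> S (\<lambda>a b. f a * \<kappa> (counit H b)) h = f h"
proof -
  assume f: "lin f"
  have h: "sweedler H HA (\<lambda>h1 h2. hscale H (counit H h1) h2) h = h"
    "sweedler H HA (\<lambda>h1 h2. hscale H (counit H h2) h1) h = h"
    using hopf by (simp_all add: hopf_algebra_def)
  show "S (\<lambda>a b. \<kappa> (counit H a) * f b) h = f h"
    using linfun_sweedler(2)[OF kspace_HA _ f, of "\<lambda>h1 h2. hscale H (counit H h1) h2" h]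
    by (simp add: h linD[OF f])
  show "S (\<lambda>a b. f a * \<kappa> (counit H b)) h = f h"
    using linfun_sweedler(2)[OF kspace_HA _ f, of "\<lambda>h1 h2. hscale H (counit H h2) h1" h]
    by (simp add: h linD[OF f] mult.commute)
qed

text \<open>The coassociativity axiom is an equality in the threefold tensor product. Applying the
  linear functional that the trilinear \<open>F\<close> induces there gives the equality of
  sums.\<close>

lemma S_coassoc:
  assumes "\<And>b c. lin (\<lambda>a. F a b c)" "\<And>a c. lin (\<lambda>b. F a b c)" "\<And>a b. lin (\<lambda>c. F a b c)"
  shows "S (\<lambda>u c. S (\<lambda>a b. F a b c) u) h = S (\<lambda>a u. S (\<lambda>b c. F a b c) u) h"
proof -
  let ?Z = "tensor_space HH HA"
  let ?t = "\<lambda>a b c. tens HH HA (tens HA HA a b) c"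
  let ?B = "\<lambda>C c. tl (\<lambda>a b. F a b c) C"
  have b2: "bil HA HA (\<lambda>a b. F a b c)" for c by (rule bilI) (rule assms)+
  have b: "bil HH HA ?B"
    unfolding bil_def using assms(3) by (auto intro: linfun_tl[OF b2] lin_tl)
  have l: "linfun ?Z (tl ?B)" by (rule linfun_tl[OF b])
  have tc: "?t a b c \<in> carrier ?Z" for a b c by (simp add: tens_carrier)
  have lt: "tl ?B (?t a b c) = F a b c" for a b c
    by (simp add: tl_tens[OF b] tl_tens[OF b2])
  have "sweedler H ?Z (\<lambda>u c. sweedler H ?Z (\<lambda>a1 a2. ?t a1 a2 c) u) h
      = sweedler H ?Z (\<lambda>a u. sweedler H ?Z (\<lambda>c1 c2. ?t a c1 c2) u) h"
    using hopf unfolding hopf_algebra_def Let_def by blast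
  then have "tl ?B (sweedler H ?Z (\<lambda>u c. sweedler H ?Z (\<lambda>a1 a2. ?t a1 a2 c) u) h)
      = tl ?B (sweedler H ?Z (\<lambda>a u. sweedler H ?Z (\<lambda>c1 c2. ?t a c1 c2) u) h)" by simp
  then show ?thesis
    using tc by (simp add: linfun_sweedler[OF kspace_tensor] linfun_sweedler(2)[OF kspace_tensor _ l] lt)
qed

definition conv :: "('h \<Rightarrow> 'r) \<Rightarrow> ('h \<Rightarrow> 'r) \<Rightarrow> 'h \<Rightarrow> 'r" where
  "conv f g h = S (\<lambda>a b. f a * g b) h"

text \<open>Convolution for the tensor product coalgebra on two copies of \<open>H\<close>,
  expressed on functions of two arguments instead of functions on the tensor square.\<close>

definition conv2 :: "('h \<Rightarrow> 'h \<Rightarrow> 'r) \<Rightarrow> ('h \<Rightarrow> 'h \<Rightarrow> 'r) \<Rightarrow> 'h \<Rightarrow> 'h \<Rightarrow> 'r" where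
  "conv2 F G x y = S (\<lambda>x1 x2. S (\<lambda>y1 y2. F x1 y1 * G x2 y2) y) x"

abbreviation eps :: "'h \<Rightarrow> 'r" where "eps \<equiv> \<lambda>h. \<kappa> (counit H h)"

lemma lin_conv: "lin f \<Longrightarrow> lin g \<Longrightarrow> lin (conv f g)"
  unfolding conv_def by (intro lin_intros)

lemma conv_assoc:
  assumes "lin f" "lin g" "lin k"
  shows "conv (conv f g) k = conv f (conv g k)"
proof
  fix h
  have "conv (conv f g) k h = S (\<lambda>u c. S (\<lambda>a b. f a * g b * k c) u) h"
    by (simp add: conv_def S_mult_right)
  also have "\<dots> = S (\<lambda>a u. S (\<lambda>b c. f a * g b * k c) u) h"
    by (rule S_coassoc) (intro lin_intros assms)+
  also have "\<dots> = conv f (conv g k) h" by (simp add: conv_def S_mult_left mult.assoc)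
  finally show "conv (conv f g) k h = conv f (conv g k) h" .
qed

lemma conv_eps_left [simp]: "lin f \<Longrightarrow> conv eps f = f"
  and conv_eps_right [simp]: "lin f \<Longrightarrow> conv f eps = f"
  by (auto simp: conv_def S_counit_left S_counit_right)

definition bilin :: "('h \<Rightarrow> 'h \<Rightarrow> 'r) \<Rightarrow> bool" where
  "bilin F \<longleftrightarrow> (\<forall>y. lin (\<lambda>x. F x y)) \<and> (\<forall>x. lin (\<lambda>y. F x y))"

lemma bilinI: "(\<And>y. lin (\<lambda>x. F x y)) \<Longrightarrow> (\<And>x. lin (\<lambda>y. F x y)) \<Longrightarrow> bilin F"
  by (simp add: bilin_def)

lemma bilinD: "bilin F \<Longrightarrow> lin (\<lambda>x. F x y)" "bilin F \<Longrightarrow> lin (\<lambda>y. F x y)"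
  by (simp_all add: bilin_def)

lemma bilin_conv2: "bilin F \<Longrightarrow> bilin G \<Longrightarrow> bilin (conv2 F G)"
  unfolding conv2_def by (rule bilinI) (intro lin_intros bilinD; assumption)+

lemma bilin_prod: "lin f \<Longrightarrow> lin g \<Longrightarrow> bilin (\<lambda>x y. f x * g y)"
  by (rule bilinI) (intro lin_intros; assumption)+

lemma bilin_mult: "lin f \<Longrightarrow> bilin (\<lambda>x y. f (x * y))"
  by (rule bilinI) (intro lin_intros; assumption)+

text \<open>Coassociativity is used for each argument separately. The interchanges of independent
  Sweedler sums bring the two coproducts of one argument next to each other.\<close>

lemma conv2_assoc:
  assumes F: "bilin F" and G: "bilin G" and K: "bilin K"
  shows "conv2 (conv2 F G) K = conv2 F (conv2 G K)"
proof (intro ext)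
  fix x y
  note li = lin_intros bilinD[OF F] bilinD[OF G] bilinD[OF K]
  have "conv2 (conv2 F G) K x y
      = S (\<lambda>x1 x2. S (\<lambda>y1 y2. S (\<lambda>a b. S (\<lambda>c d. F a c * G b d * K x2 y2) y1) x1) y) x"
    by (simp add: conv2_def S_mult_right)
  also have "\<dots> = S (\<lambda>x1 x2. S (\<lambda>a b. S (\<lambda>y1 y2. S (\<lambda>c d. F a c * G b d * K x2 y2) y1) y) x1) x"
    by (subst S_swap) (rule refl)
  also have "\<dots> = S (\<lambda>x1 x2. S (\<lambda>a b. S (\<lambda>c v. S (\<lambda>d e. F a c * G b d * K x2 e) v) y) x1) x"
    by (subst S_coassoc) (intro li refl)+
  also have "\<dots> = S (\<lambda>a w. S (\<lambda>b x2. S (\<lambda>c v. S (\<lambda>d e. F a c * G b d * K x2 e) v) y) w) x"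
    by (rule S_coassoc) (intro li)+
  also have "\<dots> = S (\<lambda>a w. S (\<lambda>c v. S (\<lambda>b x2. S (\<lambda>d e. F a c * G b d * K x2 e) v) w) y) x"
    by (subst S_swap) (rule refl)
  also have "\<dots> = conv2 F (conv2 G K) x y"
    by (simp add: conv2_def S_mult_left mult.assoc)
  finally show "conv2 (conv2 F G) K x y = conv2 F (conv2 G K) x y" .
qed

lemma conv2_eps_left: "bilin F \<Longrightarrow> conv2 (\<lambda>x y. eps x * eps y) F = F"
  by (intro ext) (simp add: conv2_def mult.assoc S_mult_left S_counit_left bilinD)

text \<open>The multiplication of \<open>H\<close> is a morphism of coalgebras, so composition with
  it respects convolution.\<close>

lemma conv_mult:
  assumes "lin f" "lin g"
  shows "conv f g (x * y) = conv2 (\<lambda>x y. f (x * y)) (\<lambda>x y. g (x * y)) x y"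
  unfolding conv_def conv2_def by (rule S_mult) (intro lin_intros assms)+

lemma conv_one: "lin f \<Longrightarrow> lin g \<Longrightarrow> conv f g 1 = f 1 * g 1"
  unfolding conv_def by (rule S_one) (intro lin_intros; assumption)+

end

lemma (in scalars) separates_mono:
  assumes "separates V L" "L \<subseteq> M" "\<And>l. l \<in> M \<Longrightarrow> linfun V l"
  shows "separates V M"
  unfolding separates_def
proof (intro conjI ballI impI)
  fix v w assume "v \<in> carrier V" "w \<in> carrier V" "\<forall>l\<in>M. l v = l w"
  then show "v = w" using separatesD(2)[OF assms(1), of v w] assms(2) by blast
qed (rule assms(3))

subsection \<open>Twisted algebras\<close>

text \<open>The coefficients form a subset of the type because \<open>S_Theta\<close> is a
  subalgebra of a field: sums are computed in the surrounding ring, and only membership in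
  \<open>R\<close> is tracked.\<close>

locale coeff_alg = hopf_scalars \<kappa> H
  for \<kappa> :: "'k::field \<Rightarrow> 'r::comm_ring_1" and H :: "('k, 'h::ring_1) hopf_data" +
  fixes R :: "'r set"
  assumes subalg: "subalgebra (\<lambda>c z. \<kappa> c * z) R"
begin

lemma R_closed:
  "1 \<in> R" "x \<in> R \<Longrightarrow> y \<in> R \<Longrightarrow> x + y \<in> R" "x \<in> R \<Longrightarrow> y \<in> R \<Longrightarrow> x * y \<in> R" "x \<in> R \<Longrightarrow> \<kappa> c * x \<in> R"
  "0 \<in> R" "x \<in> R \<Longrightarrow> - x \<in> R" "\<kappa> c \<in> R"
proof -
  show 1: "1 \<in> R" "x \<in> R \<Longrightarrow> y \<in> R \<Longrightarrow> x + y \<in> R" "x \<in> R \<Longrightarrow> y \<in> R \<Longrightarrow> x * y \<in> R"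
    and sc: "x \<in> R \<Longrightarrow> \<kappa> c * x \<in> R" for c x y
    using subalg by (auto simp: subalgebra_def)
  show "0 \<in> R" using sc[OF 1(1), of 0] by simp
  show "x \<in> R \<Longrightarrow> - x \<in> R" using sc[of x "- 1"] by simp
  show "\<kappa> c \<in> R" using sc[OF 1(1), of c] by simp
qed

lemma R_sum: "(\<And>a. a \<in> A \<Longrightarrow> f a \<in> R) \<Longrightarrow> sum f A \<in> R"
  by (induction A rule: infinite_finite_induct) (auto simp: R_closed)

lemma S_in_R: "(\<And>a b. F a b \<in> R) \<Longrightarrow> S F h \<in> R"
  unfolding S_eq tl_eq lc_def by (intro R_sum R_closed)

lemma conv2_in_R: "(\<And>x y. F x y \<in> R) \<Longrightarrow> (\<And>x y. G x y \<in> R) \<Longrightarrow> conv2 F G x y \<in> R"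
  unfolding conv2_def by (intro S_in_R R_closed)

definition RA :: "('k, 'r) module" where "RA = RR\<lparr>carrier := R\<rparr>"

lemma RA_simps [simp]:
  "carrier RA = R" "(\<otimes>\<^bsub>RA\<^esub>) = (*)" "\<one>\<^bsub>RA\<^esub> = 1"
  "\<zero>\<^bsub>RA\<^esub> = 0" "(\<oplus>\<^bsub>RA\<^esub>) = (+)" "(\<odot>\<^bsub>RA\<^esub>) = (\<lambda>c z. \<kappa> c * z)"
  by (simp_all add: RA_def RR_def alg_of_def)

lemma kspace_RA [simp]: "kspace RA"
proof (rule kspaceI, rule abelian_groupI)
  fix x assume "x \<in> carrier RA"
  then show "\<exists>y\<in>carrier RA. y \<oplus>\<^bsub>RA\<^esub> x = \<zero>\<^bsub>RA\<^esub>"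
    by (intro bexI[of _ "- x"]) (simp_all add: R_closed)
qed (simp_all add: R_closed algebra_simps)

abbreviation "RH \<equiv> tensor_space RA HA"
abbreviation "RHH \<equiv> tensor_space RH HA"
abbreviation ten :: "'r \<Rightarrow> 'h \<Rightarrow> ('r \<times> 'h \<Rightarrow>\<^sub>0 'k) set" where "ten \<equiv> tens RA HA"

text \<open>An element \<open>P\<close> of \<open>R \<otimes> H\<close> is determined by the values \<open>pair P f\<close>, so that identities in \<open>R \<otimes> H\<close>
  become identities of Sweedler sums in \<open>R\<close>.\<close>

definition pair :: "('r \<times> 'h \<Rightarrow>\<^sub>0 'k) set \<Rightarrow> ('h \<Rightarrow> 'r) \<Rightarrow> 'r" where
  "pair P f = tl (\<lambda>b h. b * f h) P"

definition pair2 :: "(('r \<times> 'h \<Rightarrow>\<^sub>0 'k) set \<times> 'h \<Rightarrow>\<^sub>0 'k) set \<Rightarrow> ('h \<Rightarrow> 'r) \<Rightarrow> ('h \<Rightarrow> 'r) \<Rightarrow> 'r" where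
  "pair2 C f g = tl (\<lambda>P h. pair P f * g h) C"

lemma bil_pair: "lin f \<Longrightarrow> bil RA HA (\<lambda>b h. b * f h)"
  by (simp add: bil_def lin_mult_l) (simp add: linfun_def algebra_simps)

lemma linfun_pair: "lin f \<Longrightarrow> linfun RH (\<lambda>P. pair P f)"
  unfolding pair_def by (rule linfun_tl[OF bil_pair])

lemma pair_ten [simp]: "lin f \<Longrightarrow> pair (ten b h) f = b * f h"
  by (simp add: pair_def tl_tens[OF bil_pair])

lemma ten_carrier [simp]: "b \<in> R \<Longrightarrow> ten b h \<in> carrier RH"
  by (simp add: tens_carrier)

lemma bil_pair2: "lin f \<Longrightarrow> lin g \<Longrightarrow> bil RH HA (\<lambda>P h. pair P f * g h)"
  using linfun_pair[of f]
  by (simp add: bil_def lin_mult_l) (simp add: linfun_def algebra_simps)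

lemma linfun_pair2: "lin f \<Longrightarrow> lin g \<Longrightarrow> linfun RHH (\<lambda>C. pair2 C f g)"
  unfolding pair2_def by (rule linfun_tl[OF bil_pair2])

lemma pair2_tens [simp]: "lin f \<Longrightarrow> lin g \<Longrightarrow> pair2 (tens RH HA P h) f g = pair P f * g h"
  by (simp add: pair2_def tl_tens[OF bil_pair2])

lemma lin_scal: "Vector_Spaces.linear (hscale H) (*) m \<Longrightarrow> lin (\<lambda>h. \<kappa> (m h))"
  by (simp add: lin_iff linearD)

text \<open>Functionals that come from scalar-valued linear forms already suffice. Such forms make
  sense for every coefficient algebra, which allows coordinates over two of them to be
  compared.\<close>

lemma separates_RH_scal:
  "separates RH {\<lambda>P. pair P (\<lambda>h. \<kappa> (m h)) | m. Vector_Spaces.linear (hscale H) (*) m}"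
proof -
  have "separates RA {\<lambda>x. x}" by (auto simp: separates_def linfun_def)
  from separates_tensor[OF kspace_RA this vs_H]
  have "separates RH {tl (\<lambda>v h. l v * \<kappa> (m h)) | l m. l \<in> {\<lambda>x. x} \<and> Vector_Spaces.linear (hscale H) (*) m}"
    by (simp only: hopf_alg_def)
  moreover have "{tl (\<lambda>v h. l v * \<kappa> (m h)) | l m. l \<in> {\<lambda>x. x} \<and> Vector_Spaces.linear (hscale H) (*) m}
      = {\<lambda>P. pair P (\<lambda>h. \<kappa> (m h)) | m. Vector_Spaces.linear (hscale H) (*) m}"
  proof -
    have "(\<lambda>P. pair P (\<lambda>h. \<kappa> (m h))) = tl (\<lambda>v h. v * \<kappa> (m h))" for m
      by (simp add: pair_def fun_eq_iff)
    then show ?thesis by auto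
  qed
  ultimately show ?thesis by simp
qed

lemma separates_RH: "separates RH {\<lambda>P. pair P f | f. lin f}"
  by (rule separates_mono[OF separates_RH_scal]) (use lin_scal linfun_pair in auto)

lemma RH_eqI_scal:
  assumes "P \<in> carrier RH" "Q \<in> carrier RH"
    and "\<And>m. Vector_Spaces.linear (hscale H) (*) m \<Longrightarrow> pair P (\<lambda>h. \<kappa> (m h)) = pair Q (\<lambda>h. \<kappa> (m h))"
  shows "P = Q"
  by (rule separatesD(2)[OF separates_RH_scal assms(1,2)]) (use assms(3) in auto)

lemma RH_eqI:
  assumes "P \<in> carrier RH" "Q \<in> carrier RH" "\<And>f. lin f \<Longrightarrow> pair P f = pair Q f"
  shows "P = Q"
  by (rule separatesD(2)[OF separates_RH assms(1,2)]) (use assms(3) in auto)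

lemma RHH_eqI:
  assumes "P \<in> carrier RHH" "Q \<in> carrier RHH"
    and "\<And>f g. lin f \<Longrightarrow> lin g \<Longrightarrow> pair2 P f g = pair2 Q f g"
  shows "P = Q"
proof -
  let ?L = "{tl (\<lambda>v h. l v * \<kappa> (m h)) | l m. l \<in> {\<lambda>P. pair P f | f. lin f} \<and> Vector_Spaces.linear (hscale H) (*) m}"
  have *: "separates RHH ?L"
    using separates_tensor[OF kspace_tensor separates_RH vs_H] by (simp only: hopf_alg_def)
  show ?thesis
  proof (rule separatesD(2)[OF * assms(1,2)])
    fix l assume "l \<in> ?L"
    then obtain f m where l: "l = tl (\<lambda>v h. pair v f * \<kappa> (m h))" and f: "lin f"
        and m: "Vector_Spaces.linear (hscale H) (*) m"
      by blast
    show "l P = l Q" using assms(3)[OF f lin_scal[OF m]] by (simp add: l pair2_def)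
  qed
qed

lemma pair_fun_add: "pair P (\<lambda>x. f x + g x) = pair P f + pair P g"
  by (simp add: pair_def distrib_left tl_fun_add)

lemma pair_fun_mult_left: "pair P (\<lambda>x. c * f x) = c * pair P f"
  unfolding pair_def by (subst mult.left_commute) (rule tl_fun_mult_left)

lemma pair_S: "pair P (\<lambda>x. S (\<lambda>a b. G x a b) y) = S (\<lambda>a b. pair P (\<lambda>x. G x a b)) y"
  unfolding pair_def S_mult_left[symmetric] by (rule S_tl_swap[symmetric])

lemma lin_pair: "(\<And>y. lin (\<lambda>x. G x y)) \<Longrightarrow> lin (\<lambda>x. pair P (\<lambda>y. G x y))"
  unfolding pair_def by (intro lin_tl lin_mult_l)

lemma pair_tlift:
  assumes "P \<in> carrier RH" "\<And>b h. b \<in> R \<Longrightarrow> F b h \<in> carrier RH"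
  shows "tlift RH F P \<in> carrier RH"
    "lin f \<Longrightarrow> pair (tlift RH F P) f = tl (\<lambda>b h. pair (F b h) f) P"
  using linfun_tlift[OF kspace_RA kspace_HA kspace_tensor[of RA HA] assms(1), of F] assms(2) linfun_pair by auto

lemma pair_sweedler:
  assumes "\<And>a b. F a b \<in> carrier RH"
  shows "sweedler H RH F h \<in> carrier RH"
    "lin f \<Longrightarrow> pair (sweedler H RH F h) f = S (\<lambda>a b. pair (F a b) f) h"
  by (rule linfun_sweedler(1)[OF kspace_tensor], rule assms)
    (rule linfun_sweedler(2)[OF kspace_tensor assms linfun_pair])

lemma tl_cong_RH:
  "P \<in> carrier RH \<Longrightarrow> (\<And>b h. b \<in> R \<Longrightarrow> F b h = G b h) \<Longrightarrow> tl F P = tl G P"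
  by (rule tl_cong[OF kspace_RA kspace_HA]) auto

lemma coaction_carrier:
  assumes "P \<in> carrier RH"
  shows "tensor_coaction H RA P \<in> carrier RHH"
  unfolding tensor_coaction_def Let_def
  by (intro linfun_tlift(1)[OF kspace_RA kspace_HA kspace_tensor assms] linfun_sweedler(1)[OF kspace_tensor])
    (simp add: tens_carrier)

text \<open>On functionals, the transpose of the comultiplication is the convolution
  product.\<close>

lemma pair2_coaction:
  assumes "P \<in> carrier RH" "lin f" "lin g"
  shows "pair2 (tensor_coaction H RA P) f g = pair P (conv f g)"
proof -
  let ?F = "\<lambda>b h. sweedler H RHH (\<lambda>h1 h2. tens RH HA (ten b h1) h2) h"
  have c: "?F b h \<in> carrier RHH" if "b \<in> R" for b h
    by (rule linfun_sweedler(1)[OF kspace_tensor]) (simp add: tens_carrier that)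
  have "pair2 (tensor_coaction H RA P) f g = tl (\<lambda>b h. pair2 (?F b h) f g) P"
    unfolding tensor_coaction_def Let_def
    by (rule linfun_tlift(2)[OF kspace_RA kspace_HA kspace_tensor assms(1) _ linfun_pair2[OF assms(2,3)]])
      (simp add: c)
  also have "\<dots> = tl (\<lambda>b h. b * conv f g h) P"
  proof (rule tl_cong_RH[OF assms(1)])
    fix b h assume "b \<in> R"
    then have "pair2 (?F b h) f g = S (\<lambda>h1 h2. pair2 (tens RH HA (ten b h1) h2) f g) h"
      by (intro linfun_sweedler(2)[OF kspace_tensor _ linfun_pair2[OF assms(2,3)]]) (simp add: tens_carrier)
    then show "pair2 (?F b h) f g = b * conv f g h"
      using assms by (simp add: conv_def S_mult_left[symmetric] mult.assoc)
  qed
  finally show ?thesis by (simp add: pair_def)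
qed

text \<open>The formula of \<open>\<phi>\<close> with a variable functional: \<open>t_var\<close>
  gives \<open>\<phi>\<close> itself and \<open>t_inv\<close> its inverse. On the dual side it is
  left convolution by \<open>t\<close>.\<close>

definition shift :: "('h \<Rightarrow> 'r) \<Rightarrow> ('r \<times> 'h \<Rightarrow>\<^sub>0 'k) set \<Rightarrow> ('r \<times> 'h \<Rightarrow>\<^sub>0 'k) set" where
  "shift t = tlift RH (\<lambda>b h. sweedler H RH (\<lambda>h1 h2. ten (b * t h1) h2) h)"

lemma shift:
  assumes "\<And>h. t h \<in> R" "P \<in> carrier RH"
  shows shift_carrier: "shift t P \<in> carrier RH"
    and pair_shift: "lin f \<Longrightarrow> pair (shift t P) f = pair P (conv t f)"
proof -
  let ?F = "\<lambda>b h. sweedler H RH (\<lambda>h1 h2. ten (b * t h1) h2) h"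
  have c: "?F b h \<in> carrier RH" if "b \<in> R" for b h
    using that assms(1) by (intro pair_sweedler(1)) (simp add: R_closed)
  show "shift t P \<in> carrier RH"
    unfolding shift_def by (rule pair_tlift(1)[OF assms(2) c])
  assume f: "lin f"
  have "pair (shift t P) f = tl (\<lambda>b h. pair (?F b h) f) P"
    unfolding shift_def by (rule pair_tlift(2)[OF assms(2) c f])
  also have "\<dots> = tl (\<lambda>b h. b * conv t f h) P"
  proof (rule tl_cong_RH[OF assms(2)])
    fix b h assume b: "b \<in> R"
    have "pair (?F b h) f = S (\<lambda>h1 h2. pair (ten (b * t h1) h2) f) h"
      using b assms(1) f by (intro pair_sweedler(2)) (simp_all add: R_closed)
    then show "pair (?F b h) f = b * conv t f h"
      using f by (simp add: conv_def S_mult_left[symmetric] mult.assoc)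
  qed
  finally show "pair (shift t P) f = pair P (conv t f)" by (simp add: pair_def)
qed

end

text \<open>The common frame for the products with \<open>\<alpha>\<close> and with
  \<open>\<sigma>\<close>. The cocycle identity and normalization enter in
  \<open>cocycle_twist\<close>.\<close>

locale twist = coeff_alg \<kappa> H R
  for \<kappa> :: "'k::field \<Rightarrow> 'r::comm_ring_1" and H :: "('k, 'h::ring_1) hopf_data" and R +
  fixes \<tau> :: "'h \<Rightarrow> 'h \<Rightarrow> 'r" and u :: 'r
  assumes bilin_\<tau>: "bilin \<tau>" and \<tau>_in_R: "\<tau> x y \<in> R" and u_in_R: "u \<in> R"
begin

abbreviation "TA \<equiv> twisted_alg H RA \<tau> u"

lemma TA_simps [simp]:
  "carrier TA = carrier RH" "(\<oplus>\<^bsub>TA\<^esub>) = (\<oplus>\<^bsub>RH\<^esub>)" "(\<odot>\<^bsub>TA\<^esub>) = (\<odot>\<^bsub>RH\<^esub>)" "\<zero>\<^bsub>TA\<^esub> = \<zero>\<^bsub>RH\<^esub>" "\<one>\<^bsub>TA\<^esub> = ten u 1"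
  by (simp_all add: twisted_alg_def Let_def tensor_space_def)

text \<open>The kernel \<open>conv2 \<tau> (\<lambda>x y. f (x * y))\<close> at \<open>x\<close> and
  \<open>y\<close> is the value of \<open>f\<close> on the twisted product of \<open>ten 1 x\<close>
  and \<open>ten 1 y\<close>. A product \<open>P Q\<close> is tested by pairing this kernel with
  \<open>Q\<close> in the second variable and with \<open>P\<close> in the first.\<close>

lemma lin_mult_kernel:
  assumes "lin f"
  shows "lin (\<lambda>x. conv2 \<tau> (\<lambda>x y. f (x * y)) x y)" "lin (\<lambda>y. conv2 \<tau> (\<lambda>x y. f (x * y)) x y)"
  using bilinD[OF bilin_conv2[OF bilin_\<tau> bilin_mult[OF assms]]] .

lemma TA_mult:
  assumes "P \<in> carrier RH" "Q \<in> carrier RH"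
  shows TA_mult_carrier: "P \<otimes>\<^bsub>TA\<^esub> Q \<in> carrier RH"
    and pair_TA_mult: "lin f \<Longrightarrow> pair (P \<otimes>\<^bsub>TA\<^esub> Q) f = pair P (\<lambda>x. pair Q (conv2 \<tau> (\<lambda>x y. f (x * y)) x))"
proof -
  let ?G = "\<lambda>b x c y. sweedler_pair H RH (\<lambda>x1 x2 y1 y2. ten (b * c * \<tau> x1 y1) (x2 * y2)) x y"
  have eq: "P \<otimes>\<^bsub>TA\<^esub> Q = tlift RH (\<lambda>b x. tlift RH (?G b x) Q) P"
    by (simp add: twisted_alg_def Let_def)
  have G0: "sweedler H RH (\<lambda>y1 y2. ten (b * c * \<tau> x1 y1) (x2 * y2)) y \<in> carrier RH"
    if "b \<in> R" "c \<in> R" for b c x1 x2 y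
    using that \<tau>_in_R by (intro pair_sweedler(1)) (simp add: R_closed)
  have G: "?G b x c y \<in> carrier RH" if "b \<in> R" "c \<in> R" for b c x y
    unfolding sweedler_pair_def by (rule pair_sweedler(1)) (rule G0[OF that])
  have in1: "tlift RH (?G b x) Q \<in> carrier RH" if "b \<in> R" for b x
    by (rule pair_tlift(1)[OF assms(2) G[OF that]])
  show "P \<otimes>\<^bsub>TA\<^esub> Q \<in> carrier RH" unfolding eq by (rule pair_tlift(1)[OF assms(1) in1])
  assume f: "lin f"
  let ?K = "conv2 \<tau> (\<lambda>x y. f (x * y))"
  have pG: "pair (?G b x c y) f = b * (c * ?K x y)" if "b \<in> R" "c \<in> R" for b c x y
  proof -
    have "pair (?G b x c y) f = S (\<lambda>x1 x2. S (\<lambda>y1 y2. pair (ten (b * c * \<tau> x1 y1) (x2 * y2)) f) y) x"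
      unfolding sweedler_pair_def
      using that \<tau>_in_R by (simp add: pair_sweedler(2)[OF G0[OF that] f] pair_sweedler(2)[OF _ f] R_closed)
    then show ?thesis by (simp add: f conv2_def S_mult_left[symmetric] mult.assoc)
  qed
  have "pair (P \<otimes>\<^bsub>TA\<^esub> Q) f = tl (\<lambda>b x. pair (tlift RH (?G b x) Q) f) P"
    unfolding eq by (rule pair_tlift(2)[OF assms(1) in1 f])
  also have "\<dots> = tl (\<lambda>b x. b * pair Q (?K x)) P"
  proof (rule tl_cong_RH[OF assms(1)])
    fix b x assume b: "b \<in> R"
    have "pair (tlift RH (?G b x) Q) f = tl (\<lambda>c y. pair (?G b x c y) f) Q"
      by (rule pair_tlift(2)[OF assms(2) G[OF b] f])
    also have "\<dots> = tl (\<lambda>c y. b * (c * ?K x y)) Q"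
      by (rule tl_cong_RH[OF assms(2)]) (rule pG[OF b])
    finally show "pair (tlift RH (?G b x) Q) f = b * pair Q (?K x)"
      by (simp add: pair_def tl_fun_mult_left)
  qed
  finally show "pair (P \<otimes>\<^bsub>TA\<^esub> Q) f = pair P (\<lambda>x. pair Q (?K x))" by (simp add: pair_def)
qed

end

locale cocycle_twist = twist \<kappa> H R \<tau> 1
  for \<kappa> :: "'k::field \<Rightarrow> 'r::comm_ring_1" and H :: "('k, 'h::ring_1) hopf_data" and R \<tau> +
  assumes cocycle: "S (\<lambda>x1 x2. S (\<lambda>y1 y2. \<tau> x1 y1 * \<tau> (x2 * y2) z) y) x
      = S (\<lambda>y1 y2. S (\<lambda>z1 z2. \<tau> y1 z1 * \<tau> x (y2 * z2)) z) y"
    and normalized: "\<tau> x 1 = eps x" "\<tau> 1 x = eps x"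
begin

text \<open>Associativity of the twisted product on three elements of \<open>H\<close>, seen by
  \<open>f\<close>: the cocycle identity is convolved with the value of \<open>f\<close> on the
  triple product.\<close>

lemma cocycle_conv:
  assumes f: "lin f"
  shows "S (\<lambda>x1 x2. S (\<lambda>y1 y2. \<tau> x1 y1 * conv2 \<tau> (\<lambda>x y. f (x * y)) (x2 * y2) z) y) x
    = S (\<lambda>y1 y2. S (\<lambda>z1 z2. \<tau> y1 z1 * conv2 \<tau> (\<lambda>x y. f (x * y)) x (y2 * z2)) z) y"
proof -
  note li = lin_intros bilinD[OF bilin_\<tau>] f
  have k: "conv2 \<tau> (\<lambda>x y. f (x * y)) (a * b) z
      = S (\<lambda>a1 a2. S (\<lambda>b1 b2. S (\<lambda>z1 z2. \<tau> (a1 * b1) z1 * f (a2 * b2 * z2)) z) b) a" for a b z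
    unfolding conv2_def by (rule S_mult) (intro li)+
  have k': "conv2 \<tau> (\<lambda>x y. f (x * y)) x (a * b)
      = S (\<lambda>x1 x2. S (\<lambda>a1 a2. S (\<lambda>b1 b2. \<tau> x1 (a1 * b1) * f (x2 * (a2 * b2))) b) a) x" for a b
    unfolding conv2_def by (subst S_mult) (intro li refl)+
  have "S (\<lambda>x1 x2. S (\<lambda>y1 y2. \<tau> x1 y1 * conv2 \<tau> (\<lambda>x y. f (x * y)) (x2 * y2) z) y) x
      = S (\<lambda>x1 w. S (\<lambda>y1 v. S (\<lambda>x2 x3. S (\<lambda>y2 y3. S (\<lambda>z1 z2. \<tau> x1 y1 * (\<tau> (x2 * y2) z1 * f (x3 * y3 * z2))) z) v) w) y) x"
    by (simp add: k S_mult_left)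
  also have "\<dots> = S (\<lambda>x1 w. S (\<lambda>x2 x3. S (\<lambda>y1 v. S (\<lambda>y2 y3. S (\<lambda>z1 z2. \<tau> x1 y1 * (\<tau> (x2 * y2) z1 * f (x3 * y3 * z2))) z) v) y) w) x"
    by (subst S_swap) (rule refl)
  also have "\<dots> = S (\<lambda>x1 w. S (\<lambda>x2 x3. S (\<lambda>v y3. S (\<lambda>y1 y2. S (\<lambda>z1 z2. \<tau> x1 y1 * (\<tau> (x2 * y2) z1 * f (x3 * y3 * z2))) z) v) y) w) x"
    by (subst S_coassoc[of "\<lambda>y1 y2 y3. S (\<lambda>z1 z2. \<tau> x1 y1 * (\<tau> (x2 * y2) z1 * f (x3 * y3 * z2))) z" for x1 x2 x3])
      (intro li refl)+
  also have "\<dots> = S (\<lambda>w x3. S (\<lambda>x1 x2. S (\<lambda>v y3. S (\<lambda>y1 y2. S (\<lambda>z1 z2. \<tau> x1 y1 * (\<tau> (x2 * y2) z1 * f (x3 * y3 * z2))) z) v) y) w) x"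
    by (rule S_coassoc[symmetric]) (intro li)+
  \<comment> \<open>The first two legs of \<open>x\<close> and of \<open>y\<close> are now
    coproducts of \<open>w\<close> and \<open>v\<close>. Pulling out the factor with
    \<open>f\<close> leaves the left side of the cocycle identity for \<open>w\<close>,
    \<open>v\<close> and \<open>z1\<close>.\<close>
  also have "\<dots> = S (\<lambda>w x3. S (\<lambda>v y3. S (\<lambda>z1 z2. S (\<lambda>x1 x2. S (\<lambda>y1 y2. \<tau> x1 y1 * \<tau> (x2 * y2) z1) v) w * f (x3 * y3 * z2)) z) y) x"
  proof -
    have "S (\<lambda>x1 x2. S (\<lambda>v y3. S (\<lambda>y1 y2. S (\<lambda>z1 z2. \<tau> x1 y1 * (\<tau> (x2 * y2) z1 * f (x3 * y3 * z2))) z) v) y) w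
      = S (\<lambda>v y3. S (\<lambda>x1 x2. S (\<lambda>y1 y2. S (\<lambda>z1 z2. \<tau> x1 y1 * (\<tau> (x2 * y2) z1 * f (x3 * y3 * z2))) z) v) w) y" for x3 w
      by (rule S_swap)
    moreover have "S (\<lambda>x1 x2. S (\<lambda>y1 y2. S (\<lambda>z1 z2. \<tau> x1 y1 * (\<tau> (x2 * y2) z1 * f (x3 * y3 * z2))) z) v) w
      = S (\<lambda>z1 z2. S (\<lambda>x1 x2. S (\<lambda>y1 y2. \<tau> x1 y1 * \<tau> (x2 * y2) z1) v) w * f (x3 * y3 * z2)) z" for x3 w y3 v
    proof -
      have "S (\<lambda>x1 x2. S (\<lambda>y1 y2. S (\<lambda>z1 z2. \<tau> x1 y1 * (\<tau> (x2 * y2) z1 * f (x3 * y3 * z2))) z) v) w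
        = S (\<lambda>x1 x2. S (\<lambda>z1 z2. S (\<lambda>y1 y2. \<tau> x1 y1 * (\<tau> (x2 * y2) z1 * f (x3 * y3 * z2))) v) z) w"
        by (subst S_swap) (rule refl)
      also have "\<dots> = S (\<lambda>z1 z2. S (\<lambda>x1 x2. S (\<lambda>y1 y2. \<tau> x1 y1 * (\<tau> (x2 * y2) z1 * f (x3 * y3 * z2))) v) w) z"
        by (rule S_swap)
      finally show ?thesis by (simp add: mult.assoc[symmetric] S_mult_right)
    qed
    ultimately show ?thesis by simp
  qed
  also have "\<dots> = S (\<lambda>w x3. S (\<lambda>v y3. S (\<lambda>z1 z2. S (\<lambda>y1 y2. S (\<lambda>a b. \<tau> y1 a * \<tau> w (y2 * b)) z1) v * f (x3 * y3 * z2)) z) y) x"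
    by (simp only: cocycle)
  \<comment> \<open>From here on the sums are regrouped in the opposite direction, so that the first
    legs of \<open>y\<close> and \<open>z\<close> are split off and the rest is the kernel at
    \<open>x\<close> and a product.\<close>
  also have "\<dots> = S (\<lambda>w x3. S (\<lambda>v y3. S (\<lambda>z1 z2. S (\<lambda>y1 y2. S (\<lambda>a b. \<tau> y1 a * (\<tau> w (y2 * b) * f (x3 * (y3 * z2)))) z1) v) z) y) x"
    by (simp add: S_mult_right[symmetric] mult.assoc)
  also have "\<dots> = S (\<lambda>w x3. S (\<lambda>v y3. S (\<lambda>y1 y2. S (\<lambda>z1 z2. S (\<lambda>a b. \<tau> y1 a * (\<tau> w (y2 * b) * f (x3 * (y3 * z2)))) z1) z) v) y) x"
    by (subst S_swap[of _ _ z]) (rule refl)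
  also have "\<dots> = S (\<lambda>w x3. S (\<lambda>v y3. S (\<lambda>y1 y2. S (\<lambda>a z1. S (\<lambda>b z2. \<tau> y1 a * (\<tau> w (y2 * b) * f (x3 * (y3 * z2)))) z1) z) v) y) x"
    by (subst S_coassoc[of "\<lambda>a b z2. \<tau> y1 a * (\<tau> w (y2 * b) * f (x3 * (y3 * z2)))" for y1 w y2 x3 y3]) (intro li refl)+
  also have "\<dots> = S (\<lambda>w x3. S (\<lambda>y1 v. S (\<lambda>y2 y3. S (\<lambda>a z1. S (\<lambda>b z2. \<tau> y1 a * (\<tau> w (y2 * b) * f (x3 * (y3 * z2)))) z1) z) v) y) x"
    by (subst S_coassoc[of "\<lambda>y1 y2 y3. S (\<lambda>a z1. S (\<lambda>b z2. \<tau> y1 a * (\<tau> w (y2 * b) * f (x3 * (y3 * z2)))) z1) z" for w x3]) (intro li refl)+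
  also have "\<dots> = S (\<lambda>y1 v. S (\<lambda>w x3. S (\<lambda>y2 y3. S (\<lambda>a z1. S (\<lambda>b z2. \<tau> y1 a * (\<tau> w (y2 * b) * f (x3 * (y3 * z2)))) z1) z) v) x) y"
    by (rule S_swap)
  also have "\<dots> = S (\<lambda>y1 v. S (\<lambda>a z1. S (\<lambda>w x3. S (\<lambda>y2 y3. S (\<lambda>b z2. \<tau> y1 a * (\<tau> w (y2 * b) * f (x3 * (y3 * z2)))) z1) v) x) z) y"
  proof -
    have "S (\<lambda>w x3. S (\<lambda>y2 y3. S (\<lambda>a z1. S (\<lambda>b z2. \<tau> y1 a * (\<tau> w (y2 * b) * f (x3 * (y3 * z2)))) z1) z) v) x
      = S (\<lambda>w x3. S (\<lambda>a z1. S (\<lambda>y2 y3. S (\<lambda>b z2. \<tau> y1 a * (\<tau> w (y2 * b) * f (x3 * (y3 * z2)))) z1) v) z) x" for y1 v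
      by (subst S_swap) (rule refl)
    also have "\<dots> y1 v = S (\<lambda>a z1. S (\<lambda>w x3. S (\<lambda>y2 y3. S (\<lambda>b z2. \<tau> y1 a * (\<tau> w (y2 * b) * f (x3 * (y3 * z2)))) z1) v) x) z" for y1 v
      by (rule S_swap)
    finally show ?thesis by simp
  qed
  also have "\<dots> = S (\<lambda>y1 y2. S (\<lambda>z1 z2. \<tau> y1 z1 * conv2 \<tau> (\<lambda>x y. f (x * y)) x (y2 * z2)) z) y"
    by (simp add: k' S_mult_left)
  finally show ?thesis .
qed

end

subsection \<open>Algebras and quotients\<close>

definition kalg :: "('k::field, 'a) module \<Rightarrow> bool" where
  "kalg A \<longleftrightarrow> ring A \<and> kspace A \<and> (\<forall>c. \<forall>x\<in>carrier A. \<forall>y\<in>carrier A.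
     (c \<odot>\<^bsub>A\<^esub> x) \<otimes>\<^bsub>A\<^esub> y = c \<odot>\<^bsub>A\<^esub> (x \<otimes>\<^bsub>A\<^esub> y) \<and> x \<otimes>\<^bsub>A\<^esub> (c \<odot>\<^bsub>A\<^esub> y) = c \<odot>\<^bsub>A\<^esub> (x \<otimes>\<^bsub>A\<^esub> y))"

lemma kalgD:
  assumes "kalg A"
  shows "ring A" "kspace A"
    "x \<in> carrier A \<Longrightarrow> y \<in> carrier A \<Longrightarrow> (c \<odot>\<^bsub>A\<^esub> x) \<otimes>\<^bsub>A\<^esub> y = c \<odot>\<^bsub>A\<^esub> (x \<otimes>\<^bsub>A\<^esub> y)"
    "x \<in> carrier A \<Longrightarrow> y \<in> carrier A \<Longrightarrow> x \<otimes>\<^bsub>A\<^esub> (c \<odot>\<^bsub>A\<^esub> y) = c \<odot>\<^bsub>A\<^esub> (x \<otimes>\<^bsub>A\<^esub> y)"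
  using assms by (auto simp: kalg_def)

lemma kalgI:
  assumes "kspace A"
    and "\<And>x y. \<lbrakk>x \<in> carrier A; y \<in> carrier A\<rbrakk> \<Longrightarrow> x \<otimes>\<^bsub>A\<^esub> y \<in> carrier A" "\<one>\<^bsub>A\<^esub> \<in> carrier A"
    and "\<And>x y z. \<lbrakk>x \<in> carrier A; y \<in> carrier A; z \<in> carrier A\<rbrakk> \<Longrightarrow> x \<otimes>\<^bsub>A\<^esub> y \<otimes>\<^bsub>A\<^esub> z = x \<otimes>\<^bsub>A\<^esub> (y \<otimes>\<^bsub>A\<^esub> z)"
    and "\<And>x. x \<in> carrier A \<Longrightarrow> \<one>\<^bsub>A\<^esub> \<otimes>\<^bsub>A\<^esub> x = x" "\<And>x. x \<in> carrier A \<Longrightarrow> x \<otimes>\<^bsub>A\<^esub> \<one>\<^bsub>A\<^esub> = x"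
    and "\<And>x y z. \<lbrakk>x \<in> carrier A; y \<in> carrier A; z \<in> carrier A\<rbrakk> \<Longrightarrow>
      (x \<oplus>\<^bsub>A\<^esub> y) \<otimes>\<^bsub>A\<^esub> z = x \<otimes>\<^bsub>A\<^esub> z \<oplus>\<^bsub>A\<^esub> y \<otimes>\<^bsub>A\<^esub> z"
    and "\<And>x y z. \<lbrakk>x \<in> carrier A; y \<in> carrier A; z \<in> carrier A\<rbrakk> \<Longrightarrow>
      z \<otimes>\<^bsub>A\<^esub> (x \<oplus>\<^bsub>A\<^esub> y) = z \<otimes>\<^bsub>A\<^esub> x \<oplus>\<^bsub>A\<^esub> z \<otimes>\<^bsub>A\<^esub> y"
    and "\<And>c x y. \<lbrakk>x \<in> carrier A; y \<in> carrier A\<rbrakk> \<Longrightarrow> (c \<odot>\<^bsub>A\<^esub> x) \<otimes>\<^bsub>A\<^esub> y = c \<odot>\<^bsub>A\<^esub> (x \<otimes>\<^bsub>A\<^esub> y)"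
    and "\<And>c x y. \<lbrakk>x \<in> carrier A; y \<in> carrier A\<rbrakk> \<Longrightarrow> x \<otimes>\<^bsub>A\<^esub> (c \<odot>\<^bsub>A\<^esub> y) = c \<odot>\<^bsub>A\<^esub> (x \<otimes>\<^bsub>A\<^esub> y)"
  shows "kalg A"
  unfolding kalg_def
  by (intro conjI ringI monoidI allI ballI kspaceD(1)[OF assms(1)] assms) auto

text \<open>The algebra axioms are equations together with the existence of negatives, so they pass
  to the image of a map compatible with all operations. It serves for quotients by ideals.\<close>

lemma kalg_image:
  assumes "kalg A" "carrier B = q ` carrier A"
    and "\<And>x y. \<lbrakk>x \<in> carrier A; y \<in> carrier A\<rbrakk> \<Longrightarrow> q x \<oplus>\<^bsub>B\<^esub> q y = q (x \<oplus>\<^bsub>A\<^esub> y)"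
    and "\<And>x y. \<lbrakk>x \<in> carrier A; y \<in> carrier A\<rbrakk> \<Longrightarrow> q x \<otimes>\<^bsub>B\<^esub> q y = q (x \<otimes>\<^bsub>A\<^esub> y)"
    and "\<And>c x. x \<in> carrier A \<Longrightarrow> c \<odot>\<^bsub>B\<^esub> q x = q (c \<odot>\<^bsub>A\<^esub> x)"
    and "\<one>\<^bsub>B\<^esub> = q \<one>\<^bsub>A\<^esub>" "\<zero>\<^bsub>B\<^esub> = q \<zero>\<^bsub>A\<^esub>"
  shows "kalg B"
proof -
  interpret A: ring A using assms(1) by (rule kalgD)
  note kA = kspaceD[OF kalgD(2)[OF assms(1)]]
  have ab: "abelian_group B"
  proof (rule abelian_groupI)
    fix x assume "x \<in> carrier B"
    then obtain a where a: "x = q a" "a \<in> carrier A" by (auto simp: assms(2))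
    then show "\<exists>y\<in>carrier B. y \<oplus>\<^bsub>B\<^esub> x = \<zero>\<^bsub>B\<^esub>"
      by (intro bexI[of _ "q (\<ominus>\<^bsub>A\<^esub> a)"]) (auto simp: assms A.l_neg)
  qed (auto simp: assms A.a_ac)
  have "kspace B"
    by (rule kspaceI[OF ab]) (auto simp: assms kA(2-6))
  then show ?thesis
    by (rule kalgI) (auto simp: assms A.m_assoc A.l_distr A.r_distr kalgD[OF assms(1)] kA(2))
qed

context
  fixes A :: "('k::field, 'a) module" and I :: "'a set"
  assumes A: "kalg A" and I: "ideal I A"
begin

interpretation A: ring A using A by (rule kalgD)
interpretation I: ideal I A by (rule I)

lemma quot_carrier: "carrier (quot_alg A I) = (\<lambda>x. I +>\<^bsub>A\<^esub> x) ` carrier A"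
  by (auto simp: quot_alg_def ring.defs module.defs FactRing_def A_RCOSETS_def')

lemma quot_add:
  "x \<in> carrier A \<Longrightarrow> y \<in> carrier A \<Longrightarrow> (I +>\<^bsub>A\<^esub> x) \<oplus>\<^bsub>quot_alg A I\<^esub> (I +>\<^bsub>A\<^esub> y) = I +>\<^bsub>A\<^esub> (x \<oplus>\<^bsub>A\<^esub> y)"
  by (simp add: quot_alg_def ring.defs module.defs FactRing_def I.a_rcos_sum)

lemma quot_mult:
  "x \<in> carrier A \<Longrightarrow> y \<in> carrier A \<Longrightarrow> (I +>\<^bsub>A\<^esub> x) \<otimes>\<^bsub>quot_alg A I\<^esub> (I +>\<^bsub>A\<^esub> y) = I +>\<^bsub>A\<^esub> (x \<otimes>\<^bsub>A\<^esub> y)"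
  by (simp add: quot_alg_def ring.defs module.defs FactRing_def I.rcoset_mult_add)

lemma quot_one: "\<one>\<^bsub>quot_alg A I\<^esub> = I +>\<^bsub>A\<^esub> \<one>\<^bsub>A\<^esub>"
  by (simp add: quot_alg_def ring.defs module.defs FactRing_def)

text \<open>A scalar multiple of \<open>x\<close> is the product of \<open>x\<close> with the same
  multiple of the unit.\<close>

lemma ideal_smult: "x \<in> I \<Longrightarrow> c \<odot>\<^bsub>A\<^esub> x \<in> I"
  using I.I_l_closed[of x "c \<odot>\<^bsub>A\<^esub> \<one>\<^bsub>A\<^esub>"] kalgD(3)[OF A, of "\<one>\<^bsub>A\<^esub>" x c] kspaceD(2)[OF kalgD(2)[OF A]]
  by (simp add: I.a_Hcarr)

lemma coset_eq_iff:
  assumes "x \<in> carrier A" "y \<in> carrier A"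
  shows "I +>\<^bsub>A\<^esub> x = I +>\<^bsub>A\<^esub> y \<longleftrightarrow> x \<ominus>\<^bsub>A\<^esub> y \<in> I"
  using A.quotient_eq_iff_same_a_r_cos[OF I assms] by blast

lemma coset_self: "x \<in> carrier A \<Longrightarrow> x \<in> I +>\<^bsub>A\<^esub> x"
  by (rule I.a_rcos_self)

lemma coset_mem: "x \<in> carrier A \<Longrightarrow> y \<in> I +>\<^bsub>A\<^esub> x \<Longrightarrow> y \<in> carrier A \<and> I +>\<^bsub>A\<^esub> y = I +>\<^bsub>A\<^esub> x"
  using I.a_repr_independence'[of y x] I.a_elemrcos_carrier[of x y] by auto

lemma quot_smult: "x \<in> carrier A \<Longrightarrow> c \<odot>\<^bsub>quot_alg A I\<^esub> (I +>\<^bsub>A\<^esub> x) = I +>\<^bsub>A\<^esub> (c \<odot>\<^bsub>A\<^esub> x)"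
proof -
  assume x: "x \<in> carrier A"
  note kA = kspaceD[OF kalgD(2)[OF A]]
  have "I +>\<^bsub>A\<^esub> (c \<odot>\<^bsub>A\<^esub> y) = I +>\<^bsub>A\<^esub> (c \<odot>\<^bsub>A\<^esub> x)" if y: "y \<in> I +>\<^bsub>A\<^esub> x" for y
  proof -
    have yc: "y \<in> carrier A" "I +>\<^bsub>A\<^esub> y = I +>\<^bsub>A\<^esub> x" using coset_mem[OF x y] by auto
    then have "y \<ominus>\<^bsub>A\<^esub> x \<in> I" using coset_eq_iff[OF yc(1) x] by simp
    then have "c \<odot>\<^bsub>A\<^esub> (y \<ominus>\<^bsub>A\<^esub> x) \<in> I" by (rule ideal_smult)
    moreover have "c \<odot>\<^bsub>A\<^esub> (y \<ominus>\<^bsub>A\<^esub> x) = c \<odot>\<^bsub>A\<^esub> y \<ominus>\<^bsub>A\<^esub> c \<odot>\<^bsub>A\<^esub> x"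
      unfolding A.minus_eq
      by (subst kA(4)) (simp_all add: x yc(1) Module.module.smult_r_minus[OF kalgD(2)[OF A]])
    ultimately show ?thesis using coset_eq_iff kA(2) x yc(1) by simp
  qed
  then have "(\<Union>y\<in>I +>\<^bsub>A\<^esub> x. I +>\<^bsub>A\<^esub> (c \<odot>\<^bsub>A\<^esub> y)) = I +>\<^bsub>A\<^esub> (c \<odot>\<^bsub>A\<^esub> x)"
    using coset_self[OF x] by (intro SUP_eq_const) blast+
  then show ?thesis by (simp add: quot_alg_def ring.defs module.defs)
qed

lemma quot_zero: "\<zero>\<^bsub>quot_alg A I\<^esub> = I +>\<^bsub>A\<^esub> \<zero>\<^bsub>A\<^esub>"
proof -
  have "I +>\<^bsub>A\<^esub> \<zero>\<^bsub>A\<^esub> = I" by (rule A.a_rcos_zero[OF I]) simp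
  then show ?thesis by (simp add: quot_alg_def ring.defs module.defs FactRing_def)
qed

lemma kalg_quot: "kalg (quot_alg A I)"
  by (rule kalg_image[OF A quot_carrier quot_add quot_mult quot_smult quot_one quot_zero])

lemma quot_hom: "(\<lambda>x. I +>\<^bsub>A\<^esub> x) \<in> alg_hom A (quot_alg A I)"
  by (auto simp: alg_hom_def quot_carrier quot_add quot_mult quot_smult quot_one intro!: ring_hom_memI)

lemma quot_some:
  assumes "x \<in> carrier A"
  shows "(SOME y. y \<in> I +>\<^bsub>A\<^esub> x) \<in> carrier A" "I +>\<^bsub>A\<^esub> (SOME y. y \<in> I +>\<^bsub>A\<^esub> x) = I +>\<^bsub>A\<^esub> x"
proof -
  have "(SOME y. y \<in> I +>\<^bsub>A\<^esub> x) \<in> I +>\<^bsub>A\<^esub> x" using coset_self[OF assms] by (rule someI)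
  then show "(SOME y. y \<in> I +>\<^bsub>A\<^esub> x) \<in> carrier A" "I +>\<^bsub>A\<^esub> (SOME y. y \<in> I +>\<^bsub>A\<^esub> x) = I +>\<^bsub>A\<^esub> x"
    using coset_mem[OF assms] by auto
qed

end

lemma kernel_ideal:
  assumes "kalg A" "kalg B" "f \<in> alg_hom A B"
  shows "ideal {x \<in> carrier A. f x = \<zero>\<^bsub>B\<^esub>} A"
proof -
  interpret ring_hom_ring A B f
    by (rule ring_hom_ringI2[OF kalgD(1)[OF assms(1)] kalgD(1)[OF assms(2)]])
      (use assms(3) in \<open>simp add: alg_hom_def\<close>)
  show ?thesis using kernel_is_ideal unfolding a_kernel_def' .
qed

lemma alg_hom_minus:
  assumes "kalg A" "kalg B" "f \<in> alg_hom A B" "x \<in> carrier A" "y \<in> carrier A"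
  shows "f (x \<ominus>\<^bsub>A\<^esub> y) = f x \<ominus>\<^bsub>B\<^esub> f y" "f \<zero>\<^bsub>A\<^esub> = \<zero>\<^bsub>B\<^esub>"
proof -
  interpret ring_hom_ring A B f
    by (rule ring_hom_ringI2[OF kalgD(1)[OF assms(1)] kalgD(1)[OF assms(2)]])
      (use assms(3) in \<open>simp add: alg_hom_def\<close>)
  show "f (x \<ominus>\<^bsub>A\<^esub> y) = f x \<ominus>\<^bsub>B\<^esub> f y" using assms(4,5) by (simp add: R.minus_eq S.minus_eq)
  show "f \<zero>\<^bsub>A\<^esub> = \<zero>\<^bsub>B\<^esub>" by simp
qed

lemma alg_hom_eq_iff:
  assumes "kalg A" "kalg B" "f \<in> alg_hom A B" "x \<in> carrier A" "y \<in> carrier A"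
  shows "f x = f y \<longleftrightarrow> f (x \<ominus>\<^bsub>A\<^esub> y) = \<zero>\<^bsub>B\<^esub>"
proof -
  interpret B: ring B using assms(2) by (rule kalgD)
  have c: "f x \<in> carrier B" "f y \<in> carrier B" using alg_homD(1)[OF assms(3)] assms(4,5) by auto
  have "f x \<ominus>\<^bsub>B\<^esub> f y = \<zero>\<^bsub>B\<^esub> \<longleftrightarrow> f x = f y"
    using c B.r_neg[OF c(2)] B.add.inv_equality[of "f x" "\<ominus>\<^bsub>B\<^esub> f y"] by (auto simp: B.minus_eq)
  then show ?thesis by (simp add: alg_hom_minus[OF assms])
qed

subsection \<open>Free, tensor and symmetric algebras\<close>

text \<open>The zero of the monoid of words is the empty word, so these monomials are the scalars of
  the free algebra.\<close>

lemma single_0_mult: "Poly_Mapping.single (0::'x list) c * p = fscale c (p :: 'x list \<Rightarrow>\<^sub>0 'k::field)"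
  and mult_single_0: "p * Poly_Mapping.single 0 c = fscale c p"
proof -
  have "Poly_Mapping.keys p \<subseteq> UNIV" by simp
  then have "Poly_Mapping.single 0 c * p = fscale c p \<and> p * Poly_Mapping.single 0 c = fscale c p"
    by (induction rule: poly_mapping_induct_on)
      (auto simp: distrib_left distrib_right mult_single fs.scale_right_distrib mult.commute)
  then show "Poly_Mapping.single 0 c * p = fscale c p" "p * Poly_Mapping.single 0 c = fscale c p" by auto
qed

lemma single_Nil: "Poly_Mapping.single [] 1 = (1 :: 'x list \<Rightarrow>\<^sub>0 'k::field)"
  by (metis single_one zero_list_def)

lemma free_alg_simps [simp]:
  "carrier free_alg = UNIV" "(\<otimes>\<^bsub>free_alg\<^esub>) = (*)" "\<one>\<^bsub>free_alg\<^esub> = 1" "\<zero>\<^bsub>free_alg\<^esub> = 0"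
  "(\<oplus>\<^bsub>free_alg\<^esub>) = (+)" "(\<odot>\<^bsub>free_alg\<^esub>) = fscale"
  by (simp_all add: free_alg_def)

lemma fscale_mult: "fscale c p * q = fscale c (p * q)" "p * fscale c q = fscale c (p * q)"
  for p q :: "'x list \<Rightarrow>\<^sub>0 'k::field"
  by (simp add: single_0_mult[symmetric] mult.assoc)
    (simp add: mult_single_0[symmetric] mult.assoc)

lemma kalg_free_alg [simp]: "kalg (free_alg :: ('k::field, 'x list \<Rightarrow>\<^sub>0 'k) module)"
  unfolding kalg_def
  by (auto simp: fscale_mult) (simp_all add: free_alg_def kspace_alg_of fs.vector_space_axioms)

lemma free_minus [simp]: "p \<ominus>\<^bsub>free_alg\<^esub> q = p - q" for p q :: "'x list \<Rightarrow>\<^sub>0 'k::field"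
proof -
  interpret ring "free_alg :: ('k, 'x list \<Rightarrow>\<^sub>0 'k) module" by (rule kalgD) simp
  have "\<ominus>\<^bsub>free_alg\<^esub> q = - q" by (rule minus_equality) auto
  then show ?thesis by (simp add: minus_eq)
qed

definition word :: "('k, 'a) module \<Rightarrow> ('x \<Rightarrow> 'a) \<Rightarrow> 'x list \<Rightarrow> 'a" where
  "word A f w = foldr (\<lambda>v a. f v \<otimes>\<^bsub>A\<^esub> a) w \<one>\<^bsub>A\<^esub>"

definition free_ext :: "('k::field, 'a) module \<Rightarrow> ('x \<Rightarrow> 'a) \<Rightarrow> ('x list \<Rightarrow>\<^sub>0 'k) \<Rightarrow> 'a" where
  "free_ext A f p = (\<Oplus>\<^bsub>A\<^esub>w\<in>Poly_Mapping.keys p. Poly_Mapping.lookup p w \<odot>\<^bsub>A\<^esub> word A f w)"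

context
  fixes A :: "('k::field, 'a) module" and f :: "'x \<Rightarrow> 'a"
  assumes A: "kalg A" and f: "\<And>v. f v \<in> carrier A"
begin

interpretation A: ring A using A by (rule kalgD)
interpretation M: Module.module ground_alg A using A by (rule kalgD)

lemma word_carrier: "word A f w \<in> carrier A"
  by (induction w) (auto simp: word_def f)

lemma word_append: "word A f (v @ w) = word A f v \<otimes>\<^bsub>A\<^esub> word A f w"
  using word_carrier[of w] word_carrier
  by (induction v) (auto simp: word_def f A.m_assoc)

lemma free_ext_superset:
  assumes "finite F" "Poly_Mapping.keys p \<subseteq> F"
  shows "free_ext A f p = (\<Oplus>\<^bsub>A\<^esub>w\<in>F. Poly_Mapping.lookup p w \<odot>\<^bsub>A\<^esub> word A f w)"
  unfolding free_ext_def
  by (rule A.add.finprod_mono_neutral_cong_left[OF assms(1,2)])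
    (auto simp: in_keys_iff word_carrier M.smult_closed kspaceD(9)[OF kalgD(2)[OF A]])

lemma free_ext_carrier: "free_ext A f p \<in> carrier A"
  unfolding free_ext_def by (rule A.finsum_closed) (auto simp: word_carrier M.smult_closed)

lemma free_ext_add: "free_ext A f (p + q) = free_ext A f p \<oplus>\<^bsub>A\<^esub> free_ext A f q"
proof -
  let ?F = "Poly_Mapping.keys p \<union> Poly_Mapping.keys q"
  have "free_ext A f (p + q) = (\<Oplus>\<^bsub>A\<^esub>w\<in>?F. Poly_Mapping.lookup p w \<odot>\<^bsub>A\<^esub> word A f w \<oplus>\<^bsub>A\<^esub> Poly_Mapping.lookup q w \<odot>\<^bsub>A\<^esub> word A f w)"
    by (subst free_ext_superset[of ?F])
      (auto simp: lookup_add kspaceD(3)[OF kalgD(2)[OF A]] word_carrier Poly_Mapping.keys_add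
        intro!: A.finsum_cong' M.smult_closed)
  also have "\<dots> = free_ext A f p \<oplus>\<^bsub>A\<^esub> free_ext A f q"
    by (subst A.finsum_addf)
      (auto simp: word_carrier M.smult_closed free_ext_superset[of ?F p] free_ext_superset[of ?F q])
  finally show ?thesis .
qed

lemma free_ext_single: "free_ext A f (Poly_Mapping.single w c) = c \<odot>\<^bsub>A\<^esub> word A f w"
  by (subst free_ext_superset[of "{w}"]) (auto simp: word_carrier M.smult_closed)

lemma free_ext_zero: "free_ext A f 0 = \<zero>\<^bsub>A\<^esub>"
  by (simp add: free_ext_def)

lemma free_ext_scale: "free_ext A f (fscale c p) = c \<odot>\<^bsub>A\<^esub> free_ext A f p"
proof -
  have "Poly_Mapping.keys p \<subseteq> UNIV" by simp
  then show ?thesis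
  proof (induction rule: poly_mapping_induct_on)
    case zero
    then show ?case by (simp add: free_ext_zero)
  next
    case (add q a d)
    then show ?case
      by (simp add: fs.scale_right_distrib free_ext_add free_ext_single word_carrier free_ext_carrier
          kspaceD(2,4,5)[OF kalgD(2)[OF A]])
  qed
qed

lemma free_ext_mult: "free_ext A f (p * q) = free_ext A f p \<otimes>\<^bsub>A\<^esub> free_ext A f q"
proof -
  have 1: "free_ext A f (Poly_Mapping.single w c * q) = free_ext A f (Poly_Mapping.single w c) \<otimes>\<^bsub>A\<^esub> free_ext A f q" for w c
  proof -
    have "Poly_Mapping.keys q \<subseteq> UNIV" by simp
    then show ?thesis
    proof (induction rule: poly_mapping_induct_on)
      case zero
      then show ?case by (simp add: free_ext_zero free_ext_carrier)
    next
      case (add q v d)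
      have "free_ext A f (Poly_Mapping.single w c * Poly_Mapping.single v d)
          = free_ext A f (Poly_Mapping.single w c) \<otimes>\<^bsub>A\<^esub> free_ext A f (Poly_Mapping.single v d)"
        by (simp add: mult_single free_ext_single plus_list_def word_append kalgD(3,4)[OF A]
            word_carrier M.smult_closed kspaceD(5)[OF kalgD(2)[OF A], symmetric] mult.commute)
      then show ?case using add.IH
        by (simp add: distrib_left free_ext_add A.r_distr free_ext_carrier)
    qed
  qed
  have "Poly_Mapping.keys p \<subseteq> UNIV" by simp
  then show ?thesis
  proof (induction rule: poly_mapping_induct_on)
    case zero
    then show ?case by (simp add: free_ext_zero free_ext_carrier)
  next
    case (add p w c)
    then show ?case by (simp add: distrib_right free_ext_add A.l_distr free_ext_carrier 1)
  qed
qed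

lemma free_ext_one: "free_ext A f 1 = \<one>\<^bsub>A\<^esub>"
  using free_ext_single[of "[]" 1] kspaceD(6)[OF kalgD(2)[OF A], of "\<one>\<^bsub>A\<^esub>"]
  by (simp add: word_def single_Nil)

lemma free_ext_gen: "free_ext A f (free_gen v) = f v"
  using f kspaceD(6)[OF kalgD(2)[OF A], of "f v"] by (simp add: free_gen_def free_ext_single word_def)

lemma free_ext_hom: "free_ext A f \<in> alg_hom free_alg A"
  by (auto simp: alg_hom_def free_ext_carrier free_ext_add free_ext_mult free_ext_one free_ext_scale
      intro!: ring_hom_memI)

end

text \<open>Words grow at the front, so left multiplication by a generator suffices. The zero
  polynomial arises from scaling by 0.\<close>

lemma free_alg_induct [case_names one gen add scale]:
  assumes "P 1" "\<And>v p. P p \<Longrightarrow> P (free_gen v * p)" "\<And>p q. P p \<Longrightarrow> P q \<Longrightarrow> P (p + q)"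
    and "\<And>c p. P p \<Longrightarrow> P (fscale c p)"
  shows "P (p :: 'x list \<Rightarrow>\<^sub>0 'k::field)"
proof -
  have w: "P (Poly_Mapping.single w 1)" for w
  proof (induction w)
    case Nil
    show ?case using assms(1) by (simp add: single_Nil)
  next
    case (Cons v w)
    have "free_gen v * Poly_Mapping.single w (1::'k) = Poly_Mapping.single (v # w) 1"
      by (simp add: free_gen_def mult_single plus_list_def)
    then show ?case using assms(2)[OF Cons, of v] by simp
  qed
  have "Poly_Mapping.keys p \<subseteq> UNIV" by simp
  then show ?thesis
  proof (induction rule: poly_mapping_induct_on)
    case zero
    then show ?case using assms(4)[OF w, of 0] by simp
  next
    case (add q a c)
    then show ?case using assms(3)[OF assms(4)[OF w[of a], of c]] by simp
  qed
qed

lemma ideal_linearity: "ideal (linearity_ideal s) free_alg"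
  unfolding linearity_ideal_def by (rule ring.genideal_ideal[OF kalgD(1)]) simp_all

lemma kalg_tensor_algebra: "kalg (tensor_algebra s)"
  unfolding tensor_algebra_def by (rule kalg_quot[OF kalg_free_alg ideal_linearity])

lemma T_carrier: "carrier (tensor_algebra s) = range (\<lambda>p. linearity_ideal s +>\<^bsub>free_alg\<^esub> p)"
  by (simp add: tensor_algebra_def quot_carrier[OF kalg_free_alg ideal_linearity])

lemma T_class_hom: "(\<lambda>p. linearity_ideal s +>\<^bsub>free_alg\<^esub> p) \<in> alg_hom free_alg (tensor_algebra s)"
  unfolding tensor_algebra_def by (rule quot_hom[OF kalg_free_alg ideal_linearity])

lemma tgen_carrier [simp]: "tgen s v \<in> carrier (tensor_algebra s)"
  by (simp add: tgen_def T_carrier)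

lemma T_induct [consumes 1, case_names one gen add scale]:
  assumes "P \<in> carrier (tensor_algebra s)"
    and "Q \<one>\<^bsub>tensor_algebra s\<^esub>"
    and "\<And>v P. P \<in> carrier (tensor_algebra s) \<Longrightarrow> Q P \<Longrightarrow> Q (tgen s v \<otimes>\<^bsub>tensor_algebra s\<^esub> P)"
    and "\<And>P P'. P \<in> carrier (tensor_algebra s) \<Longrightarrow> P' \<in> carrier (tensor_algebra s) \<Longrightarrow> Q P \<Longrightarrow> Q P'
           \<Longrightarrow> Q (P \<oplus>\<^bsub>tensor_algebra s\<^esub> P')"
    and "\<And>c P. P \<in> carrier (tensor_algebra s) \<Longrightarrow> Q P \<Longrightarrow> Q (c \<odot>\<^bsub>tensor_algebra s\<^esub> P)"
  shows "Q P"
proof -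
  note h = alg_homD[OF T_class_hom[of s], simplified]
  obtain p where p: "P = linearity_ideal s +>\<^bsub>free_alg\<^esub> p" using assms(1) by (auto simp: T_carrier)
  have "Q (linearity_ideal s +>\<^bsub>free_alg\<^esub> p)"
  proof (induction p rule: free_alg_induct)
    case one
    then show ?case using assms(2) h(4) by simp
  next
    case (gen v p)
    then show ?case using assms(3) h(1,3) by (simp add: tgen_def)
  next
    case (add p q)
    then show ?case using assms(4) h(1,2) by simp
  next
    case (scale c p)
    then show ?case using assms(5) h(1,5) by simp
  qed
  then show ?thesis by (simp add: p)
qed

lemma alg_hom_T_unique:
  assumes "f \<in> alg_hom (tensor_algebra s) A" "g \<in> alg_hom (tensor_algebra s) A"
    and "\<And>v. f (tgen s v) = g (tgen s v)" "P \<in> carrier (tensor_algebra s)"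
  shows "f P = g P"
  using assms(4)
  by (induction rule: T_induct) (simp_all add: alg_homD[OF assms(1)] alg_homD[OF assms(2)] assms(3))

context
  fixes s :: "'k::field \<Rightarrow> 'v::ab_group_add \<Rightarrow> 'v" and A :: "('k, 'a) module" and f :: "'v \<Rightarrow> 'a"
  assumes A: "kalg A" and f: "\<And>v. f v \<in> carrier A"
    and f_add: "\<And>v w. f (v + w) = f v \<oplus>\<^bsub>A\<^esub> f w" and f_scale: "\<And>c v. f (s c v) = c \<odot>\<^bsub>A\<^esub> f v"
begin

text \<open>Linearity of \<open>f\<close> puts the generators of the linearity ideal into the kernel
  of \<open>free_ext\<close>. The chosen representative of the coset therefore does not affect the
  value.\<close>

lemma tensor_algebra_ext_class: "tensor_algebra_ext A f (linearity_ideal s +>\<^bsub>free_alg\<^esub> p) = free_ext A f p"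
proof -
  interpret A: ring A using A by (rule kalgD)
  note hom = free_ext_hom[OF A f]
  have minus: "free_ext A f (p - q) = free_ext A f p \<ominus>\<^bsub>A\<^esub> free_ext A f q" for p q
    using alg_hom_minus(1)[OF kalg_free_alg A hom, of p q] by simp
  have "f v \<oplus>\<^bsub>A\<^esub> f w \<ominus>\<^bsub>A\<^esub> f v = f w" for v w
    by (simp add: f A.minus_eq A.a_comm[of "f v" "f w"] A.a_assoc A.r_neg)
  then have z: "f v \<oplus>\<^bsub>A\<^esub> f w \<ominus>\<^bsub>A\<^esub> f v \<ominus>\<^bsub>A\<^esub> f w = \<zero>\<^bsub>A\<^esub>" for v w
    by (simp add: f A.minus_eq A.r_neg)
  have z2: "x \<ominus>\<^bsub>A\<^esub> x = \<zero>\<^bsub>A\<^esub>" if "x \<in> carrier A" for x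
    using that by (simp add: A.minus_eq A.r_neg)
  have "linearity_ideal s \<subseteq> {p \<in> carrier free_alg. free_ext A f p = \<zero>\<^bsub>A\<^esub>}"
    unfolding linearity_ideal_def
  proof (rule ring.genideal_minimal[OF kalgD(1)[OF kalg_free_alg] kernel_ideal[OF kalg_free_alg A hom]])
    show "{free_gen (v + w) - free_gen v - free_gen w | v w. True}
      \<union> {free_gen (s c v) - fscale c (free_gen v) | c v. True} \<subseteq> {p \<in> carrier free_alg. free_ext A f p = \<zero>\<^bsub>A\<^esub>}"
      by (auto simp: minus free_ext_gen[OF A f] free_ext_scale[OF A f] f_add f_scale f z z2
          kspaceD(2)[OF kalgD(2)[OF A]])
  qed
  then have 0: "free_ext A f q = \<zero>\<^bsub>A\<^esub>" if "q \<in> linearity_ideal s" for q using that by auto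
  define q where "q = (SOME q. q \<in> linearity_ideal s +>\<^bsub>free_alg\<^esub> p)"
  have "linearity_ideal s +>\<^bsub>free_alg\<^esub> q = linearity_ideal s +>\<^bsub>free_alg\<^esub> p"
    unfolding q_def by (rule quot_some(2)[OF kalg_free_alg ideal_linearity]) simp
  then have "q - p \<in> linearity_ideal s"
    using coset_eq_iff[OF kalg_free_alg ideal_linearity, of q p s] by simp
  then have "free_ext A f (q \<ominus>\<^bsub>free_alg\<^esub> p) = \<zero>\<^bsub>A\<^esub>" using 0 by simp
  then have "free_ext A f q = free_ext A f p"
    using alg_hom_eq_iff[OF kalg_free_alg A hom, of q p] by simp
  then show ?thesis
    by (simp add: tensor_algebra_ext_def q_def free_ext_def word_def Let_def)
qed

lemma tensor_algebra_ext_hom: "tensor_algebra_ext A f \<in> alg_hom (tensor_algebra s) A"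
proof -
  note h = alg_homD[OF T_class_hom[of s], simplified]
  note e = alg_homD[OF free_ext_hom[OF A f], simplified]
  show ?thesis
    by (auto simp: alg_hom_def T_carrier h(2,3,4,5)[symmetric] tensor_algebra_ext_class e
        intro!: ring_hom_memI)
qed

lemma tensor_algebra_ext_tgen: "tensor_algebra_ext A f (tgen s v) = f v"
  by (simp add: tgen_def tensor_algebra_ext_class free_ext_gen[OF A f])

end

lemma ideal_commutator: "ideal (commutator_ideal s) (tensor_algebra s)"
proof -
  interpret T: ring "tensor_algebra s" by (rule kalgD[OF kalg_tensor_algebra])
  show ?thesis
    unfolding commutator_ideal_def Let_def by (rule T.genideal_ideal) auto
qed

lemma kalg_symmetric_algebra: "kalg (symmetric_algebra s)"
  unfolding symmetric_algebra_def by (rule kalg_quot[OF kalg_tensor_algebra ideal_commutator])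

lemma S_class_hom: "(\<lambda>P. commutator_ideal s +>\<^bsub>tensor_algebra s\<^esub> P) \<in> alg_hom (tensor_algebra s) (symmetric_algebra s)"
  unfolding symmetric_algebra_def by (rule quot_hom[OF kalg_tensor_algebra ideal_commutator])

text \<open>In a commutative target the images of two generators commute, so the kernel is an ideal
  that contains all commutators of generators.\<close>

lemma commutator_ideal_kernel:
  assumes "kalg A" "f \<in> alg_hom (tensor_algebra s) A"
    and "\<And>x y. x \<in> carrier A \<Longrightarrow> y \<in> carrier A \<Longrightarrow> x \<otimes>\<^bsub>A\<^esub> y = y \<otimes>\<^bsub>A\<^esub> x"
    and "P \<in> commutator_ideal s"
  shows "f P = \<zero>\<^bsub>A\<^esub>"
proof -
  let ?T = "tensor_algebra s"
  interpret T: ring ?T by (rule kalgD[OF kalg_tensor_algebra])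
  interpret A: ring A by (rule kalgD[OF assms(1)])
  have "commutator_ideal s \<subseteq> {P \<in> carrier ?T. f P = \<zero>\<^bsub>A\<^esub>}"
    unfolding commutator_ideal_def Let_def
  proof (rule T.genideal_minimal[OF kernel_ideal[OF kalg_tensor_algebra assms(1,2)]])
    have "f (tgen s v \<otimes>\<^bsub>?T\<^esub> tgen s w \<ominus>\<^bsub>?T\<^esub> tgen s w \<otimes>\<^bsub>?T\<^esub> tgen s v) = \<zero>\<^bsub>A\<^esub>" for v w
    proof -
      have "f (tgen s v \<otimes>\<^bsub>?T\<^esub> tgen s w) = f (tgen s w \<otimes>\<^bsub>?T\<^esub> tgen s v)"
        using assms(3) by (simp add: alg_homD[OF assms(2)])
      then show ?thesis
        using alg_hom_eq_iff[OF kalg_tensor_algebra assms(1,2), of "tgen s v \<otimes>\<^bsub>?T\<^esub> tgen s w" "tgen s w \<otimes>\<^bsub>?T\<^esub> tgen s v"]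
        by simp
    qed
    then show "{tgen s v \<otimes>\<^bsub>?T\<^esub> tgen s w \<ominus>\<^bsub>?T\<^esub> tgen s w \<otimes>\<^bsub>?T\<^esub> tgen s v | v w. True} \<subseteq> {P \<in> carrier ?T. f P = \<zero>\<^bsub>A\<^esub>}"
      by auto
  qed
  then show ?thesis using assms(4) by auto
qed

lemma scalars_id: "scalars id"
  by unfold_locales auto

text \<open>A polynomial outside the linearity ideal can be joined to a basis of the ideal. The
  functional that is 1 there and 0 on the ideal descends to the quotient.\<close>

lemma separates_T:
  "scalars.separates id (tensor_algebra s) {l. scalars.linfun id (tensor_algebra s) (l :: _ \<Rightarrow> 'k::field)}"
proof -
  interpret scalars "id :: 'k \<Rightarrow> 'k" by (rule scalars_id)
  interpret vp: vector_space_pair "fscale :: 'k \<Rightarrow> ('a list \<Rightarrow>\<^sub>0 'k) \<Rightarrow> _" "(*) :: 'k \<Rightarrow> 'k \<Rightarrow> 'k"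
    by (intro vector_space_pair.intro fs.vector_space_axioms vector_space_mult)
  let ?I = "linearity_ideal s" and ?q = "\<lambda>p. linearity_ideal s +>\<^bsub>free_alg\<^esub> p"
  interpret I: ideal ?I free_alg by (rule ideal_linearity)
  have sub: "fs.subspace ?I"
    unfolding fs.subspace_def
    using additive_subgroup.zero_closed[OF ideal.axioms(1)[OF ideal_linearity[of s]]]
      additive_subgroup.a_closed[OF ideal.axioms(1)[OF ideal_linearity[of s]]]
      ideal_smult[OF kalg_free_alg ideal_linearity[of s]] by simp
  note h = alg_homD[OF T_class_hom[of s], simplified]
  have *: "v = w" if vw: "v \<in> carrier (tensor_algebra s)" "w \<in> carrier (tensor_algebra s)"
    and eq: "\<And>l. linfun (tensor_algebra s) l \<Longrightarrow> l v = l w" for v w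
  proof (rule ccontr)
    assume ne: "v \<noteq> w"
    obtain p q where p: "v = ?q p" and q: "w = ?q q" using vw by (auto simp: T_carrier)
    define d where "d = p - q"
    have d: "d \<notin> ?I" using ne coset_eq_iff[OF kalg_free_alg ideal_linearity, of p q s] by (simp add: p q d_def)
    obtain B where B: "B \<subseteq> ?I" "fs.independent B" "?I \<subseteq> fs.span B"
      using fs.maximal_independent_subset[of ?I] by auto
    have spB: "fs.span B = ?I" using B fs.span_minimal[OF B(1) sub] by blast
    have ind: "fs.independent (insert d B)" using B(2) d by (simp add: fs.independent_insert spB)
    \<comment> \<open>Linear extension of the indicator of \<open>d\<close> on the independent set
      that consists of \<open>d\<close> and a basis of the ideal.\<close>
    define x where "x = vp.construct (insert d B) (\<lambda>e. if e = d then 1 else (0::'k))"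
    have lx: "Vector_Spaces.linear fscale (*) x" unfolding x_def by (rule vp.linear_construct[OF ind])
    have xb: "x e = (if e = d then 1 else 0)" if "e \<in> insert d B" for e
      unfolding x_def by (rule vp.construct_basis[OF ind that])
    have x0: "x e = 0" if "e \<in> ?I" for e
    proof (rule vp.linear_eq_0_on_span[OF lx, of B])
      show "e \<in> fs.span B" using that spB by simp
      show "x b = 0" if "b \<in> B" for b
      proof -
        have "b \<noteq> d" using d B(1) that by blast
        moreover have "x b = (if b = d then 1 else 0)" by (rule xb) (rule insertI2[OF that])
        ultimately show ?thesis by (simp only: if_False)
      qed
    qed
    define l where "l P = x (SOME p. p \<in> P)" for P
    have lq: "l (?q r) = x r" for r
    proof -
      define y where "y = (SOME p. p \<in> ?q r)"
      have "?q y = ?q r" unfolding y_def by (rule quot_some(2)[OF kalg_free_alg ideal_linearity]) simp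
      then have "y - r \<in> ?I"
        using coset_eq_iff[OF kalg_free_alg ideal_linearity, of y r s] by simp
      from x0[OF this] have "x y = x r"
        using linearD(1)[OF lx, of "y - r" r] by simp
      then show ?thesis by (simp add: l_def y_def)
    qed
    have "linfun (tensor_algebra s) l"
      unfolding linfun_def by (auto simp: T_carrier h(2,5)[symmetric] lq linearD[OF lx])
    from eq[OF this] have "x p = x q" by (simp add: p q lq)
    then have "x d = 0" using linearD(1)[OF lx, of "p - q" q] by (simp add: d_def)
    then show False using xb[of d] by simp
  qed
  show ?thesis unfolding separates_def using * by auto
qed

section \<open>Tensor products of an algebra with the Hopf algebra\<close>

context hopf_scalars
begin

text \<open>The separating functionals of \<open>separates_tensor\<close> are induced by bilinear
  forms, so agreement under all bilinear forms implies equality.\<close>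

lemma tensor_H_eqI:
  assumes "kspace A" and sep: "separates A L"
    and "P \<in> carrier (tensor_space A HA)" "Q \<in> carrier (tensor_space A HA)"
    and "\<And>B. bil A HA B \<Longrightarrow> tl B P = tl B Q"
  shows "P = Q"
proof -
  let ?L = "{tl (\<lambda>v h. l v * \<kappa> (m h)) | l m. l \<in> L \<and> Vector_Spaces.linear (hscale H) (*) m}"
  have *: "separates (tensor_space A HA) ?L"
    using separates_tensor[OF assms(1) sep vs_H] by (simp only: hopf_alg_def)
  show ?thesis
  proof (rule separatesD(2)[OF * assms(3,4)])
    fix f assume "f \<in> ?L"
    then obtain l m where f: "f = tl (\<lambda>v h. l v * \<kappa> (m h))" and l: "l \<in> L"
      and m: "Vector_Spaces.linear (hscale H) (*) m" by blast
    have "bil A HA (\<lambda>v h. l v * \<kappa> (m h))"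
      using separatesD(1)[OF sep l] m by (auto simp: bil_def linfun_def algebra_simps linearD)
    then show "f P = f Q" unfolding f by (rule assms(5))
  qed
qed

lemma tl_tensor_H_mult:
  assumes A: "kalg A" and B: "bil A HA B"
    and "P \<in> carrier (tensor_space A HA)" "Q \<in> carrier (tensor_space A HA)"
  shows "tl B (P \<otimes>\<^bsub>tensor_alg A HA\<^esub> Q) = tl (\<lambda>a b. tl (\<lambda>a' b'. B (a \<otimes>\<^bsub>A\<^esub> a') (b * b')) Q) P"
proof -
  interpret A: ring A by (rule kalgD[OF A])
  show ?thesis
    by (subst tensor_alg_mult(2)[OF kalgD(2)[OF A] kspace_HA _ _ assms(3,4) linfun_tl[OF B]])
      (simp_all add: tl_tens[OF B])
qed

lemma bil_tensor_H_mult: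
  assumes A: "kalg A" and B: "bil A HA B" and Q: "Q \<in> carrier (tensor_space A HA)"
  shows "bil A HA (\<lambda>a b. tl (\<lambda>c d. B (a \<otimes>\<^bsub>A\<^esub> c) (b * d)) Q)"
proof -
  interpret A: ring A by (rule kalgD[OF A])
  note kA = kalgD(2)[OF A]
  have cong: "tl F Q = tl G Q" if "\<And>a b. a \<in> carrier A \<Longrightarrow> F a b = G a b" for F G
    by (rule tl_cong[OF kA kspace_HA Q]) (simp add: that)
  have bl: "B (a \<oplus>\<^bsub>A\<^esub> a') b = B a b + B a' b" "B (c \<odot>\<^bsub>A\<^esub> a) b = \<kappa> c * B a b"
      "B a (b + b') = B a b + B a b'" "B a (hscale H c b) = \<kappa> c * B a b"
    if "bil A HA B" "a \<in> carrier A" "a' \<in> carrier A" for B a a' b b' c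
    using that by (simp_all add: bil_def linfun_def)
  show ?thesis
    unfolding bil_def linfun_def tl_fun_add[symmetric] tl_fun_mult_left[symmetric]
    by (auto intro!: cong simp: A.l_distr kalgD(3)[OF A] distrib_right hscale_mult bl[OF B] kspaceD(2)[OF kA])
qed

text \<open>Each axiom is tested on bilinear forms, where the product of two tensors is a double sum
  over representatives and the axiom reduces to those of \<open>A\<close> and
  \<open>H\<close>.\<close>

lemma kalg_tensor_H:
  assumes A: "kalg A" and sep: "separates A L"
  shows "kalg (tensor_alg A HA)"
proof -
  let ?X = "tensor_space A HA" and ?P = "tensor_alg A HA"
  interpret A: ring A by (rule kalgD[OF A])
  note kA = kalgD(2)[OF A]
  note eqI = tensor_H_eqI[OF kA sep]
  have mc: "P \<otimes>\<^bsub>?P\<^esub> Q \<in> carrier ?X" if "P \<in> carrier ?X" "Q \<in> carrier ?X" for P Q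
    by (rule tensor_alg_mult(1)[OF kA kspace_HA _ _ that]) simp_all
  note mv = tl_tensor_H_mult[OF A]
  have cong: "tl F P = tl G P" if "P \<in> carrier ?X" "\<And>a b. a \<in> carrier A \<Longrightarrow> F a b = G a b" for F G P
    by (rule tl_cong[OF kA kspace_HA that(1)]) (simp add: that(2))
  have b1: "bil A HA (\<lambda>c d. B (a \<otimes>\<^bsub>A\<^esub> c) (b * d))" if "bil A HA B" "a \<in> carrier A" for B a b
    using that unfolding bil_def linfun_def
    by (simp add: A.r_distr kalgD(4)[OF A] distrib_left hscale_mult)
  note b2 = bil_tensor_H_mult[OF A]
  show ?thesis
  proof (rule kalgI)
    show "kspace ?P" using kspace_tensor[of A HA] unfolding Module.module_def module_axioms_def
      abelian_group_def abelian_group_axioms_def abelian_monoid_def by simp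
    show "\<one>\<^bsub>?P\<^esub> \<in> carrier ?P" by (simp add: tens_carrier)
    show "x \<otimes>\<^bsub>?P\<^esub> y \<in> carrier ?P" if "x \<in> carrier ?P" "y \<in> carrier ?P" for x y using that by (simp add: mc)
    show "x \<otimes>\<^bsub>?P\<^esub> y \<otimes>\<^bsub>?P\<^esub> z = x \<otimes>\<^bsub>?P\<^esub> (y \<otimes>\<^bsub>?P\<^esub> z)"
      if "x \<in> carrier ?P" "y \<in> carrier ?P" "z \<in> carrier ?P" for x y z
    proof (rule eqI)
      fix B assume B: "bil A HA B"
      have "tl B (x \<otimes>\<^bsub>?P\<^esub> y \<otimes>\<^bsub>?P\<^esub> z) = tl (\<lambda>a b. tl (\<lambda>a' b'. tl (\<lambda>c d. B (a \<otimes>\<^bsub>A\<^esub> a' \<otimes>\<^bsub>A\<^esub> c) (b * b' * d)) z) y) x"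
        using that by (simp add: mv[OF B] mc mv[OF b2[OF B]])
      also have "\<dots> = tl (\<lambda>a b. tl (\<lambda>a' b'. tl (\<lambda>c d. B (a \<otimes>\<^bsub>A\<^esub> (a' \<otimes>\<^bsub>A\<^esub> c)) (b * (b' * d))) z) y) x"
        using that by (intro cong) (simp_all add: A.m_assoc mult.assoc)
      also have "\<dots> = tl (\<lambda>a b. tl (\<lambda>c d. B (a \<otimes>\<^bsub>A\<^esub> c) (b * d)) (y \<otimes>\<^bsub>?P\<^esub> z)) x"
        using that by (intro cong) (simp_all add: mv[OF b1[OF B]])
      also have "\<dots> = tl B (x \<otimes>\<^bsub>?P\<^esub> (y \<otimes>\<^bsub>?P\<^esub> z))" using that by (simp add: mv[OF B] mc)
      finally show "tl B (x \<otimes>\<^bsub>?P\<^esub> y \<otimes>\<^bsub>?P\<^esub> z) = tl B (x \<otimes>\<^bsub>?P\<^esub> (y \<otimes>\<^bsub>?P\<^esub> z))" .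
    qed (use that in \<open>simp_all add: mc\<close>)
    show "\<one>\<^bsub>?P\<^esub> \<otimes>\<^bsub>?P\<^esub> x = x" if x: "x \<in> carrier ?P" for x
    proof (rule eqI)
      fix B assume B: "bil A HA B"
      have "tl B (\<one>\<^bsub>?P\<^esub> \<otimes>\<^bsub>?P\<^esub> x) = tl (\<lambda>a' b'. B (\<one>\<^bsub>A\<^esub> \<otimes>\<^bsub>A\<^esub> a') (1 * b')) x"
        using x by (simp add: mv[OF B] tens_carrier tl_tens[OF b2[OF B]])
      also have "\<dots> = tl B x" using x by (intro cong) simp_all
      finally show "tl B (\<one>\<^bsub>?P\<^esub> \<otimes>\<^bsub>?P\<^esub> x) = tl B x" .
    qed (use x in \<open>simp_all add: mc tens_carrier\<close>)
    show "x \<otimes>\<^bsub>?P\<^esub> \<one>\<^bsub>?P\<^esub> = x" if x: "x \<in> carrier ?P" for x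
    proof (rule eqI)
      fix B assume B: "bil A HA B"
      have "tl B (x \<otimes>\<^bsub>?P\<^esub> \<one>\<^bsub>?P\<^esub>) = tl (\<lambda>a b. tl (\<lambda>a' b'. B (a \<otimes>\<^bsub>A\<^esub> a') (b * b')) (tens A HA \<one>\<^bsub>A\<^esub> 1)) x"
        using x by (simp add: mv[OF B] tens_carrier)
      also have "\<dots> = tl B x" using x by (intro cong) (simp_all add: tl_tens[OF b1[OF B]])
      finally show "tl B (x \<otimes>\<^bsub>?P\<^esub> \<one>\<^bsub>?P\<^esub>) = tl B x" .
    qed (use x in \<open>simp_all add: mc tens_carrier\<close>)
    note ac = kspaceD(7)[OF kspace_tensor[of A HA]] and sc = kspaceD(2)[OF kspace_tensor[of A HA]]
    show "(x \<oplus>\<^bsub>?P\<^esub> y) \<otimes>\<^bsub>?P\<^esub> z = x \<otimes>\<^bsub>?P\<^esub> z \<oplus>\<^bsub>?P\<^esub> y \<otimes>\<^bsub>?P\<^esub> z"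
      if "x \<in> carrier ?P" "y \<in> carrier ?P" "z \<in> carrier ?P" for x y z
      using that by (intro eqI) (simp_all add: mc ac mv linfunD[OF linfun_tl] b2)
    show "z \<otimes>\<^bsub>?P\<^esub> (x \<oplus>\<^bsub>?P\<^esub> y) = z \<otimes>\<^bsub>?P\<^esub> x \<oplus>\<^bsub>?P\<^esub> z \<otimes>\<^bsub>?P\<^esub> y"
      if "x \<in> carrier ?P" "y \<in> carrier ?P" "z \<in> carrier ?P" for x y z
    proof (rule eqI)
      fix B assume B: "bil A HA B"
      have "tl B (z \<otimes>\<^bsub>?P\<^esub> (x \<oplus>\<^bsub>?P\<^esub> y)) = tl (\<lambda>a b. tl (\<lambda>c d. B (a \<otimes>\<^bsub>A\<^esub> c) (b * d)) x + tl (\<lambda>c d. B (a \<otimes>\<^bsub>A\<^esub> c) (b * d)) y) z"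
        using that by (simp add: mv[OF B] ac) (intro cong, simp_all add: linfunD(1)[OF linfun_tl[OF b1[OF B]]])
      then show "tl B (z \<otimes>\<^bsub>?P\<^esub> (x \<oplus>\<^bsub>?P\<^esub> y)) = tl B (z \<otimes>\<^bsub>?P\<^esub> x \<oplus>\<^bsub>?P\<^esub> z \<otimes>\<^bsub>?P\<^esub> y)"
        using that by (simp add: tl_fun_add mv[OF B] linfunD[OF linfun_tl[OF B]] mc)
    qed (use that in \<open>simp_all add: mc ac\<close>)
    show "(c \<odot>\<^bsub>?P\<^esub> x) \<otimes>\<^bsub>?P\<^esub> y = c \<odot>\<^bsub>?P\<^esub> (x \<otimes>\<^bsub>?P\<^esub> y)" if "x \<in> carrier ?P" "y \<in> carrier ?P" for c x y
      using that by (intro eqI) (simp_all add: mc sc mv linfunD[OF linfun_tl] b2)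
    show "x \<otimes>\<^bsub>?P\<^esub> (c \<odot>\<^bsub>?P\<^esub> y) = c \<odot>\<^bsub>?P\<^esub> (x \<otimes>\<^bsub>?P\<^esub> y)" if "x \<in> carrier ?P" "y \<in> carrier ?P" for c x y
    proof (rule eqI)
      fix B assume B: "bil A HA B"
      have "tl B (x \<otimes>\<^bsub>?P\<^esub> (c \<odot>\<^bsub>?P\<^esub> y)) = tl (\<lambda>a b. \<kappa> c * tl (\<lambda>c d. B (a \<otimes>\<^bsub>A\<^esub> c) (b * d)) y) x"
        using that by (simp add: mv[OF B] sc) (intro cong, simp_all add: linfunD(2)[OF linfun_tl[OF b1[OF B]]])
      then show "tl B (x \<otimes>\<^bsub>?P\<^esub> (c \<odot>\<^bsub>?P\<^esub> y)) = tl B (c \<odot>\<^bsub>?P\<^esub> (x \<otimes>\<^bsub>?P\<^esub> y))"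
        using that by (simp add: tl_fun_mult_left mv[OF B] linfunD[OF linfun_tl[OF B]] mc)
    qed (use that in \<open>simp_all add: mc sc\<close>)
  qed
qed

end

lemma tgen_linear:
  shows tgen_add: "tgen s (v + w) = tgen s v \<oplus>\<^bsub>tensor_algebra s\<^esub> tgen s w"
    and tgen_scale: "tgen s (s c v) = c \<odot>\<^bsub>tensor_algebra s\<^esub> tgen s v"
proof -
  let ?G = "{free_gen (v + w) - free_gen v - free_gen w | v w. True} \<union> {free_gen (s c v) - fscale c (free_gen v) | c v. True}"
  have sub: "?G \<subseteq> linearity_ideal s"
    unfolding linearity_ideal_def by (rule ring.genideal_self[OF kalgD(1)[OF kalg_free_alg]]) simp
  note h = alg_homD[OF T_class_hom[of s], simplified]
  note ce = coset_eq_iff[OF kalg_free_alg ideal_linearity, of _ _ s, simplified]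
  have "free_gen (v + w) - (free_gen v + free_gen w) \<in> linearity_ideal s"
    using sub by (auto simp: diff_diff_eq[symmetric])
  then show "tgen s (v + w) = tgen s v \<oplus>\<^bsub>tensor_algebra s\<^esub> tgen s w"
    unfolding tgen_def h(2)[symmetric] ce .
  have "free_gen (s c v) - fscale c (free_gen v) \<in> linearity_ideal s" using sub by auto
  then show "tgen s (s c v) = c \<odot>\<^bsub>tensor_algebra s\<^esub> tgen s v"
    unfolding tgen_def h(5)[symmetric] ce .
qed

lemma kspace_cong:
  assumes "carrier A = carrier B" "(\<oplus>\<^bsub>A\<^esub>) = (\<oplus>\<^bsub>B\<^esub>)" "\<zero>\<^bsub>A\<^esub> = \<zero>\<^bsub>B\<^esub>" "(\<odot>\<^bsub>A\<^esub>) = (\<odot>\<^bsub>B\<^esub>)" "kspace B"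
  shows "kspace A"
  using assms(5) assms(1-4) unfolding Module.module_def module_axioms_def
      abelian_group_def abelian_group_axioms_def abelian_monoid_def by simp

text \<open>A tensor space depends on carrier, addition and scalar action only. Thus a twisted
  algebra may be replaced by its underlying space in the target of a coaction.\<close>

lemma tensor_space_cong:
  assumes "carrier A = carrier B" "(\<oplus>\<^bsub>A\<^esub>) = (\<oplus>\<^bsub>B\<^esub>)" "(\<odot>\<^bsub>A\<^esub>) = (\<odot>\<^bsub>B\<^esub>)"
  shows "tensor_space A W = tensor_space B W" "tens A W = tens B W"
proof -
  have "tensor_null A W = tensor_null B W"
    by (simp add: tensor_null_def tensor_relations_def assms)
  then have "tcoset A W = tcoset B W" by (simp add: tcoset_def fun_eq_iff)
  then show "tensor_space A W = tensor_space B W" "tens A W = tens B W"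
    by (simp_all add: tensor_space_def tens_def fun_eq_iff assms)
qed

section \<open>The coaction on the tensor algebra\<close>

context hopf_scalars
begin

abbreviation "T \<equiv> T_alg H"
abbreviation "TH \<equiv> tensor_alg T HA"

lemma hopf_id: "hopf_scalars id H"
  by (intro hopf_scalars.intro scalars_id hopf_scalars_axioms.intro hopf)

text \<open>The claim does not involve the coefficient algebra, so it is proved with scalar-valued
  functionals, for which \<open>separates_T\<close> is available.\<close>

lemma kalg_TH: "kalg TH"
  by (rule hopf_scalars.kalg_tensor_H[OF hopf_id kalg_tensor_algebra separates_T])

lemma linfun_TH: "linfun TH l = linfun (tensor_space T HA) l"
  by (simp add: linfun_def)

lemma T_gen_carrier: "sweedler H TH (\<lambda>h1 h2. tens T HA (tgen (hscale H) h1) h2) h \<in> carrier TH"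
  by (rule linfun_sweedler(1)[OF kalgD(2)[OF kalg_TH]]) (simp add: tens_carrier)

lemma lin_bil_tgen:
  assumes "bil T HA B"
  shows "lin (\<lambda>x. B (tgen (hscale H) x) y)" "lin (\<lambda>y. B (tgen (hscale H) x) y)"
  using assms by (simp_all add: bil_def linfun_def tgen_add tgen_scale)

lemma tl_T_gen:
  assumes "bil T HA B"
  shows "tl B (sweedler H TH (\<lambda>h1 h2. tens T HA (tgen (hscale H) h1) h2) h) = S (\<lambda>h1 h2. B (tgen (hscale H) h1) h2) h"
proof -
  have "linfun TH (tl B)" unfolding linfun_TH by (rule linfun_tl[OF assms])
  from linfun_sweedler(2)[OF kalgD(2)[OF kalg_TH] _ this] show ?thesis
    by (simp add: tens_carrier tl_tens[OF assms])
qed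

lemma T_gen_linear:
  "sweedler H TH (\<lambda>h1 h2. tens T HA (tgen (hscale H) h1) h2) (v + w) =
     sweedler H TH (\<lambda>h1 h2. tens T HA (tgen (hscale H) h1) h2) v \<oplus>\<^bsub>TH\<^esub>
     sweedler H TH (\<lambda>h1 h2. tens T HA (tgen (hscale H) h1) h2) w"
  "sweedler H TH (\<lambda>h1 h2. tens T HA (tgen (hscale H) h1) h2) (hscale H c v) =
     c \<odot>\<^bsub>TH\<^esub> sweedler H TH (\<lambda>h1 h2. tens T HA (tgen (hscale H) h1) h2) v"
proof -
  interpret I: hopf_scalars id H by (rule hopf_id)
  note eqI = I.tensor_H_eqI[OF kalgD(2)[OF kalg_tensor_algebra] separates_T[of "hscale H"]]
  note c = T_gen_carrier[simplified]
  note l = I.linfunD[OF I.linfun_tl]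
  have li: "I.lin (\<lambda>h. I.S (\<lambda>h1 h2. B (tgen (hscale H) h1) h2) h)" if "I.bil T HA B" for B
    by (rule I.lin_S_arg) (rule I.lin_bil_tgen[OF that])+
  show "sweedler H TH (\<lambda>h1 h2. tens T HA (tgen (hscale H) h1) h2) (v + w) =
     sweedler H TH (\<lambda>h1 h2. tens T HA (tgen (hscale H) h1) h2) v \<oplus>\<^bsub>TH\<^esub>
     sweedler H TH (\<lambda>h1 h2. tens T HA (tgen (hscale H) h1) h2) w"
    by (rule eqI) (simp_all add: c kspaceD(7)[OF kspace_tensor] l I.tl_T_gen I.linD[OF li])
  show "sweedler H TH (\<lambda>h1 h2. tens T HA (tgen (hscale H) h1) h2) (hscale H c v) =
     c \<odot>\<^bsub>TH\<^esub> sweedler H TH (\<lambda>h1 h2. tens T HA (tgen (hscale H) h1) h2) v"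
    by (rule eqI) (simp_all add: c kspaceD(2)[OF kspace_tensor] l I.tl_T_gen I.linD[OF li])
qed

lemma T_coaction_hom: "T_coaction H \<in> alg_hom T TH"
  and T_coaction_tgen: "T_coaction H (tgen (hscale H) h) = sweedler H TH (\<lambda>h1 h2. tens T HA (tgen (hscale H) h1) h2) h"
  unfolding T_coaction_def Let_def
  by (rule tensor_algebra_ext_hom[OF kalg_TH T_gen_carrier T_gen_linear])
    (rule tensor_algebra_ext_tgen[OF kalg_TH T_gen_carrier T_gen_linear])

lemma T_coaction_carrier: "P \<in> carrier T \<Longrightarrow> T_coaction H P \<in> carrier (tensor_space T HA)"
  using alg_homD(1)[OF T_coaction_hom] by simp

lemma tl_T_coaction_one: "bil T HA B \<Longrightarrow> tl B (T_coaction H \<one>\<^bsub>T\<^esub>) = B \<one>\<^bsub>T\<^esub> 1"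
  by (simp add: alg_homD(4)[OF T_coaction_hom] tl_tens)

text \<open>The recursion for the coaction along left multiplication by a generator, matching
  \<open>T_induct\<close>.\<close>

lemma tl_T_coaction_mult:
  assumes B: "bil T HA B" and P: "P \<in> carrier T"
  shows "tl B (T_coaction H (tgen (hscale H) v \<otimes>\<^bsub>T\<^esub> P))
    = S (\<lambda>v1 v2. tl (\<lambda>P' h. B (tgen (hscale H) v1 \<otimes>\<^bsub>T\<^esub> P') (v2 * h)) (T_coaction H P)) v"
proof -
  note c = T_coaction_carrier
  have "tl B (T_coaction H (tgen (hscale H) v \<otimes>\<^bsub>T\<^esub> P))
      = tl (\<lambda>a b. tl (\<lambda>a' b'. B (a \<otimes>\<^bsub>T\<^esub> a') (b * b')) (T_coaction H P)) (T_coaction H (tgen (hscale H) v))"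
    by (simp add: alg_homD(3)[OF T_coaction_hom] P c tl_tensor_H_mult[OF kalg_tensor_algebra B])
  then show ?thesis
    by (simp add: T_coaction_tgen tl_T_gen[OF bil_tensor_H_mult[OF kalg_tensor_algebra B c[OF P]]])
qed

end

context coeff_alg
begin

lemma pair_add [simp]:
  "P \<in> carrier RH \<Longrightarrow> Q \<in> carrier RH \<Longrightarrow> lin f \<Longrightarrow> pair (P \<oplus>\<^bsub>RH\<^esub> Q) f = pair P f + pair Q f"
  by (rule linfunD(1)[OF linfun_pair])

lemma pair_smult [simp]: "P \<in> carrier RH \<Longrightarrow> lin f \<Longrightarrow> pair (c \<odot>\<^bsub>RH\<^esub> P) f = \<kappa> c * pair P f"
  by (rule linfunD(2)[OF linfun_pair])

lemma RH_closed [simp]: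
  "P \<in> carrier RH \<Longrightarrow> Q \<in> carrier RH \<Longrightarrow> P \<oplus>\<^bsub>RH\<^esub> Q \<in> carrier RH"
  "P \<in> carrier RH \<Longrightarrow> c \<odot>\<^bsub>RH\<^esub> P \<in> carrier RH"
  by (simp_all add: kspaceD(2,7)[OF kspace_tensor])

end

section \<open>Colinearity of morphisms out of the tensor algebra\<close>

context twist
begin

lemma kspace_TA: "kspace TA"
  by (rule kspace_cong[OF _ _ _ _ kspace_tensor[of RA HA]]) (simp_all del: tensor_zero)

lemma linfun_TA: "linfun TA l = linfun RH l"
  by (simp add: linfun_def)

text \<open>Colinearity in dual form. By \<open>gen\<close> the image of a generator is the sum of
  \<open>\<theta> v1\<close> tensor \<open>v2\<close>, which is colinear by coassociativity; the
  property spreads to products because the kernel of the product is compatible with convolution. The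
  functional \<open>\<theta>\<close> is an arbitrary linear form for the morphisms \<open>mu\<close>
  and the counit for the morphism into the product with \<open>\<sigma>\<close>.\<close>

lemma coaction_compat:
  assumes g: "g \<in> alg_hom T TA" and \<theta>: "lin \<theta>"
    and gen: "\<And>v f. lin f \<Longrightarrow> pair (g (tgen (hscale H) v)) f = conv \<theta> f v"
    and P: "P \<in> carrier T"
  shows "lin f \<Longrightarrow> lin k \<Longrightarrow> tl (\<lambda>P' h. pair (g P') f * k h) (T_coaction H P) = pair (g P) (conv f k)"
  using P
proof (induction arbitrary: f k rule: T_induct)
  note gh = alg_homD[OF g, simplified]
  have bilg: "bil T HA (\<lambda>P' h. pair (g P') f * k h)" if "lin f" "lin k" for f k
    using that by (simp add: bil_def lin_mult_l) (simp add: linfun_def gh algebra_simps)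
  have step: "pair (g (tgen (hscale H) v \<otimes>\<^bsub>T\<^esub> P)) f = S (\<lambda>a x. \<theta> a * pair (g P) (conv2 \<tau> (\<lambda>x y. f (x * y)) x)) v"
    if "P \<in> carrier T" "lin f" for v P f
  proof -
    have "lin (\<lambda>x. pair (g P) (conv2 \<tau> (\<lambda>x y. f (x * y)) x))"
      by (rule lin_pair) (rule lin_mult_kernel[OF that(2)])
    from gen[OF this, of v] show ?thesis
      using that by (simp add: gh pair_TA_mult conv_def)
  qed
  {
    case one
    then show ?case
      by (simp add: tl_T_coaction_one[OF bilg] gh(4) conv_one lin_conv u_in_R mult.assoc)
  next
    case (gen v P)
    let ?K = "conv2 \<tau> (\<lambda>x y. f (x * y))"
    note f = \<open>lin f\<close> and k = \<open>lin k\<close>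
    have bK: "bilin ?K" by (rule bilin_conv2[OF bilin_\<tau> bilin_mult[OF f]])
    have "tl (\<lambda>P' h. pair (g P') f * k h) (T_coaction H (tgen (hscale H) v \<otimes>\<^bsub>T\<^esub> P))
        = S (\<lambda>v1 v2. tl (\<lambda>P' h. pair (g (tgen (hscale H) v1 \<otimes>\<^bsub>T\<^esub> P')) f * k (v2 * h)) (T_coaction H P)) v"
      by (rule tl_T_coaction_mult[OF bilg[OF f k] gen.hyps])
    also have "\<dots> = S (\<lambda>v1 v2. tl (\<lambda>P' h. S (\<lambda>a x. \<theta> a * (pair (g P') (?K x) * k (v2 * h))) v1) (T_coaction H P)) v"
      by (intro arg_cong2[where f = S] ext refl
          tl_cong[OF kalgD(2)[OF kalg_tensor_algebra] kspace_HA T_coaction_carrier[OF gen.hyps]])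
        (simp add: step f S_mult_right[symmetric] mult.assoc)
    also have "\<dots> = S (\<lambda>v1 v2. S (\<lambda>a x. \<theta> a * tl (\<lambda>P' h. pair (g P') (?K x) * k (v2 * h)) (T_coaction H P)) v1) v"
      by (simp add: S_tl_swap[symmetric] tl_fun_mult_left)
    also have "\<dots> = S (\<lambda>v1 v2. S (\<lambda>a x. \<theta> a * pair (g P) (conv (?K x) (\<lambda>h. k (v2 * h)))) v1) v"
      by (simp add: gen.IH[OF bilinD(2)[OF bK] lin_comp_r[OF k]])
    \<comment> \<open>Coassociativity moves the splitting of \<open>v\<close> away from
      \<open>\<theta>\<close>, so that both remaining legs meet in one convolution.\<close>
    also have "\<dots> = S (\<lambda>a w. S (\<lambda>x v2. \<theta> a * pair (g P) (conv (?K x) (\<lambda>h. k (v2 * h)))) w) v"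
      unfolding conv_def by (rule S_coassoc) (intro lin_intros \<theta> lin_pair bilinD[OF bK] k)+
    also have "\<dots> = S (\<lambda>a w. \<theta> a * pair (g P) (\<lambda>y. conv2 ?K (\<lambda>x y. k (x * y)) w y)) v"
      by (simp add: S_mult_left conv2_def[of ?K] pair_S conv_def[abs_def])
    \<comment> \<open>Convolving the kernel of \<open>f\<close> with \<open>k\<close> composed with
      multiplication gives the kernel of \<open>conv f k\<close>, by associativity of
      \<open>conv2\<close> and \<open>conv_mult\<close>.\<close>
    also have "\<dots> = S (\<lambda>a w. \<theta> a * pair (g P) (conv2 \<tau> (\<lambda>x y. conv f k (x * y)) w)) v"
      by (simp add: conv2_assoc[OF bilin_\<tau> bilin_mult[OF f] bilin_mult[OF k]] conv_mult[OF f k])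
    also have "\<dots> = pair (g (tgen (hscale H) v \<otimes>\<^bsub>T\<^esub> P)) (conv f k)"
      by (rule step[OF gen.hyps lin_conv[OF f k], symmetric])
    finally show ?case .
  next
    case (add P P')
    then show ?case
      by (simp add: alg_homD(2)[OF T_coaction_hom] gh lin_conv
          linfunD(1)[OF linfun_tl[OF bilg]] T_coaction_carrier)
  next
    case (scale c P)
    then show ?case
      by (simp add: alg_homD(5)[OF T_coaction_hom] gh lin_conv
          linfunD(2)[OF linfun_tl[OF bilg]] T_coaction_carrier)
  }
qed

lemma coaction_comodule:
  assumes g: "g \<in> alg_hom T TA" and \<theta>: "lin \<theta>"
    and gen: "\<And>v f. lin f \<Longrightarrow> pair (g (tgen (hscale H) v)) f = conv \<theta> f v"
  shows "g \<in> comodule_alg_hom H T (T_coaction H) TA (tensor_coaction H RA)"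
proof -
  have sp: "tensor_space TA HA = RHH" "tens TA HA = tens RH HA"
    by (rule tensor_space_cong; simp)+
  note kT = kalgD(2)[OF kalg_tensor_algebra]
  have gc: "g P \<in> carrier RH" if "P \<in> carrier T" for P using alg_homD(1)[OF g that] by simp
  have "tensor_coaction H RA (g P) = tlift RHH (\<lambda>a' h. tens RH HA (g a') h) (T_coaction H P)" if P: "P \<in> carrier T" for P
  proof (rule RHH_eqI)
    have tc: "tens RH HA (g a') h \<in> carrier RHH" if "a' \<in> carrier T" for a' h
      using gc[OF that] by (simp add: tens_carrier)
    show "tensor_coaction H RA (g P) \<in> carrier RHH" by (rule coaction_carrier[OF gc[OF P]])
    show "tlift RHH (\<lambda>a' h. tens RH HA (g a') h) (T_coaction H P) \<in> carrier RHH"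
      by (rule linfun_tlift(1)[OF kT kspace_HA kspace_tensor T_coaction_carrier[OF P] tc])
    fix f k assume fk: "lin f" "lin k"
    have "pair2 (tlift RHH (\<lambda>a' h. tens RH HA (g a') h) (T_coaction H P)) f k
        = tl (\<lambda>P' h. pair (g P') f * k h) (T_coaction H P)"
      using linfun_tlift(2)[OF kT kspace_HA kspace_tensor T_coaction_carrier[OF P] tc linfun_pair2[OF fk]]
      by (simp add: fk)
    then show "pair2 (tensor_coaction H RA (g P)) f k = pair2 (tlift RHH (\<lambda>a' h. tens RH HA (g a') h) (T_coaction H P)) f k"
      by (simp add: pair2_coaction[OF gc[OF P] fk] coaction_compat[OF g \<theta> gen P fk])
  qed
  then show ?thesis using g unfolding comodule_alg_hom_def sp by simp
qed

end

section \<open>The twisted algebra of a normalized cocycle and the morphisms into it\<close>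

context cocycle_twist
begin

lemma mult_kernel_1:
  assumes "lin f"
  shows "conv2 \<tau> (\<lambda>x y. f (x * y)) 1 y = f y" "conv2 \<tau> (\<lambda>x y. f (x * y)) x 1 = f x"
proof -
  note li = lin_intros bilinD[OF bilin_\<tau>] assms
  have "conv2 \<tau> (\<lambda>x y. f (x * y)) 1 y = S (\<lambda>y1 y2. \<tau> 1 y1 * f (1 * y2)) y"
    unfolding conv2_def by (rule S_one) (intro li)+
  then show "conv2 \<tau> (\<lambda>x y. f (x * y)) 1 y = f y" by (simp add: normalized S_counit_left assms)
  have "S (\<lambda>y1 y2. \<tau> x1 y1 * f (x2 * y2)) 1 = \<tau> x1 1 * f (x2 * 1)" for x1 x2
    by (rule S_one) (intro li)+
  then show "conv2 \<tau> (\<lambda>x y. f (x * y)) x 1 = f x"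
    by (simp add: conv2_def normalized S_counit_left assms)
qed

lemma kalg_TA: "kalg TA"
proof (rule kalgI[OF kspace_TA])
  note lk = lin_mult_kernel
  have lp: "lin (\<lambda>x. pair Q (conv2 \<tau> (\<lambda>x y. f (x * y)) x))" if "lin f" for Q f
    by (rule lin_pair) (rule lk[OF that])
  have k1: "conv2 \<tau> (\<lambda>x y. f (x * y)) 1 = f" if "lin f" for f
    by (rule ext) (rule mult_kernel_1[OF that])
  show "\<one>\<^bsub>TA\<^esub> \<in> carrier TA" by (simp add: R_closed)
  show "x \<otimes>\<^bsub>TA\<^esub> y \<in> carrier TA" if "x \<in> carrier TA" "y \<in> carrier TA" for x y
    using that by (simp add: TA_mult_carrier)
  show "x \<otimes>\<^bsub>TA\<^esub> y \<otimes>\<^bsub>TA\<^esub> z = x \<otimes>\<^bsub>TA\<^esub> (y \<otimes>\<^bsub>TA\<^esub> z)"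
    if "x \<in> carrier TA" "y \<in> carrier TA" "z \<in> carrier TA" for x y z
  proof (rule RH_eqI)
    fix f assume f: "lin f"
    let ?K = "conv2 \<tau> (\<lambda>x y. f (x * y))"
    have c: "x \<in> carrier RH" "y \<in> carrier RH" "z \<in> carrier RH" using that by auto
    have "pair (x \<otimes>\<^bsub>TA\<^esub> y \<otimes>\<^bsub>TA\<^esub> z) f
        = pair x (\<lambda>a. pair y (conv2 \<tau> (\<lambda>a b. pair z (?K (a * b))) a))"
      by (simp add: pair_TA_mult TA_mult_carrier c f lp)
    \<comment> \<open>Pairing with \<open>z\<close> commutes with Sweedler sums in the other
      variables, so \<open>cocycle_conv\<close> applies pointwise under it.\<close>
    also have "\<dots> = pair x (\<lambda>a. pair y (\<lambda>b. pair z (conv2 \<tau> (\<lambda>b c. ?K a (b * c)) b)))"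
    proof -
      have "conv2 \<tau> (\<lambda>a b. pair z (?K (a * b))) a b = pair z (conv2 \<tau> (\<lambda>b c. ?K a (b * c)) b)" for a b
      proof -
        have "conv2 \<tau> (\<lambda>a b. pair z (?K (a * b))) a b
            = pair z (\<lambda>c. S (\<lambda>x1 x2. S (\<lambda>y1 y2. \<tau> x1 y1 * ?K (x2 * y2) c) b) a)"
          unfolding conv2_def[of \<tau> "\<lambda>a b. pair z (?K (a * b))"] by (simp only: pair_S pair_fun_mult_left)
        also have "\<dots> = pair z (\<lambda>c. S (\<lambda>y1 y2. S (\<lambda>z1 z2. \<tau> y1 z1 * ?K a (y2 * z2)) c) b)"
          by (simp only: cocycle_conv[OF f])
        also have "\<dots> = pair z (conv2 \<tau> (\<lambda>b c. ?K a (b * c)) b)"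
          by (rule arg_cong[where f = "pair z"], rule ext) (simp only: conv2_def[of \<tau> "\<lambda>b c. ?K a (b * c)"])
        finally show ?thesis .
      qed
      then have "conv2 \<tau> (\<lambda>a b. pair z (?K (a * b))) a = (\<lambda>b. pair z (conv2 \<tau> (\<lambda>b c. ?K a (b * c)) b))" for a
        by (rule ext)
      then show ?thesis by (simp only:)
    qed
    also have "\<dots> = pair (x \<otimes>\<^bsub>TA\<^esub> (y \<otimes>\<^bsub>TA\<^esub> z)) f"
      by (simp add: pair_TA_mult TA_mult_carrier c f lk)
    finally show "pair (x \<otimes>\<^bsub>TA\<^esub> y \<otimes>\<^bsub>TA\<^esub> z) f = pair (x \<otimes>\<^bsub>TA\<^esub> (y \<otimes>\<^bsub>TA\<^esub> z)) f" .
  qed (use that in \<open>simp_all add: TA_mult_carrier\<close>)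
  show "\<one>\<^bsub>TA\<^esub> \<otimes>\<^bsub>TA\<^esub> x = x" if "x \<in> carrier TA" for x
    using that by (intro RH_eqI) (simp_all add: TA_mult_carrier R_closed pair_TA_mult lp k1)
  show "x \<otimes>\<^bsub>TA\<^esub> \<one>\<^bsub>TA\<^esub> = x" if "x \<in> carrier TA" for x
    using that by (intro RH_eqI) (simp_all add: TA_mult_carrier R_closed pair_TA_mult lk mult_kernel_1)
  show "(x \<oplus>\<^bsub>TA\<^esub> y) \<otimes>\<^bsub>TA\<^esub> z = x \<otimes>\<^bsub>TA\<^esub> z \<oplus>\<^bsub>TA\<^esub> y \<otimes>\<^bsub>TA\<^esub> z"
    if "x \<in> carrier TA" "y \<in> carrier TA" "z \<in> carrier TA" for x y z
    using that by (intro RH_eqI) (simp_all add: TA_mult_carrier pair_TA_mult lp)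
  show "z \<otimes>\<^bsub>TA\<^esub> (x \<oplus>\<^bsub>TA\<^esub> y) = z \<otimes>\<^bsub>TA\<^esub> x \<oplus>\<^bsub>TA\<^esub> z \<otimes>\<^bsub>TA\<^esub> y"
    if "x \<in> carrier TA" "y \<in> carrier TA" "z \<in> carrier TA" for x y z
    using that by (intro RH_eqI) (simp_all add: TA_mult_carrier pair_TA_mult lk pair_fun_add)
  show "(c \<odot>\<^bsub>TA\<^esub> x) \<otimes>\<^bsub>TA\<^esub> y = c \<odot>\<^bsub>TA\<^esub> (x \<otimes>\<^bsub>TA\<^esub> y)" if "x \<in> carrier TA" "y \<in> carrier TA" for c x y
    using that by (intro RH_eqI) (simp_all add: TA_mult_carrier pair_TA_mult lp)
  show "x \<otimes>\<^bsub>TA\<^esub> (c \<odot>\<^bsub>TA\<^esub> y) = c \<odot>\<^bsub>TA\<^esub> (x \<otimes>\<^bsub>TA\<^esub> y)" if "x \<in> carrier TA" "y \<in> carrier TA" for c x y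
    using that by (intro RH_eqI) (simp_all add: TA_mult_carrier pair_TA_mult lk pair_fun_mult_left)
qed

definition mu_gen :: "('h \<Rightarrow> 'r) \<Rightarrow> 'h \<Rightarrow> ('r \<times> 'h \<Rightarrow>\<^sub>0 'k) set" where
  "mu_gen l h = sweedler H TA (\<lambda>h1 h2. ten (l h1) h2) h"

text \<open>The family of morphisms parametrized by linear maps \<open>l\<close>: the choice
  \<open>t\<close> gives the map that induces \<open>mu_alpha\<close>, scalar forms give the
  morphisms to the twisted Hopf algebra.\<close>

definition mu :: "('h \<Rightarrow> 'r) \<Rightarrow> ('h list \<Rightarrow>\<^sub>0 'k) set \<Rightarrow> ('r \<times> 'h \<Rightarrow>\<^sub>0 'k) set" where
  "mu l = tensor_algebra_ext TA (mu_gen l)"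

context
  fixes l :: "'h \<Rightarrow> 'r"
  assumes l: "lin l" and lR: "\<And>h. l h \<in> R"
begin

lemma mu_gen_carrier: "mu_gen l h \<in> carrier RH"
  using linfun_sweedler(1)[OF kspace_TA, of "\<lambda>h1 h2. ten (l h1) h2" h] lR by (simp add: mu_gen_def)

lemma pair_mu_gen: "lin f \<Longrightarrow> pair (mu_gen l h) f = conv l f h"
  using linfun_sweedler(2)[OF kspace_TA, of "\<lambda>h1 h2. ten (l h1) h2" "\<lambda>P. pair P f" h] lR linfun_pair[of f]
  by (simp add: mu_gen_def linfun_TA conv_def)

lemma mu_gen_linear:
  "mu_gen l (v + w) = mu_gen l v \<oplus>\<^bsub>TA\<^esub> mu_gen l w" "mu_gen l (hscale H c v) = c \<odot>\<^bsub>TA\<^esub> mu_gen l v"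
  by (rule RH_eqI; simp add: mu_gen_carrier pair_mu_gen linD[OF lin_conv[OF l]])+

lemma mu_hom: "mu l \<in> alg_hom T TA"
  unfolding mu_def using mu_gen_carrier mu_gen_linear by (intro tensor_algebra_ext_hom[OF kalg_TA]) simp_all

lemma mu_class: "mu l (linearity_ideal (hscale H) +>\<^bsub>free_alg\<^esub> p) = free_ext TA (mu_gen l) p"
  unfolding mu_def using mu_gen_carrier mu_gen_linear by (intro tensor_algebra_ext_class[OF kalg_TA]) simp_all

lemma mu_tgen: "mu l (tgen (hscale H) v) = mu_gen l v"
  unfolding mu_def using mu_gen_carrier mu_gen_linear by (intro tensor_algebra_ext_tgen[OF kalg_TA]) simp_all

lemma mu_comodule: "mu l \<in> comodule_alg_hom H T (T_coaction H) TA (tensor_coaction H RA)"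
  by (rule coaction_comodule[OF mu_hom l]) (simp add: mu_tgen pair_mu_gen)

end

text \<open>Applying the counit to the last factor of the coaction recovers an element. By
  colinearity the image of a generator is thus determined by its values under the counit, and these
  form the functional \<open>l\<close>. The condition on \<open>R\<close> places the values of
  \<open>l\<close> in the coefficient algebra.\<close>

lemma comodule_alg_hom_mu:
  assumes g: "g \<in> comodule_alg_hom H T (T_coaction H) TA (tensor_coaction H RA)"
    and R: "R = UNIV"
  shows "\<exists>l. lin l \<and> (\<forall>P\<in>carrier T. g P = mu l P)"
proof -
  have gh: "g \<in> alg_hom T TA" and gc: "\<And>a. a \<in> carrier T \<Longrightarrow>
      tensor_coaction H RA (g a) = tlift (tensor_space TA HA) (\<lambda>a' h. tens TA HA (g a') h) (T_coaction H a)"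
    using g by (auto simp: comodule_alg_hom_def)
  note kT = kalgD(2)[OF kalg_tensor_algebra]
  note gd = alg_homD[OF gh, simplified]
  have sp: "tensor_space TA HA = RHH" "tens TA HA = tens RH HA"
    by (rule tensor_space_cong; simp)+
  define l where "l h = pair (g (tgen (hscale H) h)) eps" for h
  have lR: "l h \<in> R" for h by (simp add: R)
  have l: "lin l" unfolding lin_iff l_def by (simp add: tgen_add tgen_scale gd lin_counit)
  have "g (tgen (hscale H) v) = mu l (tgen (hscale H) v)" for v
  proof (rule RH_eqI)
    show "g (tgen (hscale H) v) \<in> carrier RH" "mu l (tgen (hscale H) v) \<in> carrier RH"
      using gd(1) alg_homD(1)[OF mu_hom[OF l lR], simplified] by simp_all
    fix f assume f: "lin f"
    have tc: "tens RH HA (g a') h \<in> carrier RHH" if "a' \<in> carrier T" for a' h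
      using gd(1)[OF that] by (simp add: tens_carrier)
    have bb: "bil T HA (\<lambda>P' h. pair (g P') eps * f h)"
      using f lin_counit by (simp add: bil_def lin_mult_l) (simp add: linfun_def gd algebra_simps)
    \<comment> \<open>The functional \<open>f\<close> is inserted as \<open>conv eps f\<close>,
      which exposes the coaction.\<close>
    have "pair (g (tgen (hscale H) v)) f = pair2 (tensor_coaction H RA (g (tgen (hscale H) v))) eps f"
      by (simp add: pair2_coaction gd f lin_counit)
    also have "\<dots> = tl (\<lambda>P' h. pair (g P') eps * f h) (T_coaction H (tgen (hscale H) v))"
      unfolding gc[OF tgen_carrier] sp
      using linfun_tlift(2)[OF kT kspace_HA kspace_tensor T_coaction_carrier[OF tgen_carrier] tc linfun_pair2[OF lin_counit f]]
      by (simp add: f lin_counit)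
    also have "\<dots> = conv l f v"
      unfolding T_coaction_tgen by (simp add: tl_T_gen[OF bb] l_def conv_def)
    also have "\<dots> = pair (mu l (tgen (hscale H) v)) f"
      by (simp add: mu_tgen[OF l lR] pair_mu_gen[OF l lR] f)
    finally show "pair (g (tgen (hscale H) v)) f = pair (mu l (tgen (hscale H) v)) f" .
  qed
  then show ?thesis
    using alg_hom_T_unique[OF gh mu_hom[OF l lR]] l by blast
qed

end

subsection \<open>Evaluation of noncommutative polynomials\<close>

context scalars
begin

lemma RR_simps [simp]:
  "carrier RR = UNIV" "(\<otimes>\<^bsub>RR\<^esub>) = (*)" "\<one>\<^bsub>RR\<^esub> = 1" "\<zero>\<^bsub>RR\<^esub> = 0"
  "(\<oplus>\<^bsub>RR\<^esub>) = (+)" "(\<odot>\<^bsub>RR\<^esub>) = (\<lambda>c z. \<kappa> c * z)"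
  by (simp_all add: RR_def)

lemma kalg_RR: "kalg RR"
proof -
  have "kspace RR"
    by (rule kspaceI) (simp_all add: RR_def ring.is_abelian_group algebra_simps)
  then show ?thesis by (simp add: kalg_def RR_def algebra_simps)
qed

abbreviation ev :: "('x \<Rightarrow> 'r) \<Rightarrow> ('x list \<Rightarrow>\<^sub>0 'k) \<Rightarrow> 'r" where
  "ev \<equiv> free_ext RR"

lemma ev_simps [simp]:
  "ev l (p + q) = ev l p + ev l q" "ev l (p * q) = ev l p * ev l q" "ev l 1 = 1" "ev l 0 = 0"
  "ev l (fscale c p) = \<kappa> c * ev l p" "ev l (free_gen v) = l v"
  using free_ext_add[OF kalg_RR, of l p q] free_ext_mult[OF kalg_RR, of l p q] free_ext_one[OF kalg_RR, of l]
    free_ext_zero[OF kalg_RR, of l] free_ext_scale[OF kalg_RR, of l c p] free_ext_gen[OF kalg_RR, of l v]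
  by simp_all

lemma ev_sum: "ev l (sum f A) = (\<Sum>a\<in>A. ev l (f a))"
  by (induction A rule: infinite_finite_induct) auto

lemma word_RR: "word RR l w = prod_list (map l w)"
  by (induction w) (simp_all add: word_def)

lemma finsum_RR: "finsum RR g A = sum g A"
  by (simp add: RR_def finsum_alg_of)

lemma ev_eq: "ev l p = (\<Sum>w\<in>Poly_Mapping.keys p. \<kappa> (Poly_Mapping.lookup p w) * prod_list (map l w))"
  by (simp add: free_ext_def word_RR finsum_RR)

lemma ev_substitute:
  "(\<And>v. ev l (b v) = l v) \<Longrightarrow> ev l (free_ext free_alg b p) = ev l p"
proof (induction p rule: free_alg_induct)
  note fe = alg_homD[OF free_ext_hom[OF kalg_free_alg], simplified]
  case (gen v p)
  then show ?case by (simp add: fe free_ext_gen[OF kalg_free_alg])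
qed (simp_all add: alg_homD[OF free_ext_hom[OF kalg_free_alg], simplified])

definition monom_value :: "('x \<Rightarrow> 'r) \<Rightarrow> 'x multiset \<Rightarrow> 'r" where
  "monom_value l m = prod_mset (image_mset l m)"

text \<open>The values commute, so words with the same multiset of letters contribute to the same
  monomial.\<close>

lemma ev_monomials:
  "ev l p = (\<Sum>m\<in>mset ` Poly_Mapping.keys p.
     \<kappa> (\<Sum>w | w \<in> Poly_Mapping.keys p \<and> mset w = m. Poly_Mapping.lookup p w) * monom_value l m)"
proof -
  have "ev l p = (\<Sum>m\<in>mset ` Poly_Mapping.keys p. \<Sum>w | w \<in> Poly_Mapping.keys p \<and> mset w = m.
      \<kappa> (Poly_Mapping.lookup p w) * prod_list (map l w))"
    unfolding ev_eq by (rule sum.image_gen) simp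
  also have "\<dots> = (\<Sum>m\<in>mset ` Poly_Mapping.keys p.
     \<kappa> (\<Sum>w | w \<in> Poly_Mapping.keys p \<and> mset w = m. Poly_Mapping.lookup p w) * monom_value l m)"
  proof (rule sum.cong[OF refl])
    fix m
    have "(\<Sum>w | w \<in> Poly_Mapping.keys p \<and> mset w = m. \<kappa> (Poly_Mapping.lookup p w) * prod_list (map l w))
        = (\<Sum>w | w \<in> Poly_Mapping.keys p \<and> mset w = m. \<kappa> (Poly_Mapping.lookup p w) * monom_value l m)"
      by (rule sum.cong) (auto simp: monom_value_def prod_mset_prod_list[symmetric] mset_map[symmetric] simp del: mset_map)
    then show "(\<Sum>w | w \<in> Poly_Mapping.keys p \<and> mset w = m. \<kappa> (Poly_Mapping.lookup p w) * prod_list (map l w))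
        = \<kappa> (\<Sum>w | w \<in> Poly_Mapping.keys p \<and> mset w = m. Poly_Mapping.lookup p w) * monom_value l m"
      by (simp add: scal_sum sum_distrib_right)
  qed
  finally show ?thesis .
qed

end

section \<open>Linear independence of monomials\<close>

text \<open>The difference of two distinct powers is a nonzero polynomial and has only finitely many
  roots.\<close>

lemma exists_power_neq:
  assumes "infinite (UNIV :: 'k::field set)" "i \<noteq> j"
  shows "\<exists>s::'k. s ^ i \<noteq> s ^ j"
proof (rule ccontr)
  assume "\<nexists>s::'k. s ^ i \<noteq> s ^ j"
  then have "{s::'k. poly (monom 1 i - monom 1 j) s = 0} = UNIV" by (simp add: poly_monom)
  moreover have "monom 1 i - monom 1 j \<noteq> (0 :: 'k poly)" using assms(2) by (simp add: monom_eq_iff')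
  ultimately show False using poly_roots_finite assms(1) by metis
qed

context scalars
begin

lemma monom_value_mult: "monom_value (\<lambda>x. l x * l' x) m = monom_value l m * monom_value l' m"
  by (simp add: monom_value_def prod_mset.distrib)

lemma monom_value_single: "monom_value (\<lambda>x. if x = b then s else 1) m = s ^ count m b"
  by (induction m) (auto simp: monom_value_def)

end

text \<open>Distinct monomials are distinct multiplicative functions, so Dedekind's argument shows that
  they are linearly independent.\<close>

lemma monomials_independent:
  fixes c :: "'x multiset \<Rightarrow> 'k::field"
  assumes "infinite (UNIV :: 'k set)" "finite M"
    and "\<And>l. (\<Sum>m\<in>M. c m * scalars.monom_value l m) = 0" "m \<in> M"
  shows "c m = 0"
  using assms(2-)
proof (induction M arbitrary: c m rule: finite_induct)
  case (insert m0 M)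
  interpret scalars "id :: 'k \<Rightarrow> 'k" by (rule scalars_id)
  have M0: "c m1 = 0" if m1: "m1 \<in> M" for m1
  proof -
    have "m1 \<noteq> m0" using m1 insert.hyps by auto
    then obtain b where "count m1 b \<noteq> count m0 b" by (auto simp: multiset_eq_iff)
    then obtain s :: 'k where s: "s ^ count m1 b \<noteq> s ^ count m0 b" using exists_power_neq[OF assms(1)] by blast
    \<comment> \<open>The point with value \<open>s\<close> at \<open>b\<close> and 1 elsewhere; a
      monomial takes there the value \<open>s\<close> to the power of its degree in
      \<open>b\<close>.\<close>
    define e where "e = (\<lambda>x. if x = b then s else 1)"
    \<comment> \<open>Coefficients of the relation obtained by rescaling the point by
      \<open>e\<close> and subtracting \<open>monom_value e m0\<close> times the given relation. The
      term at \<open>m0\<close> cancels, while the factor at \<open>m1\<close> is nonzero.\<close>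
    define c' where "c' m = c m * (monom_value e m - monom_value e m0)" for m
    have "c' m1 = 0"
    proof (rule insert.IH[OF _ m1])
      fix l
      have "(\<Sum>m\<in>M. c' m * monom_value l m) = (\<Sum>m\<in>insert m0 M. c' m * monom_value l m)"
        using insert.hyps by (simp add: c'_def)
      also have "\<dots> = (\<Sum>m\<in>insert m0 M. c m * monom_value (\<lambda>x. e x * l x) m)
          - monom_value e m0 * (\<Sum>m\<in>insert m0 M. c m * monom_value l m)"
        unfolding sum_distrib_left sum_subtractf[symmetric]
        by (rule sum.cong) (simp_all add: c'_def monom_value_mult algebra_simps)
      finally show "(\<Sum>m\<in>M. c' m * monom_value l m) = 0" by (simp only: insert.prems(1)) simp
    qed
    then show ?thesis using s by (simp add: c'_def e_def monom_value_single)
  qed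
  \<comment> \<open>Only the monomial \<open>m0\<close> is left, and it is evaluated at the point
    with all values 1.\<close>
  have "c m0 * monom_value (\<lambda>x. 1) m0 = 0"
    using insert.prems(1)[of "\<lambda>x. 1"] insert.hyps by (simp add: M0)
  then have "c m0 = 0" by (simp add: monom_value_def)
  then show ?case using M0 insert.prems(2) by auto
qed simp

text \<open>Linear forms cannot be prescribed on all vectors, but they can on a basis. After every
  symbol is expanded in basis symbols, the vanishing at all linear forms is a vanishing at all
  points, and the coefficient of each monomial is zero.\<close>

lemma (in scalars) ev_zero_if_vanishing:
  fixes s :: "'k \<Rightarrow> 'v::ab_group_add \<Rightarrow> 'v"
  assumes "infinite (UNIV :: 'k set)" "vector_space s"
    and van: "\<And>l. Vector_Spaces.linear s (*) l \<Longrightarrow> scalars.ev id l p = 0"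
    and t: "\<And>x y. t (x + y) = t x + t y" "\<And>c x. t (s c x) = \<kappa> c * t x"
  shows "ev t p = 0"
proof -
  interpret I: scalars "id :: 'k \<Rightarrow> 'k" by (rule scalars_id)
  interpret vector_space_pair s "(*) :: 'k \<Rightarrow> 'k \<Rightarrow> 'k"
    by (intro vector_space_pair.intro assms(2) vector_space_mult)
  define B where "B = vs1.extend_basis {}"
  have indB: "vs1.independent B" and spB: "vs1.span B = UNIV"
    unfolding B_def using vs1.independent_extend_basis[of "{}"] vs1.span_extend_basis[of "{}"]
    by (auto simp: vs1.independent_empty)
  define r where "r = vs1.representation B"
  \<comment> \<open>The expansion of \<open>v\<close> in the basis, as a polynomial of degree at
    most one. Under a linear evaluation the symbol of \<open>v\<close> and \<open>b v\<close> have
    the same value.\<close>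
  define b where "b v = (\<Sum>e | r v e \<noteq> 0. fscale (r v e) (free_gen e))" for v :: 'v
  have bt: "ev t (b v) = t v" for v
  proof -
    have tsum: "t (\<Sum>e\<in>E. s (r v e) e) = (\<Sum>e\<in>E. \<kappa> (r v e) * t e)" for E
      using t(2)[of 0 0] by (induction E rule: infinite_finite_induct) (simp_all add: t)
    have "t v = t (\<Sum>e | r v e \<noteq> 0. s (r v e) e)"
      using vs1.sum_nonzero_representation_eq[OF indB, of v] spB by (simp add: r_def)
    then show ?thesis by (simp add: b_def ev_sum tsum)
  qed
  have bl: "I.ev l (b v) = l v" if l: "Vector_Spaces.linear s (*) l" for l v
  proof -
    have lsum: "l (\<Sum>e\<in>E. s (r v e) e) = (\<Sum>e\<in>E. r v e * l e)" for E
      using linearD(2)[OF l, of 0 0] by (induction E rule: infinite_finite_induct) (simp_all add: linearD[OF l])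
    have "l v = l (\<Sum>e | r v e \<noteq> 0. s (r v e) e)"
      using vs1.sum_nonzero_representation_eq[OF indB, of v] spB by (simp add: r_def)
    then show ?thesis by (simp add: b_def I.ev_sum lsum)
  qed
  define q where "q = free_ext free_alg b p"
  define M where "M = mset ` Poly_Mapping.keys q"
  define c where "c m = (\<Sum>w | w \<in> Poly_Mapping.keys q \<and> mset w = m. Poly_Mapping.lookup q w)" for m
  have keysb: "Poly_Mapping.keys (b v) \<subseteq> {[e] | e. e \<in> B}" for v
  proof -
    have "Poly_Mapping.keys (b v) \<subseteq> (\<Union>e\<in>{e. r v e \<noteq> 0}. Poly_Mapping.keys (fscale (r v e) (free_gen e)))"
      unfolding b_def by (rule Poly_Mapping.keys_sum)
    also have "\<dots> \<subseteq> {[e] | e. e \<in> B}"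
      using vs1.representation_ne_zero[of B v] by (auto simp: free_gen_def r_def split: if_splits)
    finally show ?thesis .
  qed
  have keysq: "Poly_Mapping.keys (free_ext free_alg b z) \<subseteq> lists B" for z
  proof (induction z rule: free_alg_induct)
    note fe = alg_homD[OF free_ext_hom[OF kalg_free_alg], simplified]
    {
      case one
      show ?case unfolding fe(4) by (simp add: single_Nil[symmetric])
    next
      case (gen v z)
      show ?case
        using Poly_Mapping.keys_mult[of "b v" "free_ext free_alg b z"] gen keysb[of v]
        by (fastforce simp: fe free_ext_gen[OF kalg_free_alg] plus_list_def)
    next
      case (add y z)
      then show ?case by (simp add: fe keys_add_subset)
    next
      case (scale a z)
      then show ?case by (simp add: fe keys_fscale_subset)
    }
  qed
  have cz: "c m = 0" if "m \<in> M" for m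
  proof (rule monomials_independent[OF assms(1) _ _ that])
    show "finite M" by (simp add: M_def)
    fix l :: "'v \<Rightarrow> 'k"
    \<comment> \<open>An arbitrary point \<open>l\<close> is replaced by the linear form that agrees
      with it on \<open>B\<close>; monomials of \<open>q\<close> involve letters from
      \<open>B\<close> only.\<close>
    define l' where "l' = construct B l"
    have l': "Vector_Spaces.linear s (*) l'" unfolding l'_def by (rule linear_construct[OF indB])
    have "(\<Sum>m\<in>M. c m * I.monom_value l m) = (\<Sum>m\<in>M. c m * I.monom_value l' m)"
    proof (rule sum.cong[OF refl])
      fix m assume "m \<in> M"
      then obtain w where "m = mset w" "w \<in> lists B" using keysq[of p] by (auto simp: M_def q_def)
      then have "set_mset m \<subseteq> B" by auto
      then have "image_mset l m = image_mset l' m"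
        by (intro image_mset_cong) (auto simp: l'_def construct_basis[OF indB])
      then show "c m * I.monom_value l m = c m * I.monom_value l' m" by (simp add: I.monom_value_def)
    qed
    also have "\<dots> = I.ev l' q" by (simp add: I.ev_monomials[of l' q] M_def c_def)
    also have "\<dots> = 0" unfolding q_def by (simp add: I.ev_substitute bl[OF l'] van[OF l'])
    finally show "(\<Sum>m\<in>M. c m * scalars.monom_value l m) = 0" .
  qed
  have "ev t p = ev t q" unfolding q_def by (rule ev_substitute[OF bt, symmetric])
  also have "\<dots> = (\<Sum>m\<in>M. \<kappa> (c m) * monom_value t m)" by (simp add: ev_monomials[of t q] M_def c_def)
  finally show ?thesis by (simp add: cz)
qed

subsection \<open>Word polynomials\<close>

text \<open>\<open>word_poly H \<alpha> w f\<close> is the coordinate along \<open>f\<close> of the value at the word \<open>w\<close> of the morphism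
  \<open>X\<^sub>h \<mapsto> \<Sum> l h\<^sub>1 \<otimes> h\<^sub>2\<close>, as a polynomial in the values of \<open>l\<close>.  It does not depend on \<open>l\<close> nor on the
  coefficient algebra, which allows to compare the generic \<open>l = t\<close> with the scalar ones.\<close>

primrec word_poly ::
  "('k::field, 'h::ring_1) hopf_data \<Rightarrow> ('h \<Rightarrow> 'h \<Rightarrow> 'k) \<Rightarrow> 'h list \<Rightarrow> ('h \<Rightarrow> 'k) \<Rightarrow> ('h list \<Rightarrow>\<^sub>0 'k)" where
  "word_poly H \<alpha> [] f = fscale (f 1) 1"
| "word_poly H \<alpha> (v # w) f = sweedler H free_alg
     (\<lambda>a b. free_gen a * word_poly H \<alpha> w (hopf_scalars.conv2 id H \<alpha> (\<lambda>x y. f (x * y)) b)) v"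

definition coord_poly ::
  "('k::field, 'h::ring_1) hopf_data \<Rightarrow> ('h \<Rightarrow> 'h \<Rightarrow> 'k) \<Rightarrow> ('h list \<Rightarrow>\<^sub>0 'k) \<Rightarrow> ('h \<Rightarrow> 'k) \<Rightarrow> ('h list \<Rightarrow>\<^sub>0 'k)" where
  "coord_poly H \<alpha> p f = (\<Sum>w\<in>Poly_Mapping.keys p. fscale (Poly_Mapping.lookup p w) (word_poly H \<alpha> w f))"

context hopf_scalars
begin

text \<open>Both sums run over the same chosen representative of the coproduct, and
  \<open>\<kappa>\<close> is a ring homomorphism.\<close>

lemma S_transfer: "S (\<lambda>a b. \<kappa> (F a b)) h = \<kappa> (sweedler H (scalars.RR id) F h)"
proof -
  interpret I: hopf_scalars id H by (rule hopf_id)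
  show ?thesis by (simp add: S_eq I.S_eq tl_eq I.tl_eq lc_def I.lc_def scal_sum)
qed

lemma conv2_transfer:
  "conv2 (\<lambda>x y. \<kappa> (F x y)) (\<lambda>x y. \<kappa> (G x y)) x y = \<kappa> (hopf_scalars.conv2 id H F G x y)"
proof -
  interpret I: hopf_scalars id H by (rule hopf_id)
  show ?thesis by (simp add: conv2_def I.conv2_def scal_mult[symmetric] S_transfer del: scal_mult)
qed

lemma linfun_ev: "linfun free_alg (ev l)"
  by (simp add: linfun_def)

lemma ev_sweedler: "ev l (sweedler H free_alg F h) = S (\<lambda>a b. ev l (F a b)) h"
  by (rule linfun_sweedler(2)[OF kalgD(2)[OF kalg_free_alg] _ linfun_ev]) simp

end

context cocycle_twist
begin

context
  fixes \<alpha> :: "'h \<Rightarrow> 'h \<Rightarrow> 'k"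
  assumes \<tau>: "\<tau> = (\<lambda>x y. \<kappa> (\<alpha> x y))" and \<alpha>: "hopf_scalars.bilin id H \<alpha>"
begin

text \<open>The recursion of \<open>word_poly\<close> is the pairing formula for left multiplication
  by the image of a generator. The kernel of the product has scalar values up to
  \<open>\<kappa>\<close>, so the functional stays scalar along the recursion.\<close>

lemma ev_word_poly:
  assumes l: "lin l" "\<And>h. l h \<in> R"
  shows "scalars.linfun id HA f \<Longrightarrow> ev l (word_poly H \<alpha> w f) = pair (word TA (mu_gen l) w) (\<lambda>h. \<kappa> (f h))"
proof (induction w arbitrary: f)
  interpret I: hopf_scalars id H by (rule hopf_id)
  have lf: "lin (\<lambda>h. \<kappa> (f h))" if "I.lin f" for f using that by (simp add: lin_iff I.lin_iff)
  note wc = word_carrier[OF kalg_TA, of "mu_gen l", simplified, OF mu_gen_carrier[OF l]]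
  {
    case Nil
    show ?case using pair_ten[OF lf[OF Nil], of 1 1] by (simp add: word_def)
  next
    case (Cons v w)
    let ?F = "\<lambda>h. \<kappa> (f h)" and ?k = "I.conv2 \<alpha> (\<lambda>x y. f (x * y))"
    have k: "conv2 \<tau> (\<lambda>x y. ?F (x * y)) b = (\<lambda>y. \<kappa> (?k b y))" for b
      unfolding \<tau> by (rule ext) (rule conv2_transfer)
    have kl: "I.lin (?k b)" for b
      by (rule I.bilinD(2)[OF I.bilin_conv2[OF \<alpha> I.bilin_mult[OF Cons.prems]]])
    have lp: "lin (\<lambda>x. pair (word TA (mu_gen l) w) (conv2 \<tau> (\<lambda>x y. ?F (x * y)) x))"
      by (rule lin_pair) (rule lin_mult_kernel[OF lf[OF Cons.prems]])
    have "word TA (mu_gen l) (v # w) = mu_gen l v \<otimes>\<^bsub>TA\<^esub> word TA (mu_gen l) w" by (simp add: word_def)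
    then have "pair (word TA (mu_gen l) (v # w)) ?F
        = conv l (\<lambda>x. pair (word TA (mu_gen l) w) (conv2 \<tau> (\<lambda>x y. ?F (x * y)) x)) v"
      by (simp add: pair_TA_mult mu_gen_carrier[OF l] wc lf[OF Cons.prems] pair_mu_gen[OF l lp])
    also have "\<dots> = S (\<lambda>a b. ev l (free_gen a * word_poly H \<alpha> w (?k b))) v"
      by (simp add: conv_def k Cons.IH[OF kl])
    also have "\<dots> = ev l (word_poly H \<alpha> (v # w) f)" by (simp only: ev_sweedler word_poly.simps)
    finally show ?case ..
  }
qed

lemma ev_coord_poly:
  assumes l: "lin l" "\<And>h. l h \<in> R" and f: "scalars.linfun id HA f"
  shows "ev l (coord_poly H \<alpha> p f) = pair (mu l (linearity_ideal (hscale H) +>\<^bsub>free_alg\<^esub> p)) (\<lambda>h. \<kappa> (f h))"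
proof -
  interpret I: hopf_scalars id H by (rule hopf_id)
  have lf: "lin (\<lambda>h. \<kappa> (f h))" using f by (simp add: lin_iff I.lin_iff)
  note wc = word_carrier[OF kalg_TA, of "mu_gen l", simplified, OF mu_gen_carrier[OF l]]
  have "pair (free_ext TA (mu_gen l) p) (\<lambda>h. \<kappa> (f h)) = (\<Sum>w\<in>Poly_Mapping.keys p.
      pair (Poly_Mapping.lookup p w \<odot>\<^bsub>TA\<^esub> word TA (mu_gen l) w) (\<lambda>h. \<kappa> (f h)))"
    unfolding free_ext_def using wc linfun_pair[OF lf]
    by (intro linfun_finsum[OF kspace_TA, of "\<lambda>P. pair P (\<lambda>h. \<kappa> (f h))"]) (auto simp: linfun_TA)
  then show ?thesis
    by (simp add: mu_class[OF l] coord_poly_def ev_sum ev_word_poly[OF l f] wc lf)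
qed

end

end

subsection \<open>Finite-dimensional coideals and convolution inverses\<close>

context hopf_scalars
begin

abbreviation "klin \<equiv> scalars.linfun id HA"

lemma klin_iff: "klin m \<longleftrightarrow> Vector_Spaces.linear (hscale H) (*) m"
proof -
  interpret I: hopf_scalars id H by (rule hopf_id)
  show ?thesis using vs_H vector_space_mult by (auto simp: I.lin_iff Vector_Spaces.linear_iff)
qed

lemma klin_counit: "klin (counit H)"
proof -
  interpret I: hopf_scalars id H by (rule hopf_id)
  show ?thesis by (simp add: I.lin_iff)
qed

text \<open>Evaluates the first leg of the coproduct; with a coordinate form this produces the
  matrix coefficients of a coideal.\<close>

definition contract :: "('h \<Rightarrow> 'k) \<Rightarrow> 'h \<Rightarrow> 'h" where
  "contract m v = sweedler H HA (\<lambda>a b. hscale H (m a) b) v"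

text \<open>The left action of the dual convolution algebra on \<open>H\<close>, which evaluates the
  second leg. Its invariant subspaces are the right coideals.\<close>

definition act :: "('h \<Rightarrow> 'k) \<Rightarrow> 'h \<Rightarrow> 'h" where
  "act m v = sweedler H HA (\<lambda>a b. hscale H (m b) a) v"

lemma lin_contract: "lin f \<Longrightarrow> f (contract m v) = S (\<lambda>a b. \<kappa> (m a) * f b) v"
  and lin_act: "lin f \<Longrightarrow> f (act m v) = S (\<lambda>a b. \<kappa> (m b) * f a) v"
  unfolding contract_def act_def
  by (subst linfun_sweedler(2)[OF kspace_HA]; simp add: linD)+

text \<open>The condition on \<open>B\<close> says that the span \<open>V\<close> of \<open>B\<close> satisfies \<open>\<Delta> V \<subseteq> V \<otimes> H\<close>.\<close>

definition coideal :: "'h set \<Rightarrow> bool" where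
  "coideal B \<longleftrightarrow> finite B \<and> (\<forall>b\<in>B. \<forall>m. klin m \<longrightarrow> act m b \<in> Modules.module.span (hscale H) B)"

end

text \<open>The coefficients now lie in a field, where a matrix with nonzero determinant is
  invertible.\<close>

locale hopf_vs = hopf_scalars \<kappa> H + vector_space "hscale H"
  for \<kappa> :: "'k::field \<Rightarrow> 'r::field" and H :: "('k, 'h::ring_1) hopf_data"
begin

sublocale I: hopf_scalars id H by (rule hopf_id)

lemma lin_klin: "klin m \<Longrightarrow> lin (\<lambda>x. \<kappa> (m x))"
  by (simp add: lin_iff I.lin_iff)

lemma act_klin: "klin l \<Longrightarrow> l (act m v) = I.S (\<lambda>a b. m b * l a) v"
  using I.lin_act[of l m v] by (simp add: act_def I.act_def)

lemma contract_klin: "klin l \<Longrightarrow> l (contract m v) = I.S (\<lambda>a b. m a * l b) v"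
  using I.lin_contract[of l m v] by (simp add: contract_def I.contract_def)

abbreviation "bs \<equiv> extend_basis {}"
abbreviation "coord \<equiv> representation bs"

lemma coord_extend:
  assumes "independent B"
  shows "klin (\<lambda>x. representation (extend_basis B) x e)"
  unfolding klin_iff Vector_Spaces.linear_iff
  using independent_extend_basis[OF assms] span_extend_basis[OF assms] vs_H vector_space_mult
  by (auto simp: representation_add representation_scale)

lemma H_eqI:
  assumes "\<And>l. klin l \<Longrightarrow> l x = l y"
  shows "x = y"
proof -
  have i: "independent bs" "span bs = UNIV"
    using independent_extend_basis[of "{}"] span_extend_basis[of "{}"] by (simp_all add: independent_empty)
  have "coord x = coord y" using assms[OF coord_extend[of "{}"]] by (auto simp: independent_empty fun_eq_iff)
  have sn: "(\<Sum>b | coord z b \<noteq> 0. hscale H (coord z b) b) = z" for z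
    by (rule sum_nonzero_representation_eq[OF i(1)]) (simp add: i(2))
  show ?thesis using sn[of x] sn[of y] unfolding \<open>coord x = coord y\<close> by (rule trans[OF sym])
qed

text \<open>Coassociativity: both sides evaluate \<open>m'\<close> on the second and
  \<open>m\<close> on the third leg.\<close>

lemma act_act:
  assumes "klin m" "klin m'"
  shows "act m' (act m h) = act (I.conv m' m) h"
proof (rule H_eqI)
  fix l assume l: "klin l"
  have k: "klin (\<lambda>x. I.S (\<lambda>a b. m' b * l a) x)"
    by (rule I.lin_S_arg) (intro I.lin_intros assms l)+
  have "l (act m' (act m h)) = I.S (\<lambda>x y. I.S (\<lambda>a b. m y * (m' b * l a)) x) h"
    by (simp add: act_klin[OF l] act_klin[OF k] I.S_mult_left)
  also have "\<dots> = I.S (\<lambda>a u. I.S (\<lambda>b y. m y * (m' b * l a)) u) h"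
    by (rule I.S_coassoc) (intro I.lin_intros assms l)+
  also have "\<dots> = l (act (I.conv m' m) h)"
    unfolding act_klin[OF l] I.conv_def I.S_mult_right[symmetric] by (simp add: mult_ac)
  finally show "l (act m' (act m h)) = l (act (I.conv m' m) h)" .
qed

lemma act_counit: "act (counit H) h = h"
  by (rule H_eqI) (use I.S_counit_right in \<open>simp add: act_klin mult.commute\<close>)

lemma act_add: "act m (x + y) = act m x + act m y" if "klin m"
  by (rule H_eqI) (simp add: act_klin I.linD I.linD[OF I.lin_S_arg] I.lin_mult_r I.lin_mult_l that)

lemma act_scale: "act m (hscale H c x) = hscale H c (act m x)" if "klin m"
  by (rule H_eqI) (simp add: act_klin I.linD I.linD[OF I.lin_S_arg] I.lin_mult_r I.lin_mult_l that)

lemma coideal_act_span: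
  assumes "coideal B" "klin m" "v \<in> span B"
  shows "act m v \<in> span B"
  using assms(3)
proof (induction rule: span_induct_alt)
  case base
  then show ?case using act_scale[OF assms(2), of 0 0] by (simp add: span_zero)
next
  case (step c x y)
  then show ?case using assms
    by (simp add: act_add act_scale span_add span_scale coideal_def)
qed

text \<open>The orbit of \<open>h\<close> under the dual algebra is spanned by the finitely many
  first legs of one representative of its coproduct. It is invariant by \<open>act_act\<close> and
  contains \<open>h\<close> because the counit acts as the identity.\<close>

lemma coideal_exists: "\<exists>B. coideal B \<and> h \<in> span B"
proof -
  define V where "V = {act m h | m. klin m}"
  define p where "p = (SOME p. p \<in> comul H h)"
  have act_eq: "act m h = (\<Sum>a\<in>Poly_Mapping.keys p. hscale H (Poly_Mapping.lookup p a) (hscale H (m (snd a)) (fst a)))" for m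
    by (simp add: act_def sweedler_def tlift_def formal_sum_def hopf_alg_def finsum_alg_of p_def)
  have Vsub: "V \<subseteq> span (fst ` Poly_Mapping.keys p)"
  proof
    fix x assume "x \<in> V"
    then obtain m where "x = act m h" by (auto simp: V_def)
    then show "x \<in> span (fst ` Poly_Mapping.keys p)"
      unfolding act_eq by (simp only:) (intro span_sum span_scale span_base imageI)
  qed
  have act_m: "act (\<lambda>x. m x + m' x) h = act m h + act m' h" "act (\<lambda>x. c * m x) h = hscale H c (act m h)" for m m' c
    by (simp_all add: act_eq scale_left_distrib scale_right_distrib sum.distrib scale_sum_right mult_ac)
  have sub: "subspace V"
  proof (rule subspaceI)
    show "0 \<in> V" using I.lin_mult_l[OF klin_counit, of 0] act_m(2)[of 0 "counit H"] by (force simp: V_def)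
    show "x + y \<in> V" if "x \<in> V" "y \<in> V" for x y
      using that act_m(1)[symmetric] I.lin_add by (fastforce simp: V_def)
    show "hscale H c x \<in> V" if "x \<in> V" for x c
      using that act_m(2)[symmetric] I.lin_mult_l by (fastforce simp: V_def)
  qed
  obtain B where B: "B \<subseteq> V" "independent B" "V \<subseteq> span B"
    using maximal_independent_subset by auto
  have sp: "span B = V" using B span_minimal[OF B(1) sub] by blast
  have "finite B"
    using independent_span_bound[of "fst ` Poly_Mapping.keys p" B] B Vsub by auto
  moreover have "act m b \<in> span B" if b: "b \<in> B" and m: "klin m" for b m
  proof -
    obtain m' where m': "b = act m' h" "klin m'" using b B(1) unfolding V_def by blast
    then show ?thesis using act_act[OF m'(2) m] I.lin_conv[OF m m'(2)] by (auto simp: sp V_def)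
  qed
  moreover have "h \<in> span B" using act_counit[of h] klin_counit by (force simp: sp V_def)
  ultimately show ?thesis by (auto simp: coideal_def)
qed

lemma coideal_independent:
  assumes "coideal B"
  shows "\<exists>B'. coideal B' \<and> independent B' \<and> span B' = span B"
proof -
  obtain B' where B': "B' \<subseteq> B" "independent B'" "B \<subseteq> span B'"
    using maximal_independent_subset by auto
  have sp: "span B' = span B"
    using span_mono[OF B'(1)] span_minimal[OF B'(3) subspace_span] by blast
  have "coideal B'" using assms B'(1) finite_subset unfolding coideal_def sp by blast
  then show ?thesis using B' sp by blast
qed

lemma coideal_Un: "coideal B \<Longrightarrow> coideal C \<Longrightarrow> coideal (B \<union> C)"
  using span_mono[of B "B \<union> C"] span_mono[of C "B \<union> C"] by (auto simp: coideal_def)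

context
  fixes B assumes B: "coideal B" "independent B"
begin

text \<open>The matrix with \<open>\<Delta> b = \<Sum> b' \<otimes> cm b' b\<close> for \<open>b \<in> B\<close>.\<close>

definition "cm b' b = contract (\<lambda>x. representation (extend_basis B) x b') b"

lemma finB: "finite B" using B by (simp add: coideal_def)

lemma lin_cm: "lin f \<Longrightarrow> f (cm b' b) = S (\<lambda>x y. \<kappa> (representation (extend_basis B) x b') * f y) b"
  by (simp add: cm_def lin_contract)

text \<open>First legs are expanded in a basis that extends \<open>B\<close>; the terms outside
  \<open>B\<close> vanish because the coproduct of \<open>b\<close> has its first legs in the span
  of \<open>B\<close>.\<close>

lemma S_expand:
  assumes F: "\<And>y. lin (\<lambda>x. F x y)" "\<And>x. lin (\<lambda>y. F x y)" and b: "b \<in> B"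
  shows "S F b = (\<Sum>b'\<in>B. F b' (cm b' b))"
proof -
  let ?E = "extend_basis B"
  let ?r = "representation ?E"
  have E: "independent ?E" "span ?E = UNIV" "B \<subseteq> ?E"
    using independent_extend_basis[OF B(2)] span_extend_basis[OF B(2)] extend_basis_superset[OF B(2)] by auto
  define p where "p = (SOME p. p \<in> comul H b)"
  define E0 where "E0 = B \<union> (\<Union>a\<in>Poly_Mapping.keys p. {e. ?r (fst a) e \<noteq> 0})"
  have finE0: "finite E0" unfolding E0_def using finB by (auto intro: finite_representation)
  have S: "S G b = lc (\<lambda>a. G (fst a) (snd a)) p" for G by (simp add: S_eq tl_eq p_def)
  have Fsum: "F (\<Sum>e\<in>A. hscale H (c e) e) y = (\<Sum>e\<in>A. \<kappa> (c e) * F e y)" for A c y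
    using linD(2)[OF F(1), of 0 0 y] by (induction A rule: infinite_finite_induct) (simp_all add: linD[OF F(1)])
  have "S F b = lc (\<lambda>a. \<Sum>e\<in>E0. \<kappa> (?r (fst a) e) * F e (snd a)) p"
    unfolding S
  proof (rule lc_cong)
    fix a assume a: "a \<in> Poly_Mapping.keys p"
    have "fst a = (\<Sum>e | ?r (fst a) e \<noteq> 0. hscale H (?r (fst a) e) e)"
      using sum_nonzero_representation_eq[OF E(1), of "fst a"] E(2) by simp
    also have "\<dots> = (\<Sum>e\<in>E0. hscale H (?r (fst a) e) e)"
      using finE0 a by (intro sum.mono_neutral_left) (auto simp: E0_def)
    finally have eq: "fst a = (\<Sum>e\<in>E0. hscale H (?r (fst a) e) e)" .
    show "F (fst a) (snd a) = (\<Sum>e\<in>E0. \<kappa> (?r (fst a) e) * F e (snd a))"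
      by (subst eq) (rule Fsum)
  qed
  also have "\<dots> = (\<Sum>e\<in>E0. S (\<lambda>x y. \<kappa> (?r x e) * F e y) b)"
    unfolding S lc_def sum_distrib_left by (rule sum.swap)
  also have "\<dots> = (\<Sum>e\<in>E0. F e (cm e b))"
    by (simp add: lin_cm[OF F(2)])
  also have "\<dots> = (\<Sum>e\<in>B. F e (cm e b))"
  proof (rule sum.mono_neutral_right[OF finE0])
    show "B \<subseteq> E0" by (simp add: E0_def)
    show "\<forall>e\<in>E0 - B. F e (cm e b) = 0"
    proof
      fix e assume e: "e \<in> E0 - B"
      have "cm e b = 0"
      proof (rule H_eqI)
        fix l assume l: "klin l"
        have re: "klin (\<lambda>x. ?r x e)" by (rule coord_extend[OF B(2)])
        \<comment> \<open>Both sides evaluate the coordinate at \<open>e\<close> on the first leg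
          and \<open>l\<close> on the second. Since \<open>act l b\<close> lies in the span of
          \<open>B\<close>, its coordinate at \<open>e\<close> is zero.\<close>
        have "l (cm e b) = ?r (act l b) e"
          by (simp add: cm_def contract_klin[OF l] act_klin[OF re] mult.commute)
        also have "\<dots> = representation B (act l b) e"
          using representation_extend[OF E(1) _ E(3), of "act l b"] coideal_act_span[OF B(1) l span_base[OF b]] by simp
        also have "\<dots> = 0" using e representation_ne_zero[of B "act l b" e] by auto
        finally show "l (cm e b) = l 0" using I.linD(2)[OF l, of 0 0] by simp
      qed
      then show "F e (cm e b) = 0" using linD(2)[OF F(2), of e 0 0] by simp
    qed
  qed
  finally show ?thesis .
qed

lemma coord_basis: "b \<in> B \<Longrightarrow> representation (extend_basis B) b b' = (if b' = b then 1 else 0)"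
  using representation_basis[OF independent_extend_basis[OF B(2)], of b] extend_basis_superset[OF B(2)] by auto

lemma counit_cm: "b \<in> B \<Longrightarrow> b' \<in> B \<Longrightarrow> counit H (cm b' b) = (if b' = b then 1 else 0)"
  using contract_klin[OF klin_counit, of "\<lambda>x. representation (extend_basis B) x b'" b]
    I.S_counit_right[OF coord_extend[OF B(2)], of b' b] coord_basis[of b b'] by (simp add: cm_def)

text \<open>Coassociativity read off in the basis. On the entries of \<open>cm\<close> a convolution
  product therefore becomes a product of matrices.\<close>

lemma S_cm:
  assumes F: "\<And>y. lin (\<lambda>x. F x y)" "\<And>x. lin (\<lambda>y. F x y)" and b': "b' \<in> B"
  shows "S F (cm b b') = (\<Sum>k\<in>B. F (cm b k) (cm k b'))"
proof -
  let ?r = "\<lambda>x. \<kappa> (representation (extend_basis B) x b)"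
  note li = lin_intros F lin_klin[OF coord_extend[OF B(2)]]
  have "S F (cm b b') = S (\<lambda>x u. S (\<lambda>y z. ?r x * F y z) u) b'"
    by (simp add: lin_cm[OF lin_S_arg[OF F]] S_mult_left)
  also have "\<dots> = S (\<lambda>u z. S (\<lambda>x y. ?r x * F y z) u) b'"
    by (rule S_coassoc[symmetric]) (intro li)+
  also have "\<dots> = (\<Sum>k\<in>B. S (\<lambda>x y. ?r x * F y (cm k b')) k)"
    by (rule S_expand[OF _ _ b']) (intro li)+
  also have "\<dots> = (\<Sum>k\<in>B. F (cm b k) (cm k b'))"
    by (simp add: lin_cm[OF F(1)])
  finally show ?thesis .
qed

text \<open>The determinant of the matrix \<open>t (cm b b')\<close> is the value at \<open>t\<close> of a polynomial that takes the value
  \<open>1\<close> at the counit.\<close>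

lemma comatrix_inverse:
  fixes t :: "'h \<Rightarrow> 'r"
  assumes gen: "\<And>p. ev t p = 0 \<Longrightarrow> I.ev (counit H) p = 0"
  shows "\<exists>N. \<forall>b\<in>B. \<forall>b'\<in>B. (\<Sum>k\<in>B. t (cm b k) * N k b') = (if b = b' then 1 else 0) \<and>
    (\<Sum>k\<in>B. N b k * t (cm k b')) = (if b = b' then 1 else 0)"
proof -
  obtain e n where e: "bij_betw e {0..<n::nat} B" using finB ex_bij_betw_nat_finite by blast
  define w where "w \<pi> = map (\<lambda>i. cm (e i) (e (\<pi> i))) [0..<n]" for \<pi>
  \<comment> \<open>The determinant of the matrix of symbols. The order of factors in a word is
    immaterial, because it is only evaluated in commutative rings.\<close>
  define D :: "'h list \<Rightarrow>\<^sub>0 'k" where "D = (\<Sum>\<pi> | \<pi> permutes {0..<n}. Poly_Mapping.single (w \<pi>) (of_int (sign \<pi>)))"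
  have eB: "e i \<in> B" if "i < n" for i using e that by (auto simp: bij_betw_def)
  have einj: "e i = e j \<longleftrightarrow> i = j" if "i < n" "j < n" for i j
    using e that by (auto simp: bij_betw_def inj_on_def)
  have ev_single: "ev l (Poly_Mapping.single w c) = \<kappa> c * prod_list (map l w)" for l w c
    using free_ext_single[OF kalg_RR, of l w c] by (simp add: word_RR)
  have evI_single: "I.ev l (Poly_Mapping.single w c) = c * prod_list (map l w)" for l w c
    using free_ext_single[OF I.kalg_RR, of l w c] by (simp add: I.word_RR)
  have pl: "prod_list (map g [0..<n]) = (\<Prod>i=0..<n. g i)" for g :: "nat \<Rightarrow> 'c::comm_monoid_mult"
    by (induction n) (simp_all add: mult.commute)
  have kint: "\<kappa> (of_int (sign \<pi>)) = of_int (sign \<pi>)" for \<pi> :: "nat \<Rightarrow> nat"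
    by (simp add: sign_def)
  have evt: "ev t D = leibniz n (\<lambda>i j. t (cm (e i) (e j)))"
    by (simp add: D_def ev_sum ev_single leibniz_def w_def o_def pl kint)
  have "I.ev (counit H) D = leibniz n (\<lambda>i j. counit H (cm (e i) (e j)))"
    by (simp add: D_def I.ev_sum evI_single leibniz_def w_def o_def pl)
  also have "\<dots> = leibniz n (\<lambda>i j. if i = j then 1 else 0)"
    unfolding leibniz_def
  proof (intro sum.cong refl arg_cong2[where f = "(*)"] prod.cong)
    fix \<pi> i assume "\<pi> \<in> {\<pi>. \<pi> permutes {0..<n}}" "i \<in> {0..<n}"
    then have "i < n" "\<pi> i < n" using permutes_in_image[of \<pi> "{0..<n}" i] by auto
    then show "counit H (cm (e i) (e (\<pi> i))) = (if i = \<pi> i then 1 else 0)"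
      by (simp add: counit_cm eB einj)
  qed
  also have "\<dots> = 1" by (rule leibniz_identity)
  \<comment> \<open>If the determinant vanished at \<open>t\<close>, then \<open>gen\<close> would
    make it vanish at the counit as well, where it is 1.\<close>
  finally have "ev t D \<noteq> 0" using gen[of D] by auto
  then obtain N where N: "\<forall>i<n. \<forall>j<n. (\<Sum>k=0..<n. t (cm (e i) (e k)) * N k j) = (if i = j then 1 else 0) \<and>
    (\<Sum>k=0..<n. N i k * t (cm (e k) (e j))) = (if i = j then 1 else 0)"
    using inverse_matrix_exists[of n "\<lambda>i j. t (cm (e i) (e j))"] by (auto simp: evt)
  define e' where "e' = the_inv_into {0..<n} e"
  have e'e: "e' (e i) = i" if "i < n" for i
    unfolding e'_def using e that by (intro the_inv_into_f_f) (auto simp: bij_betw_def)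
  have e': "e' b < n" "e (e' b) = b" if "b \<in> B" for b
  proof -
    obtain i where "i < n" "b = e i" using e \<open>b \<in> B\<close> by (auto simp: bij_betw_def)
    then show "e' b < n" "e (e' b) = b" by (simp_all add: e'e)
  qed
  have sumB: "(\<Sum>k\<in>B. g k) = (\<Sum>k=0..<n. g (e k))" for g :: "'h \<Rightarrow> 'r"
    using sum.reindex_bij_betw[OF e, of g] by simp
  have "(\<Sum>k\<in>B. t (cm b k) * N (e' k) (e' b')) = (if b = b' then 1 else 0) \<and>
    (\<Sum>k\<in>B. N (e' b) (e' k) * t (cm k b')) = (if b = b' then 1 else 0)" if "b \<in> B" "b' \<in> B" for b b'
  proof -
    have "e' b = e' b' \<longleftrightarrow> b = b'" using e'(2)[OF that(1)] e'(2)[OF that(2)] by metis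
    moreover have "(\<Sum>k\<in>B. t (cm b k) * N (e' k) (e' b')) = (\<Sum>k=0..<n. t (cm (e (e' b)) (e k)) * N k (e' b'))"
      unfolding sumB using that by (intro sum.cong) (simp_all add: e'e e')
    moreover have "(\<Sum>k\<in>B. N (e' b) (e' k) * t (cm k b')) = (\<Sum>k=0..<n. N (e' b) k * t (cm (e k) (e (e' b'))))"
      unfolding sumB using that by (intro sum.cong) (simp_all add: e'e e')
    ultimately show ?thesis using N e'(1)[OF that(1)] e'(1)[OF that(2)] by simp
  qed
  then show ?thesis by (intro exI[of _ "\<lambda>b b'. N (e' b) (e' b')"]) blast
qed

end

lemma lin_eq_on_span:
  assumes "lin f" "lin g" "\<And>b. b \<in> B \<Longrightarrow> f b = g b" "v \<in> span B"
  shows "f v = g v"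
  using assms(4)
  by (induction rule: span_induct_alt)
    (use linD(2)[OF assms(1), of 0 0] linD(2)[OF assms(2), of 0 0] in
      \<open>simp_all add: linD[OF assms(1)] linD[OF assms(2)] assms(3)\<close>)

text \<open>On the span of a coideal, a left inverse amounts to one vector equation with an
  invertible matrix, hence exists and is unique there. Local solutions agree on overlaps and glue to
  a left inverse on \<open>H\<close>. It is also a right inverse, because this holds for the
  matrices.\<close>

theorem convolution_inverse_exists:
  fixes t :: "'h \<Rightarrow> 'r"
  assumes t: "lin t" and gen: "\<And>p. ev t p = 0 \<Longrightarrow> I.ev (counit H) p = 0"
  shows "\<exists>g. lin g \<and> conv g t = eps \<and> conv t g = eps"
proof -
  note eps = lin_counit
  have conv_B: "conv g t b = (\<Sum>b'\<in>B. g b' * t (cm B b' b))"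
    if "coideal B" "independent B" "lin g" "b \<in> B" for g b B
    unfolding conv_def by (rule S_expand[OF that(1,2) _ _ that(4)]) (intro lin_intros t that)+
  have ex: "\<exists>g. lin g \<and> (\<forall>v\<in>span B. conv g t v = eps v)" if B: "coideal B" for B
  proof -
    obtain C where C: "coideal C" "independent C" and sp: "span C = span B"
      using coideal_independent[OF B] by auto
    obtain N where N: "\<And>b b'. b \<in> C \<Longrightarrow> b' \<in> C \<Longrightarrow> (\<Sum>k\<in>C. N b k * t (cm C k b')) = (if b = b' then 1 else 0)"
      using comatrix_inverse[OF C gen] by blast
    \<comment> \<open>On \<open>C\<close> the equation says that the row of values of
      \<open>g\<close> times the matrix of \<open>t\<close> is the row of values of the counit; the
      solution is that row times \<open>N\<close>, extended by zero along the remaining basis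
      vectors.\<close>
    define g where "g h = (\<Sum>b\<in>C. \<kappa> (representation (extend_basis C) h b) * (\<Sum>k\<in>C. eps k * N k b))" for h
    have finC: "finite C" using C(1) by (simp add: coideal_def)
    have lg: "lin g"
      unfolding lin_iff g_def sum_distrib_left sum.distrib[symmetric]
      using lin_klin[OF coord_extend[OF C(2)]] by (simp add: lin_iff algebra_simps sum.distrib sum_distrib_left)
    have gC: "g b = (\<Sum>k\<in>C. eps k * N k b)" if "b \<in> C" for b
    proof -
      have "g b = (\<Sum>b'\<in>C. if b' = b then (\<Sum>k\<in>C. eps k * N k b') else 0)"
        unfolding g_def by (rule sum.cong) (simp_all add: coord_basis[OF C that])
      then show ?thesis using finC that by (simp add: sum.delta)
    qed
    have "conv g t b = eps b" if "b \<in> C" for b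
    proof -
      have "conv g t b = (\<Sum>b'\<in>C. (\<Sum>k\<in>C. eps k * N k b') * t (cm C b' b))"
        using that by (simp add: conv_B[OF C lg] gC)
      also have "\<dots> = (\<Sum>k\<in>C. eps k * (\<Sum>b'\<in>C. N k b' * t (cm C b' b)))"
        unfolding sum_distrib_left sum_distrib_right by (subst sum.swap) (simp add: mult.assoc)
      also have "\<dots> = (\<Sum>k\<in>C. if k = b then eps k else 0)"
        using that by (intro sum.cong) (simp_all add: N)
      finally show ?thesis using finC that by (simp add: sum.delta)
    qed
    then have "\<forall>v\<in>span C. conv g t v = eps v"
      using lin_eq_on_span[OF lin_conv[OF lg t] eps] by blast
    then show ?thesis using lg sp by auto
  qed
  \<comment> \<open>Multiplication by the right inverse matrix recovers the values of
    \<open>g\<close> on a basis from those of \<open>conv g t\<close>.\<close>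
  have un: "g v = g' v" if B: "coideal B" and g: "lin g" "lin g'"
    and eq: "\<And>v. v \<in> span B \<Longrightarrow> conv g t v = conv g' t v" and v: "v \<in> span B" for B g g' v
  proof -
    obtain C where C: "coideal C" "independent C" and sp: "span C = span B"
      using coideal_independent[OF B] by auto
    obtain N where N: "\<And>b b'. b \<in> C \<Longrightarrow> b' \<in> C \<Longrightarrow> (\<Sum>k\<in>C. t (cm C b k) * N k b') = (if b = b' then 1 else 0)"
      using comatrix_inverse[OF C gen] by blast
    have finC: "finite C" using C(1) by (simp add: coideal_def)
    have rec: "f b = (\<Sum>k\<in>C. conv f t k * N k b)" if "lin f" "b \<in> C" for f b
    proof -
      have "(\<Sum>k\<in>C. conv f t k * N k b) = (\<Sum>k\<in>C. (\<Sum>b'\<in>C. f b' * t (cm C b' k)) * N k b)"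
        by (simp add: conv_B[OF C that(1)])
      also have "\<dots> = (\<Sum>b'\<in>C. f b' * (\<Sum>k\<in>C. t (cm C b' k) * N k b))"
        unfolding sum_distrib_left sum_distrib_right by (subst sum.swap) (simp add: mult.assoc)
      also have "\<dots> = (\<Sum>b'\<in>C. if b' = b then f b' else 0)"
        using that by (intro sum.cong) (simp_all add: N)
      finally show ?thesis using finC that by (simp add: sum.delta)
    qed
    have "g b = g' b" if "b \<in> C" for b
      using rec[OF g(1) that] rec[OF g(2) that] eq span_base[of _ C] by (simp add: sp)
    then show ?thesis using lin_eq_on_span[OF g, of C v] v sp by simp
  qed
  define good where "good B g \<longleftrightarrow> coideal B \<and> lin g \<and> (\<forall>v\<in>span B. conv g t v = eps v)" for B g
  have "\<forall>h. \<exists>z. \<exists>B g. good B g \<and> h \<in> span B \<and> z = g h"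
    using coideal_exists ex unfolding good_def by metis
  then have "\<exists>G. \<forall>h. \<exists>B g. good B g \<and> h \<in> span B \<and> G h = g h" by (rule choice)
  then obtain G where G: "\<And>h. \<exists>B g. good B g \<and> h \<in> span B \<and> G h = g h" by blast
  \<comment> \<open>Two local solutions are both compared with one on the union of the two
    coideals.\<close>
  have Geq: "G h = g h" if gd: "good B g" "h \<in> span B" for B g h
  proof -
    obtain B' g' where g': "good B' g'" "h \<in> span B'" "G h = g' h" using G by blast
    have co: "coideal (B \<union> B')" using gd g' by (auto simp: good_def intro: coideal_Un)
    obtain g2 where g2: "lin g2" "\<And>v. v \<in> span (B \<union> B') \<Longrightarrow> conv g2 t v = eps v" using ex[OF co] by blast
    have "g h = g2 h"
      by (rule un[of B]) (use gd g2 subsetD[OF span_mono[of B "B \<union> B'"]] in \<open>simp_all add: good_def\<close>)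
    moreover have "g' h = g2 h"
      by (rule un[of B']) (use g' g2 subsetD[OF span_mono[of B' "B \<union> B'"]] in \<open>simp_all add: good_def\<close>)
    ultimately show ?thesis using g'(3) by simp
  qed
  have lG: "lin G"
    unfolding lin_iff
  proof (intro conjI allI)
    fix x y
    obtain B C where B: "coideal B" "x \<in> span B" and C: "coideal C" "y \<in> span C" using coideal_exists by metis
    have "coideal (B \<union> C)" using B C by (intro coideal_Un)
    then obtain g where g: "good (B \<union> C) g" using ex by (auto simp: good_def)
    have "x \<in> span (B \<union> C)" "y \<in> span (B \<union> C)"
      using B(2) C(2) span_mono[of B "B \<union> C"] span_mono[of C "B \<union> C"] by auto
    then show "G (x + y) = G x + G y"
      using Geq[OF g] g by (simp add: span_add good_def linD)
  next
    fix c x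
    obtain B where B: "coideal B" "x \<in> span B" using coideal_exists by metis
    obtain g where g: "good B g" using ex[OF B(1)] B(1) by (auto simp: good_def)
    show "G (hscale H c x) = \<kappa> c * G x"
      using Geq[OF g] g B(2) by (simp add: span_scale good_def linD)
  qed
  have left: "conv G t h = eps h" for h
  proof -
    obtain B0 where "coideal B0" "h \<in> span B0" using coideal_exists by blast
    then obtain B where B: "coideal B" "independent B" "h \<in> span B" using coideal_independent by blast
    obtain g where g: "good B g" using ex[OF B(1)] B(1) by (auto simp: good_def)
    have "conv G t b = eps b" if "b \<in> B" for b
    proof -
      have "conv G t b = conv g t b"
        using g that Geq[OF g span_base] by (simp add: conv_B[OF B(1,2)] lG good_def)
      then show ?thesis using g span_base[OF that] by (simp add: good_def)
    qed
    then show ?thesis using lin_eq_on_span[OF lin_conv[OF lG t] eps _ B(3)] by blast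
  qed
  have right: "conv t G h = eps h" for h
  proof -
    obtain B0 where "coideal B0" "h \<in> span B0" using coideal_exists by blast
    then obtain B where B: "coideal B" "independent B" "h \<in> span B" using coideal_independent by blast
    have finB: "finite B" using B(1) by (simp add: coideal_def)
    obtain N where N: "\<And>b b'. b \<in> B \<Longrightarrow> b' \<in> B \<Longrightarrow> (\<Sum>k\<in>B. t (cm B b k) * N k b') = (if b = b' then 1 else 0)"
      using comatrix_inverse[OF B(1,2) gen] by blast
    have GM: "(\<Sum>k\<in>B. G (cm B b k) * t (cm B k b')) = (if b = b' then 1 else 0)" if "b \<in> B" "b' \<in> B" for b b'
    proof -
      have "(\<Sum>k\<in>B. G (cm B b k) * t (cm B k b')) = conv G t (cm B b b')"
        unfolding conv_def by (rule S_cm[OF B(1,2) _ _ that(2), symmetric]) (intro lin_intros t lG)+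
      then show ?thesis using that by (simp add: left counit_cm[OF B(1,2)])
    qed
    \<comment> \<open>The entries of \<open>G\<close> form a left inverse and \<open>N\<close> a
      right inverse of the same matrix, so the two coincide.\<close>
    have GN: "G (cm B b b') = N b b'" if "b \<in> B" "b' \<in> B" for b b'
    proof -
      have "(\<Sum>j\<in>B. (\<Sum>k\<in>B. G (cm B b k) * t (cm B k j)) * N j b') = (\<Sum>k\<in>B. G (cm B b k) * (\<Sum>j\<in>B. t (cm B k j) * N j b'))"
        unfolding sum_distrib_left sum_distrib_right by (subst sum.swap) (simp add: mult.assoc)
      moreover have "(\<Sum>j\<in>B. (\<Sum>k\<in>B. G (cm B b k) * t (cm B k j)) * N j b') = (\<Sum>j\<in>B. if j = b then N j b' else 0)"
        using that by (intro sum.cong) (simp_all add: GM)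
      moreover have "(\<Sum>k\<in>B. G (cm B b k) * (\<Sum>j\<in>B. t (cm B k j) * N j b')) = (\<Sum>k\<in>B. if k = b' then G (cm B b k) else 0)"
        using that by (intro sum.cong) (simp_all add: N)
      ultimately show ?thesis using that finB by (simp add: sum.delta)
    qed
    have cmat: "conv t G (cm B b b') = (if b = b' then 1 else 0)" if "b \<in> B" "b' \<in> B" for b b'
    proof -
      have "conv t G (cm B b b') = (\<Sum>k\<in>B. t (cm B b k) * G (cm B k b'))"
        unfolding conv_def by (rule S_cm[OF B(1,2) _ _ that(2)]) (intro lin_intros t lG)+
      also have "\<dots> = (\<Sum>k\<in>B. t (cm B b k) * N k b')" using that by (intro sum.cong) (simp_all add: GN)
      finally show ?thesis using that by (simp add: N)
    qed
    have "conv t G b = eps b" if "b \<in> B" for b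
    proof -
      have l: "lin (conv t G)" by (rule lin_conv[OF t lG])
      \<comment> \<open>A counit is inserted so that \<open>S_expand\<close> expresses the value at
        \<open>b\<close> through values at matrix entries, where \<open>cmat\<close> is
        known.\<close>
      have "conv t G b = S (\<lambda>x y. eps x * conv t G y) b" by (simp add: S_counit_left l)
      also have "\<dots> = (\<Sum>b'\<in>B. eps b' * conv t G (cm B b' b))"
        by (rule S_expand[OF B(1,2) _ _ that]) (intro lin_intros l)+
      also have "\<dots> = (\<Sum>b'\<in>B. if b' = b then eps b' else 0)"
        using that by (intro sum.cong) (simp_all add: cmat)
      finally show ?thesis using finB that by (simp add: sum.delta)
    qed
    then show ?thesis using lin_eq_on_span[OF lin_conv[OF t lG] eps _ B(3)] by blast
  qed
  show ?thesis using lG left right by (intro exI[of _ G]) auto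
qed

end

subsection \<open>The universal cocycle\<close>

lemma subalgebra_generated:
  assumes "\<And>c x y. s c (x + y) = s c x + s c y"
  shows "subalgebra s (generated_subalgebra s X)" "X \<subseteq> generated_subalgebra s X"
  unfolding subalgebra_def generated_subalgebra_def by auto

lemma generated_subalgebra_least: "subalgebra s B \<Longrightarrow> X \<subseteq> B \<Longrightarrow> generated_subalgebra s X \<subseteq> B"
  unfolding generated_subalgebra_def by blast

locale universal_cocycle =
  fixes H :: "('k::field, 'h::ring_1) hopf_data"
    and \<alpha> \<beta> :: "'h \<Rightarrow> 'h \<Rightarrow> 'k"
    and \<iota> :: "('h list \<Rightarrow>\<^sub>0 'k) set set \<Rightarrow> 'f::field"
  assumes inf: "infinite (UNIV :: 'k set)"
    and hopf_H: "hopf_algebra H"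
    and cocycle_\<alpha>: "two_cocycle H (*) \<alpha>"
    and normalized_\<alpha>: "normalized_cocycle H (*) \<alpha>"
    and inverse_\<beta>: "convolution_inverse H (*) \<alpha> \<beta>"
    and fractions: "fraction_field (symmetric_algebra (hscale H)) \<iota>"
begin

abbreviation "Sym \<equiv> symmetric_algebra (hscale H)"
abbreviation "Tcl p \<equiv> linearity_ideal (hscale H) +>\<^bsub>free_alg\<^esub> p"
abbreviation "Scl P \<equiv> commutator_ideal (hscale H) +>\<^bsub>T_alg H\<^esub> P"

definition \<kappa> :: "'k \<Rightarrow> 'f" where "\<kappa> c = \<iota> (c \<odot>\<^bsub>Sym\<^esub> \<one>\<^bsub>Sym\<^esub>)"

lemma iota_simps:
  "x \<in> carrier Sym \<Longrightarrow> y \<in> carrier Sym \<Longrightarrow> \<iota> (x \<oplus>\<^bsub>Sym\<^esub> y) = \<iota> x + \<iota> y"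
  "x \<in> carrier Sym \<Longrightarrow> y \<in> carrier Sym \<Longrightarrow> \<iota> (x \<otimes>\<^bsub>Sym\<^esub> y) = \<iota> x * \<iota> y"
  "\<iota> \<one>\<^bsub>Sym\<^esub> = 1" "inj_on \<iota> (carrier Sym)"
  using fractions by (auto simp: fraction_field_def Ring.ring_hom_def)

lemma Sym_one [simp]: "\<one>\<^bsub>Sym\<^esub> \<in> carrier Sym"
proof -
  interpret ring Sym by (rule kalgD[OF kalg_symmetric_algebra])
  show ?thesis by simp
qed

lemma Sym_smult [simp]: "x \<in> carrier Sym \<Longrightarrow> c \<odot>\<^bsub>Sym\<^esub> x \<in> carrier Sym"
  by (rule kspaceD[OF kalgD(2)[OF kalg_symmetric_algebra]])

text \<open>The embedding is assumed to be a ring homomorphism only. It respects scalars because a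
  scalar multiple is a product with a multiple of the unit, and \<open>\<kappa>\<close> is defined
  from these.\<close>

lemma iota_scale: "x \<in> carrier Sym \<Longrightarrow> \<iota> (c \<odot>\<^bsub>Sym\<^esub> x) = \<kappa> c * \<iota> x"
proof -
  assume x: "x \<in> carrier Sym"
  interpret ring Sym by (rule kalgD[OF kalg_symmetric_algebra])
  have "c \<odot>\<^bsub>Sym\<^esub> x = (c \<odot>\<^bsub>Sym\<^esub> \<one>\<^bsub>Sym\<^esub>) \<otimes>\<^bsub>Sym\<^esub> x"
    using x by (simp add: kalgD(3)[OF kalg_symmetric_algebra])
  then show ?thesis using x by (simp add: iota_simps \<kappa>_def)
qed

lemma scalars_\<kappa>: "scalars \<kappa>"
proof
  note k = kspaceD[OF kalgD(2)[OF kalg_symmetric_algebra[of "hscale H"]]]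
  show "\<kappa> 1 = 1" by (simp add: \<kappa>_def k(6) iota_simps)
  show "\<kappa> (a + b) = \<kappa> a + \<kappa> b" for a b by (simp add: \<kappa>_def k(3) iota_simps)
  show "\<kappa> (a * b) = \<kappa> a * \<kappa> b" for a b
    using iota_scale[of "b \<odot>\<^bsub>Sym\<^esub> \<one>\<^bsub>Sym\<^esub>" a] by (simp add: \<kappa>_def[of "a * b"] k(5)) (simp add: \<kappa>_def)
qed

sublocale hopf_scalars \<kappa> H
  by (intro hopf_scalars.intro scalars_\<kappa> hopf_scalars_axioms.intro hopf_H)

sublocale hopf_vs \<kappa> H
  by (intro hopf_vs.intro hopf_scalars_axioms vs_H)

lemma frac_scale_eq: "frac_scale H \<iota> = (\<lambda>c z. \<kappa> c * z)"
  by (simp add: fun_eq_iff frac_scale_def \<kappa>_def Let_def)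

lemma frac_alg_eq: "frac_alg H \<iota> = RR"
  by (simp add: frac_alg_def RR_def frac_scale_eq)

abbreviation "t \<equiv> t_var H \<iota>"

lemma Scl_carrier [simp]: "P \<in> carrier T \<Longrightarrow> Scl P \<in> carrier Sym"
  by (rule alg_homD(1)[OF S_class_hom])

lemma Tcl_carrier [simp]: "Tcl p \<in> carrier T"
  using alg_homD(1)[OF T_class_hom, of p] by simp

lemma t_eq: "t h = \<iota> (Scl (tgen (hscale H) h))"
  by (simp add: t_var_def sgen_def)

lemma lin_t: "lin t"
  unfolding lin_iff t_eq
  by (simp add: tgen_add tgen_scale alg_homD[OF S_class_hom] iota_simps iota_scale)

lemma iota_class: "\<iota> (Scl (Tcl p)) = ev t p"
proof (induction p rule: free_alg_induct)
  note h = alg_homD[OF T_class_hom[of "hscale H"], simplified] and h' = alg_homD[OF S_class_hom[of "hscale H"]]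
  {
    case one
    then show ?case by (simp add: h(4) h'(4) iota_simps)
  next
    case (gen v p)
    have "Tcl (free_gen v * p) = tgen (hscale H) v \<otimes>\<^bsub>T\<^esub> Tcl p" by (simp add: h(3) tgen_def)
    then show ?case using gen by (simp add: h'(3) iota_simps t_eq)
  next
    case (add p q)
    then show ?case by (simp add: h(2) h'(2) iota_simps)
  next
    case (scale c p)
    then show ?case by (simp add: h(5) h'(5) iota_scale)
  }
qed

text \<open>The embedding is injective, so a polynomial vanishing at \<open>t\<close> is zero in the
  symmetric algebra. A scalar linear form extends to a morphism from the tensor algebra to the
  ground field, which is commutative, and hence kills the commutator ideal.\<close>

lemma ev_specialize:
  assumes p: "ev t p = 0" and l: "klin l"
  shows "I.ev l p = 0"
proof -
  interpret T: ring T by (rule kalgD[OF kalg_tensor_algebra])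
  interpret Sy: ring Sym by (rule kalgD[OF kalg_symmetric_algebra])
  have "\<iota> \<zero>\<^bsub>Sym\<^esub> = 0"
    using iota_scale[of "\<one>\<^bsub>Sym\<^esub>" 0] kspaceD(9)[OF kalgD(2)[OF kalg_symmetric_algebra], of "\<one>\<^bsub>Sym\<^esub>" "hscale H"]
    by simp
  then have "\<iota> (Scl (Tcl p)) = \<iota> \<zero>\<^bsub>Sym\<^esub>" using p by (simp add: iota_class)
  then have "Scl (Tcl p) = \<zero>\<^bsub>Sym\<^esub>" using iota_simps(4) by (simp add: inj_on_eq_iff)
  also have "\<zero>\<^bsub>Sym\<^esub> = Scl \<zero>\<^bsub>T\<^esub>"
    unfolding symmetric_algebra_def by (rule quot_zero[OF kalg_tensor_algebra ideal_commutator])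
  finally have "Tcl p \<ominus>\<^bsub>T\<^esub> \<zero>\<^bsub>T\<^esub> \<in> commutator_ideal (hscale H)"
    using coset_eq_iff[OF kalg_tensor_algebra ideal_commutator, of "Tcl p" "hscale H" "\<zero>\<^bsub>T\<^esub>"] by simp
  then have P: "Tcl p \<in> commutator_ideal (hscale H)" by (simp add: T.minus_eq)
  have l2: "l v \<in> carrier I.RR" "l (v + w) = l v \<oplus>\<^bsub>I.RR\<^esub> l w" "l (hscale H c v) = c \<odot>\<^bsub>I.RR\<^esub> l v" for v w c
    using l by (simp_all add: I.lin_iff)
  have "I.ev l p = tensor_algebra_ext I.RR l (Tcl p)"
    by (rule tensor_algebra_ext_class[OF I.kalg_RR l2, symmetric])
  also have "\<dots> = \<zero>\<^bsub>I.RR\<^esub>"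
    by (rule commutator_ideal_kernel[OF I.kalg_RR tensor_algebra_ext_hom[OF I.kalg_RR l2] _ P])
      (simp only: I.RR_simps mult.commute)
  also have "\<dots> = 0" by (rule I.RR_simps)
  finally show ?thesis .
qed

abbreviation "ti \<equiv> t_inv H \<iota>"

text \<open>The definite description is justified by the usual uniqueness of a two-sided inverse in
  an associative monoid, here the convolution monoid of linear functionals.\<close>

lemma t_inv_props: "lin ti" "conv ti t = eps" "conv t ti = eps"
proof -
  have vsf: "vector_space (\<lambda>c z. \<kappa> c * z)" by unfold_locales (simp_all add: algebra_simps)
  have lin: "Vector_Spaces.linear (hscale H) (\<lambda>c z. \<kappa> c * z) g \<longleftrightarrow> lin g" for g
    using vs_H vsf by (auto simp: Vector_Spaces.linear_iff lin_iff)
  define Q where "Q g \<longleftrightarrow> lin g \<and> conv g t = eps \<and> conv t g = eps" for g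
  have eq: "ti = (THE g. Q g)"
    unfolding t_inv_def frac_alg_eq frac_scale_eq lin Q_def
    by (rule arg_cong[where f = The], rule ext) (auto simp: conv_def fun_eq_iff)
  obtain g where g: "Q g"
    using convolution_inverse_exists[OF lin_t ev_specialize[OF _ klin_counit]] by (auto simp: Q_def)
  have "g' = g" if "Q g'" for g'
  proof -
    have "g' = conv g' (conv t g)" using g that by (simp add: Q_def)
    also have "\<dots> = conv (conv g' t) g"
      by (rule conv_assoc[symmetric]) (use g that lin_t in \<open>simp_all add: Q_def\<close>)
    also have "\<dots> = g" using g that by (simp add: Q_def)
    finally show ?thesis .
  qed
  then have "Q ti" unfolding eq using g by (rule theI[of Q, rotated])
  then show "lin ti" "conv ti t = eps" "conv t ti = eps" by (simp_all add: Q_def)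
qed

definition R :: "'f set" where
  "R = generated_subalgebra (frac_scale H \<iota>) (range t \<union> range ti)"

sublocale coeff_alg \<kappa> H R
proof
  show "subalgebra (\<lambda>c z. \<kappa> c * z) R"
    unfolding R_def frac_scale_eq by (rule subalgebra_generated(1)) (simp add: algebra_simps)
qed

lemma t_in_R [simp]: "t h \<in> R" "ti h \<in> R"
  unfolding R_def using subalgebra_generated(2)[of "frac_scale H \<iota>" "range t \<union> range ti"]
  by (auto simp: frac_scale_eq algebra_simps)

lemma S_Theta_eq: "S_Theta H \<iota> = RA"
  by (simp add: S_Theta_def RA_def frac_alg_eq R_def[symmetric])

definition \<alpha>K :: "'h \<Rightarrow> 'h \<Rightarrow> 'f" where "\<alpha>K = (\<lambda>x y. \<kappa> (\<alpha> x y))"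

lemma bilin_ground:
  assumes "bilinear_map (hscale H) (*) \<gamma>"
  shows "I.bilin \<gamma>"
  using assms by (simp add: bilinear_map_def I.bilin_def klin_iff)

lemma bilin_\<alpha>: "I.bilin \<alpha>"
  using cocycle_\<alpha> by (intro bilin_ground) (simp add: two_cocycle_def)

lemma bilin_\<beta>: "I.bilin \<beta>"
  using inverse_\<beta> by (intro bilin_ground) (simp add: convolution_inverse_def)

lemma bilin_scal: "I.bilin \<gamma> \<Longrightarrow> bilin (\<lambda>x y. \<kappa> (\<gamma> x y))"
  by (simp add: I.bilin_def bilin_def lin_klin)

lemma IRR_eq: "I.RR = alg_of (*)"
  by (simp add: I.RR_def)

lemma cocycle_ground: "I.S (\<lambda>x1 x2. I.S (\<lambda>y1 y2. \<alpha> x1 y1 * \<alpha> (x2 * y2) z) y) x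
      = I.S (\<lambda>y1 y2. I.S (\<lambda>z1 z2. \<alpha> y1 z1 * \<alpha> x (y2 * z2)) z) y"
  using cocycle_\<alpha> by (simp add: two_cocycle_def sweedler_pair_def IRR_eq)

lemma normalized_ground: "\<alpha> x 1 = counit H x" "\<alpha> 1 x = counit H x"
  using normalized_\<alpha> by (simp_all add: normalized_cocycle_def)

text \<open>Values of \<open>\<alpha>\<close> are carried into the field of fractions by
  \<open>\<kappa>\<close>, and the cocycle identity with them.\<close>

sublocale A: cocycle_twist \<kappa> H R \<alpha>K
proof
  show "bilin \<alpha>K" unfolding \<alpha>K_def by (rule bilin_scal[OF bilin_\<alpha>])
  show "\<alpha>K x y \<in> R" for x y by (simp add: \<alpha>K_def R_closed)
  show "1 \<in> R" by (rule R_closed)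
  show "S (\<lambda>x1 x2. S (\<lambda>y1 y2. \<alpha>K x1 y1 * \<alpha>K (x2 * y2) z) y) x
      = S (\<lambda>y1 y2. S (\<lambda>z1 z2. \<alpha>K y1 z1 * \<alpha>K x (y2 * z2)) z) y" for x y z
    unfolding \<alpha>K_def scal_mult[symmetric] S_transfer by (rule arg_cong[where f = \<kappa>]) (rule cocycle_ground)
  show "\<alpha>K x 1 = eps x" "\<alpha>K 1 x = eps x" for x by (simp_all add: \<alpha>K_def normalized_ground)
qed

lemma alpha_twisted_eq: "alpha_twisted H \<iota> \<alpha> = A.TA"
  by (simp add: alpha_twisted_def S_Theta_eq frac_scale_eq \<alpha>K_def)

text \<open>The same product over the ground field, which is the twisted Hopf algebra that receives
  the specializations.\<close>

sublocale K: cocycle_twist id H UNIV \<alpha>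
proof
  show "subalgebra (\<lambda>c z. id c * z) UNIV" by (simp add: subalgebra_def)
qed (simp_all add: bilin_\<alpha> cocycle_ground normalized_ground)

lemma ground_eq: "K.RA = ground_alg"
  by (simp add: K.RA_def I.RR_def ground_alg_def alg_of_def)

abbreviation "\<sigma> \<equiv> sigma H \<iota> \<alpha>"

text \<open>The defining sum splits \<open>x\<close> completely before \<open>y\<close>.
  Interchanging one pair of sums shows it as an iterated convolution.\<close>

lemma sigma_eq: "\<sigma> = conv2 (conv2 (\<lambda>x y. t x * t y) \<alpha>K) (\<lambda>x y. ti (x * y))"
proof (intro ext)
  fix x y
  have "\<sigma> x y = S (\<lambda>u x3. S (\<lambda>x1 x2. S (\<lambda>v y3. S (\<lambda>y1 y2. t x1 * t y1 * \<alpha>K x2 y2 * ti (x3 * y3)) v) y) u) x"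
    by (simp add: sigma_def sweedler3_pair_def sweedler3_def frac_alg_eq frac_scale_eq \<alpha>K_def)
  also have "\<dots> = S (\<lambda>u x3. S (\<lambda>v y3. S (\<lambda>x1 x2. S (\<lambda>y1 y2. t x1 * t y1 * \<alpha>K x2 y2 * ti (x3 * y3)) v) u) y) x"
    by (subst S_swap) (rule refl)
  also have "\<dots> = conv2 (conv2 (\<lambda>x y. t x * t y) \<alpha>K) (\<lambda>x y. ti (x * y)) x y"
    by (simp add: conv2_def S_mult_right)
  finally show "\<sigma> x y = conv2 (conv2 (\<lambda>x y. t x * t y) \<alpha>K) (\<lambda>x y. ti (x * y)) x y" .
qed

section \<open>The product twisted by the universal cocycle, and the isomorphism
  \<open>\<phi>\<close>\<close>

lemma bilin_tt: "bilin (\<lambda>x y. t x * t y)"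
  by (rule bilin_prod[OF lin_t lin_t])

text \<open>The cocycle \<open>\<sigma>\<close> has the value \<open>t 1\<close> at the pair of
  units, so the unit element carries the coefficient \<open>ti 1\<close>.\<close>

sublocale G: twist \<kappa> H R \<sigma> "ti 1"
proof
  show "bilin \<sigma>"
    unfolding sigma_eq by (intro bilin_conv2 bilin_tt A.bilin_\<tau> bilin_mult t_inv_props)
  show "\<sigma> x y \<in> R" for x y
    unfolding sigma_eq by (intro conv2_in_R A.\<tau>_in_R R_closed t_in_R)
qed simp

lemma sigma_twisted_eq: "sigma_twisted H \<iota> \<alpha> = G.TA"
  by (simp add: sigma_twisted_def S_Theta_eq)

lemma phi_eq: "phi H \<iota> = shift t"
  by (simp add: phi_def shift_def S_Theta_eq Let_def)

lemma shift_inverse: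
  assumes "P \<in> carrier RH"
  shows "shift ti (shift t P) = P" "shift t (shift ti P) = P"
proof -
  show "shift ti (shift t P) = P"
    by (rule RH_eqI) (simp_all add: shift assms lin_conv lin_t t_inv_props conv_assoc[symmetric])
  show "shift t (shift ti P) = P"
    by (rule RH_eqI) (simp_all add: shift assms lin_conv lin_t t_inv_props conv_assoc[symmetric])
qed

lemma inv_phi: "P \<in> carrier RH \<Longrightarrow> inv_into (carrier RH) (phi H \<iota>) P = shift ti P"
  by (rule inv_into_f_eq)
    (auto simp: phi_eq shift shift_inverse intro!: inj_on_inverseI[of _ "shift ti"])

text \<open>This turns the product with \<open>\<sigma>\<close> into the product with \<open>\<alpha>\<close> under \<open>\<phi>\<close>.\<close>

lemma kernel_sigma_alpha:
  assumes f: "lin f"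
  shows "conv2 \<sigma> (\<lambda>x y. conv t f (x * y)) = conv2 (\<lambda>x y. t x * t y) (conv2 \<alpha>K (\<lambda>x y. f (x * y)))"
proof -
  let ?f = "\<lambda>x y. f (x * y)" and ?t = "\<lambda>x y. t (x * y)" and ?ti = "\<lambda>x y. ti (x * y)"
  have bf: "bilin ?f" and bt: "bilin ?t" and bti: "bilin ?ti"
    by (rule bilin_mult, fact f lin_t t_inv_props(1))+
  have bX: "bilin (conv2 (\<lambda>x y. t x * t y) \<alpha>K)" by (rule bilin_conv2[OF bilin_tt A.bilin_\<tau>])
  have 1: "(\<lambda>x y. conv t f (x * y)) = conv2 ?t ?f"
    by (intro ext) (rule conv_mult[OF lin_t f])
  \<comment> \<open>Composition with the multiplication respects convolution, so \<open>t\<close>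
    and \<open>ti\<close> remain inverse to each other on pairs.\<close>
  have "conv2 ?ti ?t = (\<lambda>x y. eps x * eps y)"
    by (intro ext) (simp add: conv_mult[OF t_inv_props(1) lin_t, symmetric] t_inv_props(2))
  then have 2: "conv2 ?ti (conv2 ?t ?f) = ?f"
    by (simp add: conv2_assoc[OF bti bt bf, symmetric] conv2_eps_left bf)
  show ?thesis
    unfolding sigma_eq 1 conv2_assoc[OF bX bti bilin_conv2[OF bt bf]] 2
    by (rule conv2_assoc[OF bilin_tt A.bilin_\<tau> bf])
qed

text \<open>On functionals \<open>shift t\<close> is convolution by \<open>t\<close> in each factor,
  and a product is tested by its kernel. Both sides then reduce to the two sides of
  \<open>kernel_sigma_alpha\<close>.\<close>

lemma shift_mult:
  assumes "P \<in> carrier RH" "Q \<in> carrier RH"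
  shows "shift t (P \<otimes>\<^bsub>G.TA\<^esub> Q) = shift t P \<otimes>\<^bsub>A.TA\<^esub> shift t Q"
proof (rule RH_eqI)
  fix f assume f: "lin f"
  let ?K = "conv2 \<alpha>K (\<lambda>x y. f (x * y))"
  have bK: "bilin ?K" by (rule bilin_conv2[OF A.bilin_\<tau> bilin_mult[OF f]])
  have lp: "lin (\<lambda>x. pair (shift t Q) (?K x))" by (rule lin_pair) (rule bilinD[OF bK])
  have "pair (shift t P \<otimes>\<^bsub>A.TA\<^esub> shift t Q) f = pair P (conv t (\<lambda>x. pair (shift t Q) (?K x)))"
    by (simp add: A.pair_TA_mult shift assms f lp)
  also have "\<dots> = pair P (\<lambda>x. pair Q (conv2 (\<lambda>x y. t x * t y) ?K x))"
  proof -
    have "conv t (\<lambda>x. pair (shift t Q) (?K x)) x = pair Q (conv2 (\<lambda>x y. t x * t y) ?K x)" for x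
    proof -
      have "conv t (\<lambda>x. pair (shift t Q) (?K x)) x = S (\<lambda>x1 x2. pair Q (\<lambda>y. t x1 * conv t (?K x2) y)) x"
        unfolding conv_def[of t "\<lambda>x. pair (shift t Q) (?K x)"]
        by (simp add: pair_shift assms bilinD[OF bK] pair_fun_mult_left)
      also have "\<dots> = pair Q (\<lambda>y. S (\<lambda>x1 x2. t x1 * conv t (?K x2) y) x)" by (rule pair_S[symmetric])
      also have "\<dots> = pair Q (conv2 (\<lambda>x y. t x * t y) ?K x)"
        by (rule arg_cong[where f = "pair Q"], rule ext)
          (simp add: conv2_def[of "\<lambda>x y. t x * t y"] conv_def S_mult_left[symmetric] mult.assoc)
      finally show ?thesis .
    qed
    then have "conv t (\<lambda>x. pair (shift t Q) (?K x)) = (\<lambda>x. pair Q (conv2 (\<lambda>x y. t x * t y) ?K x))" by (rule ext)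
    then show ?thesis by simp
  qed
  also have "\<dots> = pair (shift t (P \<otimes>\<^bsub>G.TA\<^esub> Q)) f"
    by (simp add: pair_shift G.TA_mult_carrier G.pair_TA_mult assms f lin_conv lin_t kernel_sigma_alpha)
  finally show "pair (shift t (P \<otimes>\<^bsub>G.TA\<^esub> Q)) f = pair (shift t P \<otimes>\<^bsub>A.TA\<^esub> shift t Q) f" ..
qed (simp_all add: shift_carrier A.TA_mult_carrier G.TA_mult_carrier assms)

lemma shift_linear:
  assumes "\<And>h. l h \<in> R" "lin l" "P \<in> carrier RH"
  shows shift_add: "Q \<in> carrier RH \<Longrightarrow> shift l (P \<oplus>\<^bsub>RH\<^esub> Q) = shift l P \<oplus>\<^bsub>RH\<^esub> shift l Q"
    and shift_smult: "shift l (c \<odot>\<^bsub>RH\<^esub> P) = c \<odot>\<^bsub>RH\<^esub> shift l P"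
  by (rule RH_eqI; simp add: shift assms lin_conv)+

lemma t_1: "ti 1 * t 1 = 1"
  using fun_cong[OF t_inv_props(2), of 1] conv_one[OF t_inv_props(1) lin_t] by simp

lemma shift_one: "shift t (ten (ti 1) 1) = ten 1 1"
  by (rule RH_eqI) (simp_all add: shift R_closed lin_t lin_conv conv_one mult.assoc[symmetric] t_1)

section \<open>The generic morphism on the tensor algebra and the ideal of identities\<close>

lemmas mu_t = A.mu_hom[OF lin_t t_in_R(1)]

lemma mu_t_carrier [simp]: "P \<in> carrier T \<Longrightarrow> A.mu t P \<in> carrier RH"
  using alg_homD(1)[OF mu_t] by simp

text \<open>The map that induces \<open>mu_sigma\<close>, taken on the tensor algebra, where
  induction over words is available and no representatives of classes are chosen.\<close>

definition g :: "('h list \<Rightarrow>\<^sub>0 'k) set \<Rightarrow> ('f \<times> 'h \<Rightarrow>\<^sub>0 'k) set" where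
  "g P = shift ti (A.mu t P)"

lemma g_carrier [simp]: "P \<in> carrier T \<Longrightarrow> g P \<in> carrier RH"
  by (simp add: g_def shift_carrier)

lemma g_hom: "g \<in> alg_hom T G.TA"
proof -
  interpret T: ring T by (rule kalgD[OF kalg_tensor_algebra])
  note h = alg_homD[OF mu_t, simplified]
  have m: "g (P \<otimes>\<^bsub>T\<^esub> Q) = g P \<otimes>\<^bsub>G.TA\<^esub> g Q" if "P \<in> carrier T" "Q \<in> carrier T" for P Q
  proof -
    \<comment> \<open>Multiplicativity is known for \<open>shift t\<close>, so its inverse is
      inserted and cancelled.\<close>
    have "g P \<otimes>\<^bsub>G.TA\<^esub> g Q = shift ti (shift t (g P \<otimes>\<^bsub>G.TA\<^esub> g Q))"
      using that by (simp add: shift_inverse G.TA_mult_carrier)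
    also have "\<dots> = shift ti (A.mu t P \<otimes>\<^bsub>A.TA\<^esub> A.mu t Q)"
      using that by (simp add: shift_mult shift_carrier) (simp add: g_def shift_inverse)
    finally show ?thesis using that by (simp add: g_def h(3))
  qed
  have o: "g \<one>\<^bsub>T\<^esub> = ten (ti 1) 1"
    using shift_inverse(1)[of "ten (ti 1) 1"] by (simp add: g_def h(4) shift_one)
  show ?thesis
    unfolding alg_hom_def
    by (auto intro!: ring_hom_memI simp: m o)
      (simp_all add: g_def h(2,5) shift_linear t_inv_props)
qed

text \<open>Convolution by \<open>t\<close> from the generic morphism and by \<open>ti\<close> from
  the inverse of \<open>\<phi>\<close> cancel by associativity.\<close>

lemma pair_g_tgen: "lin f \<Longrightarrow> pair (g (tgen (hscale H) v)) f = f v"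
  by (simp add: g_def pair_shift A.mu_tgen A.mu_gen_carrier A.pair_mu_gen lin_t lin_conv t_inv_props
      conv_assoc[symmetric])

lemma g_tgen: "g (tgen (hscale H) v) = ten 1 v"
  by (rule RH_eqI) (simp_all add: pair_g_tgen R_closed)

lemma g_eq_iff: "P \<in> carrier T \<Longrightarrow> Q \<in> carrier T \<Longrightarrow> g P = g Q \<longleftrightarrow> A.mu t P = A.mu t Q"
  unfolding g_def by (metis mu_t_carrier shift_inverse(2))

text \<open>A polynomial in the variables \<open>t\<^sub>h\<close> vanishes if and only if all its specialisations to scalar linear
  forms vanish, because the field is infinite; the latter correspond to the morphisms to the twisted
  Hopf algebra.\<close>

lemma identities_eq: "identities H \<alpha> = {P \<in> carrier T. A.mu t P = \<zero>\<^bsub>A.TA\<^esub>}"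
proof -
  have zero_pair: "pair \<zero>\<^bsub>RH\<^esub> f = 0" if "lin f" for f
    using linfun_zero[OF kspace_tensor linfun_pair[OF that]] .
  have zero_pairK: "K.pair \<zero>\<^bsub>K.RH\<^esub> f = 0" if "klin f" for f
    using I.linfun_zero[OF kspace_tensor K.linfun_pair[OF that]] .
  have zc: "\<zero>\<^bsub>RH\<^esub> \<in> carrier RH" "\<zero>\<^bsub>K.RH\<^esub> \<in> carrier K.RH" by (rule kspaceD(8)[OF kspace_tensor])+
  have evt: "ev t (coord_poly H \<alpha> p f) = pair (A.mu t (Tcl p)) (\<lambda>h. \<kappa> (f h))" if "klin f" for p f
    by (rule A.ev_coord_poly[OF \<alpha>K_def bilin_\<alpha> lin_t t_in_R(1) that])
  have evk: "I.ev l (coord_poly H \<alpha> p f) = K.pair (K.mu l (Tcl p)) f" if "klin l" "klin f" for l p f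
    using K.ev_coord_poly[OF _ bilin_\<alpha> that(1) _ that(2), of p] by simp
  have tw: "twisted_hopf_alg H \<alpha> = K.TA" by (simp add: twisted_hopf_alg_def ground_eq)
  have "Tcl p \<in> identities H \<alpha> \<longleftrightarrow> A.mu t (Tcl p) = \<zero>\<^bsub>A.TA\<^esub>" for p
  proof
    assume id: "Tcl p \<in> identities H \<alpha>"
    have "A.mu t (Tcl p) = \<zero>\<^bsub>RH\<^esub>"
    proof (rule RH_eqI_scal)
      fix m :: "'h \<Rightarrow> 'k" assume "Vector_Spaces.linear (hscale H) (*) m"
      then have m: "klin m" by (simp add: klin_iff)
      \<comment> \<open>Each scalar linear form gives a comodule algebra morphism, which annihilates
        an identity; its coordinate along \<open>m\<close> is this value.\<close>
      have "I.ev l (coord_poly H \<alpha> p m) = 0" if "Vector_Spaces.linear (hscale H) (*) l" for l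
      proof -
        have l: "klin l" using that by (simp add: klin_iff)
        have "K.mu l (Tcl p) = \<zero>\<^bsub>K.TA\<^esub>"
          using id K.mu_comodule[OF l] unfolding identities_def tw ground_eq by simp
        then show ?thesis using zero_pairK[OF m] by (simp add: evk[OF l m])
      qed
      then have "ev t (coord_poly H \<alpha> p m) = 0"
        by (rule ev_zero_if_vanishing[OF inf vs_H]) (use lin_t in \<open>simp_all add: linD\<close>)
      then show "pair (A.mu t (Tcl p)) (\<lambda>h. \<kappa> (m h)) = pair \<zero>\<^bsub>RH\<^esub> (\<lambda>h. \<kappa> (m h))"
        using zero_pair[OF lin_klin[OF m]] by (simp add: evt[OF m])
    qed (simp_all only: zc mu_t_carrier Tcl_carrier)
    then show "A.mu t (Tcl p) = \<zero>\<^bsub>A.TA\<^esub>" by simp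
  next
    assume mu0: "A.mu t (Tcl p) = \<zero>\<^bsub>A.TA\<^esub>"
    have "m (Tcl p) = \<zero>\<^bsub>K.TA\<^esub>" if m: "m \<in> comodule_alg_hom H T (T_coaction H) K.TA (tensor_coaction H K.RA)" for m
    proof -
      \<comment> \<open>Every morphism comes from a scalar linear form, so its coordinates are
        specializations of the vanishing generic ones.\<close>
      obtain l where l: "klin l" "\<forall>P\<in>carrier T. m P = K.mu l P" using K.comodule_alg_hom_mu[OF m] by auto
      have "K.mu l (Tcl p) = \<zero>\<^bsub>K.RH\<^esub>"
      proof (rule K.RH_eqI)
        show "K.mu l (Tcl p) \<in> carrier K.RH" using alg_homD(1)[OF K.mu_hom[OF l(1)], of "Tcl p"] by simp
        fix f assume f: "klin f"
        have "ev t (coord_poly H \<alpha> p f) = 0"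
          using mu0 zero_pair[OF lin_klin[OF f]] by (simp add: evt[OF f])
        from ev_specialize[OF this l(1)]
        show "K.pair (K.mu l (Tcl p)) f = K.pair \<zero>\<^bsub>K.RH\<^esub> f" using zero_pairK[OF f] by (simp add: evk[OF l(1) f])
      qed (rule zc)
      then show ?thesis using l(2) by simp
    qed
    then show "Tcl p \<in> identities H \<alpha>" unfolding identities_def tw ground_eq[symmetric] by simp
  qed
  moreover have "identities H \<alpha> \<subseteq> carrier T" by (auto simp: identities_def)
  ultimately show ?thesis by (auto simp: T_carrier)
qed

lemma ideal_identities: "ideal (identities H \<alpha>) T"
  unfolding identities_eq by (rule kernel_ideal[OF kalg_tensor_algebra A.kalg_TA mu_t])

section \<open>The induced morphism on the universal comodule algebra\<close>

abbreviation "U \<equiv> U_alg H \<alpha>"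

lemma U_class_eq_iff: "P \<in> carrier T \<Longrightarrow> Q \<in> carrier T \<Longrightarrow> U_class H \<alpha> P = U_class H \<alpha> Q \<longleftrightarrow> g P = g Q"
proof -
  assume P: "P \<in> carrier T" "Q \<in> carrier T"
  interpret T: ring T by (rule kalgD[OF kalg_tensor_algebra])
  have "U_class H \<alpha> P = U_class H \<alpha> Q \<longleftrightarrow> P \<ominus>\<^bsub>T\<^esub> Q \<in> identities H \<alpha>"
    unfolding U_class_def by (rule coset_eq_iff[OF kalg_tensor_algebra ideal_identities P])
  also have "\<dots> \<longleftrightarrow> A.mu t P = A.mu t Q"
    using P alg_hom_eq_iff[OF kalg_tensor_algebra A.kalg_TA mu_t P] by (simp add: identities_eq)
  finally show ?thesis using g_eq_iff[OF P] by simp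
qed

lemma U_carrier: "carrier U = U_class H \<alpha> ` carrier T"
  unfolding U_alg_def U_class_def by (rule quot_carrier[OF kalg_tensor_algebra ideal_identities])

lemma U_class_hom: "U_class H \<alpha> \<in> alg_hom T U"
  unfolding U_alg_def U_class_def[abs_def] by (rule quot_hom[OF kalg_tensor_algebra ideal_identities])

lemma kalg_U: "kalg U"
  unfolding U_alg_def by (rule kalg_quot[OF kalg_tensor_algebra ideal_identities])

lemma U_some:
  assumes "P \<in> carrier T"
  shows "(SOME Q. Q \<in> U_class H \<alpha> P) \<in> carrier T" "g (SOME Q. Q \<in> U_class H \<alpha> P) = g P"
proof -
  have 1: "(SOME Q. Q \<in> U_class H \<alpha> P) \<in> carrier T"
    unfolding U_class_def by (rule quot_some(1)[OF kalg_tensor_algebra ideal_identities assms])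
  then show "(SOME Q. Q \<in> U_class H \<alpha> P) \<in> carrier T" .
  have "U_class H \<alpha> (SOME Q. Q \<in> U_class H \<alpha> P) = U_class H \<alpha> P"
    unfolding U_class_def by (rule quot_some(2)[OF kalg_tensor_algebra ideal_identities assms])
  then show "g (SOME Q. Q \<in> U_class H \<alpha> P) = g P" using U_class_eq_iff[OF 1 assms] by simp
qed

abbreviation "mus \<equiv> mu_sigma H \<iota> \<alpha>"

lemma mus_class: "P \<in> carrier T \<Longrightarrow> mus (U_class H \<alpha> P) = g P"
proof -
  assume P: "P \<in> carrier T"
  have "mu_alpha H \<iota> \<alpha> C = A.mu t (SOME P. P \<in> C)" for C
    unfolding mu_alpha_def alpha_twisted_eq S_Theta_eq Let_def A.mu_def A.mu_gen_def[abs_def] ..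
  then show ?thesis
    using U_some[OF P] by (simp add: mu_sigma_def sigma_twisted_eq inv_phi) (simp add: g_def)
qed

lemma mus_hom: "mus \<in> alg_hom U G.TA"
proof -
  interpret T: ring T by (rule kalgD[OF kalg_tensor_algebra])
  note u = alg_homD(2-5)[OF U_class_hom, symmetric] and gh = alg_homD[OF g_hom]
  note sc = kspaceD(2)[OF kalgD(2)[OF kalg_tensor_algebra]]
  show ?thesis
    unfolding alg_hom_def
    by (auto intro!: ring_hom_memI simp: U_carrier u mus_class gh(2-5)[simplified] sc)
qed

lemma mus_inj: "inj_on mus (carrier U)"
  by (auto simp: inj_on_def U_carrier mus_class U_class_eq_iff)

lemma mus_coaction:
  assumes "a \<in> carrier U"
  shows "tensor_coaction H RA (mus a) = tlift RHH (\<lambda>a' h. tens RH HA (mus a') h) (U_coaction H \<alpha> a)"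
proof (rule RHH_eqI)
  obtain P where P: "P \<in> carrier T" "a = U_class H \<alpha> P" using assms by (auto simp: U_carrier)
  \<comment> \<open>The representative on which \<open>U_coaction\<close> is computed. It may differ
    from \<open>P\<close>, but has the same image under \<open>g\<close>.\<close>
  define Q where "Q = (SOME Q. Q \<in> U_class H \<alpha> P)"
  have Q: "Q \<in> carrier T" "g Q = mus a" using U_some[OF P(1)] by (simp_all add: Q_def P mus_class)
  note kT = kalgD(2)[OF kalg_tensor_algebra] and kU = kalgD(2)[OF kalg_U]
  note md = alg_homD[OF mus_hom, simplified]
  let ?UH = "tensor_space U HA"
  have ua: "U_coaction H \<alpha> a = tlift ?UH (\<lambda>P h. tens U HA (U_class H \<alpha> P) h) (T_coaction H Q)"
    by (simp add: U_coaction_def P Q_def)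
  have uc: "tens U HA (U_class H \<alpha> P) h \<in> carrier ?UH" if "P \<in> carrier T" for P h
    using that alg_homD(1)[OF U_class_hom] by (simp add: tens_carrier)
  have Uc: "U_coaction H \<alpha> a \<in> carrier ?UH"
    unfolding ua by (rule linfun_tlift(1)[OF kT kspace_HA kspace_tensor T_coaction_carrier[OF Q(1)] uc])
  have tc: "tens RH HA (mus a') h \<in> carrier RHH" if "a' \<in> carrier U" for a' h
    using md(1)[OF that] by (simp add: tens_carrier)
  show "tensor_coaction H RA (mus a) \<in> carrier RHH" by (rule coaction_carrier) (rule md(1)[OF assms])
  show "tlift RHH (\<lambda>a' h. tens RH HA (mus a') h) (U_coaction H \<alpha> a) \<in> carrier RHH"
    by (rule linfun_tlift(1)[OF kU kspace_HA kspace_tensor Uc tc])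
  fix f k assume fk: "lin f" "lin k"
  have bU: "bil U HA (\<lambda>a' h. pair (mus a') f * k h)"
    using fk by (simp add: bil_def lin_mult_l) (simp add: linfun_def md algebra_simps)
  have "pair2 (tlift RHH (\<lambda>a' h. tens RH HA (mus a') h) (U_coaction H \<alpha> a)) f k
      = tl (\<lambda>a' h. pair (mus a') f * k h) (U_coaction H \<alpha> a)"
    using linfun_tlift(2)[OF kU kspace_HA kspace_tensor Uc tc linfun_pair2[OF fk]] by (simp add: fk)
  also have "\<dots> = tl (\<lambda>P h. pair (mus (U_class H \<alpha> P)) f * k h) (T_coaction H Q)"
    unfolding ua
    using linfun_tlift(2)[OF kT kspace_HA kspace_tensor T_coaction_carrier[OF Q(1)] uc linfun_tl[OF bU]]
    by (simp add: tl_tens[OF bU])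
  also have "\<dots> = tl (\<lambda>P h. pair (g P) f * k h) (T_coaction H Q)"
    by (rule tl_cong[OF kT kspace_HA T_coaction_carrier[OF Q(1)]]) (simp add: mus_class)
  \<comment> \<open>A generator is sent to \<open>ten 1 v\<close>, so \<open>coaction_compat\<close>
    applies with the counit as \<open>\<theta>\<close>.\<close>
  also have "\<dots> = pair (g Q) (conv f k)"
    using G.coaction_compat[OF g_hom lin_counit _ Q(1) fk] by (simp add: pair_g_tgen)
  finally show "pair2 (tensor_coaction H RA (mus a)) f k
      = pair2 (tlift RHH (\<lambda>a' h. tens RH HA (mus a') h) (U_coaction H \<alpha> a)) f k"
    using md(1)[OF assms] by (simp add: pair2_coaction fk Q)
qed

lemma mus_comodule: "mus \<in> comodule_alg_hom H U (U_coaction H \<alpha>) G.TA (tensor_coaction H RA)"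
proof -
  have sp: "tensor_space G.TA HA = RHH" "tens G.TA HA = tens RH HA"
    by (rule tensor_space_cong; simp)+
  show ?thesis unfolding comodule_alg_hom_def sp using mus_hom mus_coaction by simp
qed

section \<open>The image lies in the subalgebra with coefficients in \<open>B\<close>\<close>

abbreviation "B \<equiv> B_alg H \<iota> \<alpha> \<beta>"

lemma B_sub: "subalgebra (\<lambda>c z. \<kappa> c * z) B"
  unfolding B_alg_def frac_scale_eq by (rule subalgebra_generated(1)) (simp add: algebra_simps)

text \<open>The unit is group-like, so the sum collapses to \<open>t 1\<close>,
  \<open>\<beta> 1 1\<close> and two factors \<open>ti 1\<close>; normalization of
  \<open>\<alpha>\<close> forces \<open>\<beta> 1 1 = 1\<close>. This places the coefficient of the
  unit element in \<open>B\<close>.\<close>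

lemma sigma_inv_1: "sigma_inv H \<iota> \<beta> 1 1 = ti 1"
proof -
  have bK: "bilin (\<lambda>x y. \<kappa> (\<beta> x y))" by (rule bilin_scal[OF bilin_\<beta>])
  note li = lin_intros lin_t t_inv_props(1) bilinD[OF bK]
  have y3: "S (\<lambda>v y3. S (\<lambda>y1 y2. t (x1 * y1) * \<kappa> (\<beta> x2 y2) * ti x3 * ti y3) v) 1
      = t (x1 * 1) * \<kappa> (\<beta> x2 1) * ti x3 * ti 1" for x1 x2 x3
  proof -
    have "S (\<lambda>v y3. S (\<lambda>y1 y2. t (x1 * y1) * \<kappa> (\<beta> x2 y2) * ti x3 * ti y3) v) 1
        = S (\<lambda>y1 y2. t (x1 * y1) * \<kappa> (\<beta> x2 y2) * ti x3 * ti 1) 1"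
      by (rule S_one) (intro li)+
    also have "\<dots> = t (x1 * 1) * \<kappa> (\<beta> x2 1) * ti x3 * ti 1"
      by (rule S_one) (intro li)+
    finally show ?thesis .
  qed
  have "sigma_inv H \<iota> \<beta> 1 1 = S (\<lambda>u x3. S (\<lambda>x1 x2. t (x1 * 1) * \<kappa> (\<beta> x2 1) * ti x3 * ti 1) u) 1"
    unfolding sigma_inv_def sweedler3_pair_def sweedler3_def frac_alg_eq frac_scale_eq
    by (simp only: mult_1_right y3)
  also have "\<dots> = S (\<lambda>x1 x2. t (x1 * 1) * \<kappa> (\<beta> x2 1) * ti 1 * ti 1) 1"
    by (rule S_one) (intro li)+
  also have "\<dots> = t (1 * 1) * \<kappa> (\<beta> 1 1) * ti 1 * ti 1"
    by (rule S_one) (intro li)+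
  also have "\<beta> 1 1 = 1"
  proof -
    have "I.conv2 \<alpha> \<beta> 1 1 = 1"
      using inverse_\<beta> by (simp add: convolution_inverse_def sweedler_pair_def I.conv2_def IRR_eq)
    moreover have "I.conv2 \<alpha> \<beta> 1 1 = \<alpha> 1 1 * \<beta> 1 1"
    proof -
      have "I.S (\<lambda>y1 y2. \<alpha> x1 y1 * \<beta> x2 y2) 1 = \<alpha> x1 1 * \<beta> x2 1" for x1 x2
        by (rule I.S_one) (intro I.lin_intros I.bilinD[OF bilin_\<alpha>] I.bilinD[OF bilin_\<beta>])+
      then have "I.conv2 \<alpha> \<beta> 1 1 = I.S (\<lambda>x1 x2. \<alpha> x1 1 * \<beta> x2 1) 1" by (simp add: I.conv2_def)
      also have "\<dots> = \<alpha> 1 1 * \<beta> 1 1"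
        by (rule I.S_one) (intro I.lin_intros I.bilinD[OF bilin_\<alpha>] I.bilinD[OF bilin_\<beta>])+
      finally show ?thesis .
    qed
    ultimately show ?thesis by (simp add: normalized_ground)
  qed
  finally show ?thesis using t_1 by (simp add: mult.commute)
qed

lemma B_closed:
  "1 \<in> B" "x \<in> B \<Longrightarrow> y \<in> B \<Longrightarrow> x * y \<in> B" "\<sigma> a b \<in> B" "ti 1 \<in> B" "B \<subseteq> R"
proof -
  show "1 \<in> B" "x \<in> B \<Longrightarrow> y \<in> B \<Longrightarrow> x * y \<in> B" using B_sub by (auto simp: subalgebra_def)
  have sub: "{\<sigma> x y | x y. True} \<union> {sigma_inv H \<iota> \<beta> x y | x y. True} \<subseteq> B"
    unfolding B_alg_def by (rule subalgebra_generated(2)) (simp add: frac_scale_eq algebra_simps)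
  then show "\<sigma> a b \<in> B" by blast
  have "sigma_inv H \<iota> \<beta> 1 1 \<in> B" using sub by blast
  then show "ti 1 \<in> B" by (simp add: sigma_inv_1)
  have "sigma_inv H \<iota> \<beta> x y \<in> R" for x y
    unfolding sigma_inv_def sweedler3_pair_def sweedler3_def frac_alg_eq frac_scale_eq
    by (intro S_in_R R_closed t_in_R)
  then show "B \<subseteq> R"
    unfolding B_alg_def frac_scale_eq using G.\<tau>_in_R by (intro generated_subalgebra_least[OF subalg]) auto
qed

text \<open>The carrier of \<open>A_alg\<close>, with \<open>S_Theta\<close> in the form
  \<open>RA\<close> used for calculations.\<close>

definition W :: "('f \<times> 'h \<Rightarrow>\<^sub>0 'k) set set" where
  "W = tcoset RA HA ` {p. Poly_Mapping.keys p \<subseteq> B \<times> UNIV}"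

lemma W_carrier: "W \<subseteq> carrier RH"
  using B_closed(5) by (auto simp: W_def intro!: tcoset_carrier)

lemma W_closed:
  "P \<in> W \<Longrightarrow> Q \<in> W \<Longrightarrow> P \<oplus>\<^bsub>RH\<^esub> Q \<in> W" "P \<in> W \<Longrightarrow> c \<odot>\<^bsub>RH\<^esub> P \<in> W" "\<zero>\<^bsub>RH\<^esub> \<in> W" "b \<in> B \<Longrightarrow> ten b h \<in> W"
  by (auto simp: W_def tens_def keys_add_subset keys_fscale_subset)

lemma W_sweedler:
  assumes "\<And>a b. F a b \<in> W"
  shows "sweedler H RH F h \<in> W"
proof -
  interpret X: abelian_group RH by (rule kspaceD(1)[OF kspace_tensor])
  have fin: "finsum RH f A \<in> W" if "finite A" "\<And>a. a \<in> A \<Longrightarrow> f a \<in> W" for f and A :: "('h \<times> 'h) set"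
    using that
  proof (induction A rule: finite_induct)
    case empty
    then show ?case using W_closed(3) by simp
  next
    case (insert x A)
    then have "f x \<in> W" "finsum RH f A \<in> W" "f \<in> A \<rightarrow> carrier RH" "f x \<in> carrier RH"
      using subsetD[OF W_carrier] by (simp_all add: Pi_def)
    then show ?case using insert.hyps by (simp add: X.finsum_insert W_closed)
  qed
  show ?thesis
    unfolding sweedler_def tlift_def formal_sum_def by (intro fin W_closed assms) simp
qed

text \<open>The product of \<open>ten 1 v\<close> with \<open>ten c y\<close> has coefficients
  \<open>c\<close> times values of \<open>\<sigma>\<close>, which stay in \<open>B\<close>. Left
  multiplication by images of generators is all that the induction over words requires.\<close>

lemma W_mult:
  assumes "Q \<in> W"
  shows "ten 1 v \<otimes>\<^bsub>G.TA\<^esub> Q \<in> W"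
proof -
  have 1: "ten 1 v \<otimes>\<^bsub>G.TA\<^esub> ten c y \<in> W" if c: "c \<in> B" for c y
  proof -
    let ?F = "\<lambda>x1 x2 y1 y2. ten (c * \<sigma> x1 y1) (x2 * y2)"
    have cR: "c \<in> R" using c B_closed(5) by auto
    have FW: "sweedler H RH (?F x1 x2) y \<in> W" for x1 x2
      using c by (intro W_sweedler W_closed B_closed)
    have W2: "sweedler H RH (\<lambda>x1 x2. sweedler H RH (?F x1 x2) y) v \<in> W" by (rule W_sweedler[OF FW])
    have Fc: "?F x1 x2 y1 y2 \<in> carrier RH" for x1 x2 y1 y2 using cR G.\<tau>_in_R by (simp add: R_closed)
    have "ten 1 v \<otimes>\<^bsub>G.TA\<^esub> ten c y = sweedler H RH (\<lambda>x1 x2. sweedler H RH (?F x1 x2) y) v"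
    proof (rule RH_eqI)
      show "ten 1 v \<otimes>\<^bsub>G.TA\<^esub> ten c y \<in> carrier RH" by (simp add: G.TA_mult_carrier cR R_closed)
      show "sweedler H RH (\<lambda>x1 x2. sweedler H RH (?F x1 x2) y) v \<in> carrier RH" using W2 W_carrier by auto
      fix f assume f: "lin f"
      have lp: "lin (\<lambda>x. pair (ten c y) (conv2 \<sigma> (\<lambda>x y. f (x * y)) x))"
        by (rule lin_pair) (rule G.lin_mult_kernel[OF f])
      have "pair (ten 1 v \<otimes>\<^bsub>G.TA\<^esub> ten c y) f = c * conv2 \<sigma> (\<lambda>x y. f (x * y)) v y"
        by (simp add: G.pair_TA_mult cR R_closed f pair_fun_mult_left G.lin_mult_kernel[OF f])
      moreover have "pair (sweedler H RH (\<lambda>x1 x2. sweedler H RH (?F x1 x2) y) v) f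
          = S (\<lambda>x1 x2. S (\<lambda>y1 y2. c * \<sigma> x1 y1 * f (x2 * y2)) y) v"
        using FW W_carrier by (subst pair_sweedler(2)[OF _ f]) (auto simp: pair_sweedler(2)[OF Fc f] f)
      ultimately show "pair (ten 1 v \<otimes>\<^bsub>G.TA\<^esub> ten c y) f
          = pair (sweedler H RH (\<lambda>x1 x2. sweedler H RH (?F x1 x2) y) v) f"
        by (simp add: conv2_def S_mult_left[symmetric] mult.assoc)
    qed
    then show ?thesis using W2 by simp
  qed
  obtain q where q: "Q = tcoset RA HA q" "Poly_Mapping.keys q \<subseteq> B \<times> UNIV" using assms by (auto simp: W_def)
  have "ten 1 v \<otimes>\<^bsub>G.TA\<^esub> tcoset RA HA q \<in> W" using q(2)
  proof (induction rule: poly_mapping_induct_on)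
    case zero
    have z: "tcoset RA HA 0 \<in> carrier RH" by (rule tcoset_carrier) simp
    have "ten 1 v \<otimes>\<^bsub>G.TA\<^esub> tcoset RA HA 0 = tcoset RA HA 0"
    proof (rule RH_eqI)
      fix f assume f: "lin f"
      have p0: "pair (tcoset RA HA 0) k = 0" if "lin k" for k
        using linfun_zero[OF kspace_tensor linfun_pair[OF that]] by simp
      show "pair (ten 1 v \<otimes>\<^bsub>G.TA\<^esub> tcoset RA HA 0) f = pair (tcoset RA HA 0) f"
        using lin_pair[of "conv2 \<sigma> (\<lambda>x y. f (x * y))" "tcoset RA HA 0"] G.lin_mult_kernel[OF f]
        by (simp add: G.pair_TA_mult z R_closed f p0)
    qed (simp_all add: z G.TA_mult_carrier R_closed)
    then show ?case using W_closed(3) by simp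
  next
    case (add q a d)
    obtain c y where a: "a = (c, y)" "c \<in> B" using add.hyps by auto
    have cR: "c \<in> R" using a B_closed(5) by auto
    have qW: "tcoset RA HA q \<in> carrier RH" using add.hyps W_carrier by (auto simp: W_def)
    have eq: "tcoset RA HA (Poly_Mapping.single a d + q) = d \<odot>\<^bsub>RH\<^esub> ten c y \<oplus>\<^bsub>RH\<^esub> tcoset RA HA q"
      by (simp add: a tens_def)
    have "ten 1 v \<otimes>\<^bsub>G.TA\<^esub> (d \<odot>\<^bsub>RH\<^esub> ten c y \<oplus>\<^bsub>RH\<^esub> tcoset RA HA q)
        = d \<odot>\<^bsub>RH\<^esub> (ten 1 v \<otimes>\<^bsub>G.TA\<^esub> ten c y) \<oplus>\<^bsub>RH\<^esub> (ten 1 v \<otimes>\<^bsub>G.TA\<^esub> tcoset RA HA q)"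
    proof (rule RH_eqI)
      fix f assume f: "lin f"
      note lk = G.lin_mult_kernel[OF f]
      have lp: "lin (\<lambda>x. pair Q (conv2 \<sigma> (\<lambda>x y. f (x * y)) x))" for Q by (rule lin_pair) (rule lk)
      show "pair (ten 1 v \<otimes>\<^bsub>G.TA\<^esub> (d \<odot>\<^bsub>RH\<^esub> ten c y \<oplus>\<^bsub>RH\<^esub> tcoset RA HA q)) f
        = pair (d \<odot>\<^bsub>RH\<^esub> (ten 1 v \<otimes>\<^bsub>G.TA\<^esub> ten c y) \<oplus>\<^bsub>RH\<^esub> (ten 1 v \<otimes>\<^bsub>G.TA\<^esub> tcoset RA HA q)) f"
        by (simp add: G.pair_TA_mult G.TA_mult_carrier R_closed f cR qW lp lk pair_fun_add pair_fun_mult_left del: tensor_add tensor_smult)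
    qed (simp_all add: G.TA_mult_carrier R_closed cR qW del: tensor_add tensor_smult)
    then show ?case unfolding eq using 1[OF a(2)] add.IH by (simp add: W_closed del: tensor_add tensor_smult)
  qed
  then show ?thesis by (simp add: q)
qed

text \<open>Induction over words: the empty word gives the unit with coefficient
  \<open>ti 1\<close>, and prefixing a letter is left multiplication by
  \<open>ten 1 v\<close>.\<close>

lemma g_in_W: "P \<in> carrier T \<Longrightarrow> g P \<in> W"
proof (induction rule: T_induct)
  note h = alg_homD[OF g_hom, simplified]
  {
    case one
    then show ?case by (simp add: h W_closed B_closed)
  next
    case (gen v P)
    then show ?case by (simp add: h g_tgen W_mult)
  next
    case (add P P')
    then show ?case by (simp add: h W_closed)
  next
    case (scale c P)
    then show ?case by (simp add: h W_closed)
  }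
qed

lemma mus_gen: "mus (U_gen H \<alpha> h) = ten 1 h"
  by (simp add: U_gen_def mus_class g_tgen)

lemma mus_image: "mus ` carrier U \<subseteq> carrier (A_alg H \<iota> \<alpha> \<beta>)"
  using g_in_W by (auto simp: A_alg_def U_carrier mus_class S_Theta_eq W_def[symmetric])

end

theorem lemma8p1:
  fixes H :: "('k::field, 'h::ring_1) hopf_data"
    and \<alpha> \<beta> :: "'h \<Rightarrow> 'h \<Rightarrow> 'k"
    and \<iota> :: "('h list \<Rightarrow>\<^sub>0 'k) set set \<Rightarrow> 'f::field"
  assumes "infinite (UNIV :: 'k set)"
    and "hopf_algebra H"
    and "two_cocycle H (*) \<alpha>"
    and "normalized_cocycle H (*) \<alpha>"
    and "convolution_inverse H (*) \<alpha> \<beta>"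
    and "fraction_field (symmetric_algebra (hscale H)) \<iota>"
  shows "mu_sigma H \<iota> \<alpha> \<in> comodule_alg_hom H (U_alg H \<alpha>) (U_coaction H \<alpha>)
           (sigma_twisted H \<iota> \<alpha>) (tensor_coaction H (S_Theta H \<iota>)) \<and>
         inj_on (mu_sigma H \<iota> \<alpha>) (carrier (U_alg H \<alpha>)) \<and>
         (\<forall>h. mu_sigma H \<iota> \<alpha> (U_gen H \<alpha> h) = tens (S_Theta H \<iota>) (hopf_alg H) 1 h) \<and>
         mu_sigma H \<iota> \<alpha> ` carrier (U_alg H \<alpha>) \<subseteq> carrier (A_alg H \<iota> \<alpha> \<beta>)"
proof -
  interpret universal_cocycle H \<alpha> \<beta> \<iota> by (rule universal_cocycle.intro) (rule assms)+
  show ?thesis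
    unfolding sigma_twisted_eq S_Theta_eq using mus_comodule mus_inj mus_gen mus_image by blast
qed

end
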